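(* Let $\Omega \subseteq \mathbb{R}$ be a bounded Lebesgue measurable set such that $\Omega \cap (-\epsilon,\epsilon) = \emptyset$ for some $\epsilon > 0$, and let $A \subseteq \mathbb{R}\setminus\{0\}$ be a discrete set such that $A\cdot\Omega$ is a multiplicative tiling of $\mathbb{R}$ at level 1. Define the subsets of $(0,+\infty)$ $$\Omega^+ = \Omega\cap(0,+\infty),\quad \Omega^- = -(\Omega\cap(-\infty,0)),\quad A^+ = A\cap(0,+\infty),\quad A^- = -(A\cap(-\infty,0)).$$ Then: (i) If $\Omega$ is essentially symmetric, i.e. $|\Omega^+ \,\triangle\, \Omega^-| = 0$, then $A^+\cap A^- = \emptyset$ and the union $\log A^+ \cup \log A^-$ is periodic of the form $$\alpha\mathbb{Z} + \{r_1, r_2, \ldots, r_s\}, \quad \text{with } \alpha>0 \text{ and all differences } r_i - r_j \text{ rational multiples of } \alpha. \qquad ( * )$$ Moreover, the partition of the set $S = \log A^+\cup\log A^-$ into $\log A^+$ and $\log A^-$ can be completely arbitrary: for every partition $S = S^+ \sqcup S^-$ into two disjoint sets, with $A' = \exp(S^+) \cup (-\exp(S^-))$, $A'\cdot\Omega$ is also a multiplicative tiling of $\mathbb{R}$ at level 1. (ii) If $\Omega$ is not essentially symmetric, then the sets $\log A^+$ and $\log A^-$ are both periodic and of the form $( * )$ with the same period $\alpha$ (the numbers $s$ and $r_1,\dots,r_s$ may be different for the two sets).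
   Context: For a discrete set $A\subseteq\mathbb{R}\setminus\{0\}$ and a measurable set $\Omega\subseteq\mathbb{R}$, $A\cdot\Omega$ is called a (multiplicative) tiling of $\mathbb{R}$ at level $1$ if $\sum_{a\in A}\mathbf{1}_\Omega(a^{-1}x) = 1$ for almost every $x\in\mathbb{R}$; that is, almost every real number can be written uniquely as $a\omega$ with $a\in A$, $\omega\in\Omega$. Here $|\cdot|$ is Lebesgue measure, $\triangle$ is symmetric difference, and for $E\subseteq(0,+\infty)$, $\log E = \{\log x : x\in E\}$. In the form $( * )$, $s\ge 0$ is a finite integer; $s=0$ is allowed and gives the empty set. *)

theory Defs
  imports "HOL-Analysis.Analysis"
begin

(* The library predicate discrete only asks that every point of A is isolated in A, so A may
   accumulate at 0. For real values, has_sum forces the family of 0/1 terms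
   to be summable, so exactly one a \<in> A contributes for almost every x. *)
definition mult_tiling :: "real set \<Rightarrow> real set \<Rightarrow> bool" where
  "mult_tiling A \<Omega> \<longleftrightarrow>
     discrete A \<and> 0 \<notin> A \<and> \<Omega> \<in> sets lebesgue \<and>
     (AE x in lebesgue. ((\<lambda>a. indicat_real \<Omega> (inverse a * x)) has_sum 1) A)"

definition pos_half :: "real set \<Rightarrow> real set" where
  "pos_half E = E \<inter> {0<..}"

definition neg_half :: "real set \<Rightarrow> real set" where
  "neg_half E = uminus ` (E \<inter> {..<0})"

definition essentially_symmetric :: "real set \<Rightarrow> bool" where
  "essentially_symmetric \<Omega> \<longleftrightarrow>
     emeasure lebesgue (sym_diff (pos_half \<Omega>) (neg_half \<Omega>)) = 0"

(* R is the finite set {r_1, ..., r_s}; R = {} is the case s = 0. *)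
definition rational_periodic :: "real \<Rightarrow> real set \<Rightarrow> bool" where
  "rational_periodic \<alpha> T \<longleftrightarrow>
     \<alpha> > 0 \<and>
     (\<exists>R. finite R \<and>
          T = {\<alpha> * of_int k + r | k r. r \<in> R} \<and>
          (\<forall>r\<in>R. \<forall>r'\<in>R. \<exists>q\<in>\<rat>. r - r' = q * \<alpha>))"

end

theory Submission
  imports
    Defs
    "HOL-Complex_Analysis.Complex_Analysis"
    "HOL-Probability.Sinc_Integral"
    "HOL-Library.Poly_Mapping"
begin

text \<open>
In logarithmic coordinates, with \<open>P\<close>, \<open>Q\<close>, \<open>F\<close>, \<open>G\<close> the logarithms of \<open>A\<^sup>+\<close>, \<open>A\<^sup>-\<close>, \<open>\<Omega>\<^sup>+\<close>, \<open>\<Omega>\<^sup>-\<close>, the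
tiling says that \<open>P + F\<close> together with \<open>Q + G\<close>, and \<open>P + G\<close> together with \<open>Q + F\<close>, tile the line.
Adding and subtracting the two gives convolution equations for the counting measures
\<open>\<delta>\<^sub>P + \<delta>\<^sub>Q\<close> and \<open>\<delta>\<^sub>P - \<delta>\<^sub>Q\<close>, with compactly supported right factors whose Fourier transforms are
entire. On a bounded band such a transform has finitely many zeros, so the convolution of the
measure with a band-limited kernel solves a linear differential equation with constant coefficients
and real frequencies; being bounded, it is a trigonometric polynomial. Its almost periods \<open>t\<close> move
\<open>P\<close> and \<open>Q\<close> uniformly close to themselves. By Lebesgue density two uniformly close tilings by the
same tiles are translates of each other, so an almost period is turned into a true period.

Modulo the period, tilings by finitely many translates persist under dilation of the translation set
by any prime exceeding the number of translates, since the \<open>p\<close>-th convolution power is the dilate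
modulo \<open>p\<close>. An irrational difference would, after such dilations, bring two tiles arbitrarily
close, contradicting disjointness. When one of \<open>F\<close>, \<open>G\<close> is null the two copies of the line decouple,
and the two periods are commensurable because both are multiples of the measure of the tile.
\<close>

subsection \<open>Sums over uniformly discrete sets\<close>

text \<open>The tiles enter through the measure of their part in a moving unit interval. It depends
  continuously on the position, so the convolution equations hold at every point and no
  distributions are needed. The transform of such a function may vanish at complex points, but only
  its zeros on the segment \<open>[-R,R]\<close> obstruct division, because the kernels are
  integrals over that segment; hence the real frequencies. The band is compact but arbitrarily wide,
  so that a kernel can be peaked enough to detect single points of \<open>P\<close>. The equation
  for the sum does not separate \<open>P\<close> from \<open>Q\<close>. The equation for the
  difference does, and it is void exactly when the two tiles agree up to a null set. This is the
  dichotomy of the theorem: in the symmetric case all translates are merged into one copy with one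
  tile. An almost period must be common to \<open>P\<close> and \<open>Q\<close>, since rigidity
  compares whole tilings. Rigidity also needs every tile to have positive measure, which is why a
  null tile is treated apart.\<close>

lemma finite_sum_inverse_square_int_bound:
  obtains B :: real where "\<And>J::int set. finite J \<Longrightarrow> (\<Sum>m\<in>J. 1 / (1 + (of_int m)\<^sup>2)) \<le> B"
proof -
  let ?f = "\<lambda>n::nat. 1 / (1 + (real n)\<^sup>2)"
  have sm: "summable ?f"
  proof (rule summable_comparison_test_ev)
    show "summable (\<lambda>n. inverse ((real n)\<^sup>2))"
      using inverse_power_summable[of 2] by simp
    show "\<forall>\<^sub>F n in sequentially. norm (?f n) \<le> inverse ((real n)\<^sup>2)"
      by (intro eventually_sequentiallyI[of 1]) (auto simp: inverse_eq_divide intro!: divide_left_mono mult_pos_pos add_pos_nonneg)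
  qed
  have "(\<Sum>m\<in>J. 1 / (1 + (real_of_int m)\<^sup>2)) \<le> 2 * suminf ?f" if "finite J" for J :: "int set"
  proof -
    have part: "(\<Sum>m\<in>K. 1 / (1 + (real_of_int m)\<^sup>2)) \<le> suminf ?f"
      if K: "finite K" "inj_on (\<lambda>m. nat \<bar>m\<bar>) K" for K :: "int set"
    proof -
      have "(\<Sum>m\<in>K. 1 / (1 + (real_of_int m)\<^sup>2)) = (\<Sum>m\<in>K. ?f (nat \<bar>m\<bar>))"
        by (intro sum.cong) auto
      also have "\<dots> = sum ?f ((\<lambda>m. nat \<bar>m\<bar>) ` K)"
        using K by (simp add: sum.reindex)
      also have "\<dots> \<le> suminf ?f"
        using K by (intro sum_le_suminf sm) auto
      finally show ?thesis .
    qed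
    have "J = (J \<inter> {0..}) \<union> (J \<inter> {..<0})" by auto
    then have "(\<Sum>m\<in>J. 1 / (1 + (real_of_int m)\<^sup>2)) =
       (\<Sum>m\<in>J \<inter> {0..}. 1 / (1 + (real_of_int m)\<^sup>2)) + (\<Sum>m\<in>J \<inter> {..<0}. 1 / (1 + (real_of_int m)\<^sup>2))"
      by (subst sum.union_disjoint[symmetric]) (use that in auto)
    also have "\<dots> \<le> suminf ?f + suminf ?f"
      by (intro add_mono part) (use that in \<open>auto simp: inj_on_def\<close>)
    finally show ?thesis by simp
  qed
  then show ?thesis using that by blast
qed

text \<open>Rounding \<open>(p - x) / d\<close> down is injective on a \<open>d\<close>-separated
  set, which reduces the sum to one over the integers. The bound is the same for all
  \<open>x\<close>, so the convolutions below are bounded functions.\<close>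

lemma uniform_discrete_sum_bound:
  fixes P :: "real set"
  assumes "uniform_discrete P"
  obtains B where "B > 0" "\<And>x J. finite J \<Longrightarrow> J \<subseteq> P \<Longrightarrow> (\<Sum>p\<in>J. 1 / (1 + (x - p)\<^sup>2)) \<le> B"
proof -
  obtain d where d: "d > 0" "\<And>p q. p \<in> P \<Longrightarrow> q \<in> P \<Longrightarrow> dist p q < d \<Longrightarrow> p = q"
    using assms unfolding uniform_discrete_def by blast
  obtain B0 where B0: "\<And>J::int set. finite J \<Longrightarrow> (\<Sum>m\<in>J. 1 / (1 + (of_int m :: real)\<^sup>2)) \<le> B0"
    using finite_sum_inverse_square_int_bound by blast
  have B00: "B0 \<ge> 0" using B0[of "{}"] by simp
  \<comment> \<open>With \<open>y = (p - x) / d\<close>, the rounding \<open>m p\<close> satisfies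
    \<open>1 + m^2 <= 1 + (|y| + 1)^2 <= 3 + 2 y^2\<close>.\<close>
  define c where "c = 3 + 2 / d\<^sup>2"
  have c: "c > 0" unfolding c_def by (simp add: add_pos_nonneg)
  have "(\<Sum>p\<in>J. 1 / (1 + (x - p)\<^sup>2)) \<le> c * B0 + 1" if J: "finite J" "J \<subseteq> P" for x J
  proof -
    define m where "m p = \<lfloor>(p - x) / d\<rfloor>" for p
    have inj: "inj_on m J"
    proof (rule inj_onI)
      fix p q assume pq: "p \<in> J" "q \<in> J" "m p = m q"
      have "\<bar>(p - x) / d - (q - x) / d\<bar> < 1"
        using pq(3) unfolding m_def by linarith
      then have "\<bar>p - q\<bar> < d"
        using d(1) by (simp add: diff_divide_distrib[symmetric] abs_divide)
      then show "p = q" using d(2)[of p q] pq J by (auto simp: dist_real_def)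
    qed
    have bd: "1 / (1 + (x - p)\<^sup>2) \<le> c * (1 / (1 + (of_int (m p))\<^sup>2))" for p
    proof -
      let ?y = "(p - x) / d" and ?m = "real_of_int (m p)"
      have "\<bar>?m\<bar> \<le> \<bar>?y\<bar> + 1" unfolding m_def by linarith
      then have "?m\<^sup>2 \<le> (\<bar>?y\<bar> + 1)\<^sup>2" by (metis abs_ge_zero power2_abs power_mono)
      also have "\<dots> \<le> 2 * \<bar>?y\<bar>\<^sup>2 + 2"
        using zero_le_power2[of "\<bar>?y\<bar> - 1"] unfolding power2_sum power2_diff power_one by linarith
      also have "\<bar>?y\<bar>\<^sup>2 = ?y\<^sup>2" by (rule power2_abs)
      finally have "1 + ?m\<^sup>2 \<le> 3 + 2 / d\<^sup>2 * (x - p)\<^sup>2"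
        by (simp add: power_divide power2_commute)
      also have "\<dots> \<le> c * (1 + (x - p)\<^sup>2)"
        unfolding c_def distrib_left distrib_right by simp
      finally have "1 + ?m\<^sup>2 \<le> c * (1 + (x - p)\<^sup>2)" .
      then show ?thesis
        by (simp add: field_simps add_pos_nonneg)
    qed
    have "(\<Sum>p\<in>J. 1 / (1 + (x - p)\<^sup>2)) \<le> (\<Sum>p\<in>J. c * (1 / (1 + (of_int (m p))\<^sup>2)))"
      by (intro sum_mono bd)
    also have "\<dots> = c * (\<Sum>i\<in>m ` J. 1 / (1 + (of_int i)\<^sup>2))"
      by (simp add: sum.reindex[OF inj] sum_distrib_left)
    also have "\<dots> \<le> c * B0"
      using B0[of "m ` J"] c J(1) by simp
    finally show ?thesis by simp
  qed
  moreover have "c * B0 + 1 > 0" using c B00 by (simp add: add_nonneg_pos)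
  ultimately show ?thesis using that by blast
qed

text \<open>The decay produced by two integrations by parts; it suffices for absolute summation over
  a uniformly discrete set and for integrability.\<close>

definition quad_decay :: "(real \<Rightarrow> complex) \<Rightarrow> bool" where
  "quad_decay k \<longleftrightarrow> (\<exists>C. \<forall>x. norm (k x) \<le> C / (1 + x\<^sup>2))"

lemma quad_decayE:
  assumes "quad_decay k"
  obtains C where "C > 0" "\<And>x. norm (k x) \<le> C / (1 + x\<^sup>2)"
proof -
  obtain C where C: "\<And>x. norm (k x) \<le> C / (1 + x\<^sup>2)"
    using assms unfolding quad_decay_def by blast
  have "norm (k x) \<le> (\<bar>C\<bar> + 1) / (1 + x\<^sup>2)" for x
    by (rule order_trans[OF C]) (auto intro!: divide_right_mono)
  then show ?thesis using that[of "\<bar>C\<bar> + 1"] by simp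
qed

text \<open>The convolution of the counting measure of \<open>P\<close> with \<open>k\<close>. Since
  \<open>infsum\<close> is 0 without summability, it is always used together with
  \<open>quad_decay_summable\<close>.\<close>

definition set_conv :: "real set \<Rightarrow> (real \<Rightarrow> complex) \<Rightarrow> real \<Rightarrow> complex" where
  "set_conv P k x = (\<Sum>\<^sub>\<infinity>p\<in>P. k (x - p))"

lemma quad_decay_summable:
  assumes "uniform_discrete P" "quad_decay k"
  shows "(\<lambda>p. norm (k (x - p))) summable_on P"
proof -
  obtain B where B: "\<And>x J. finite J \<Longrightarrow> J \<subseteq> P \<Longrightarrow> (\<Sum>p\<in>J. 1 / (1 + (x - p)\<^sup>2)) \<le> B"
    using uniform_discrete_sum_bound[OF assms(1)] by metis
  obtain C where C: "C > 0" "\<And>x. norm (k x) \<le> C / (1 + x\<^sup>2)"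
    using quad_decayE[OF assms(2)] by blast
  show ?thesis
  proof (rule nonneg_bdd_above_summable_on)
    have "(\<Sum>p\<in>J. norm (k (x - p))) \<le> C * B" if "finite J" "J \<subseteq> P" for J
    proof -
      have "(\<Sum>p\<in>J. norm (k (x - p))) \<le> (\<Sum>p\<in>J. C * (1 / (1 + (x - p)\<^sup>2)))"
        using C by (intro sum_mono) (metis times_divide_eq_right mult.right_neutral)
      also have "\<dots> \<le> C * B"
        unfolding sum_distrib_left[symmetric] using B[OF that, of x] C(1) by (intro mult_left_mono) auto
      finally show ?thesis .
    qed
    then show "bdd_above (sum (\<lambda>p. norm (k (x - p))) ` {J. J \<subseteq> P \<and> finite J})"
      by (intro bdd_aboveI[of _ "C * B"]) auto
  qed auto
qed

lemma norm_infsum_le_bound: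
  fixes f :: "real \<Rightarrow> complex"
  assumes "\<And>J. finite J \<Longrightarrow> J \<subseteq> P \<Longrightarrow> (\<Sum>p\<in>J. norm (f p)) \<le> b"
  shows "norm (infsum f P) \<le> b"
proof -
  have s: "(\<lambda>p. norm (f p)) summable_on P"
    by (rule nonneg_bdd_above_summable_on) (use assms in \<open>auto intro!: bdd_aboveI[of _ b]\<close>)
  have "norm (infsum f P) \<le> infsum (\<lambda>p. norm (f p)) P"
    by (rule norm_infsum_bound[OF s])
  also have "\<dots> \<le> b"
    by (rule infsum_le_finite_sums[OF s]) (use assms in auto)
  finally show ?thesis .
qed

lemma set_conv_bound:
  fixes f :: "real \<Rightarrow> complex"
  assumes P: "\<And>x J. finite J \<Longrightarrow> J \<subseteq> P \<Longrightarrow> (\<Sum>p\<in>J. 1 / (1 + (x - p)\<^sup>2)) \<le> B"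
    and C: "C \<ge> 0" "\<And>p. p \<in> P \<Longrightarrow> norm (f p) \<le> C / (1 + (x - p)\<^sup>2)"
  shows "norm (infsum f P) \<le> C * B"
proof (rule norm_infsum_le_bound)
  fix J assume J: "finite J" "J \<subseteq> P"
  have "(\<Sum>p\<in>J. norm (f p)) \<le> (\<Sum>p\<in>J. C * (1 / (1 + (x - p)\<^sup>2)))"
    using C J by (intro sum_mono) auto
  also have "\<dots> \<le> C * B"
    unfolding sum_distrib_left[symmetric] using P[OF J, of x] C(1) by (intro mult_left_mono)
  finally show "(\<Sum>p\<in>J. norm (f p)) \<le> C * B" .
qed

lemma set_conv_bounded:
  assumes "uniform_discrete P" "quad_decay k"
  obtains M where "\<And>x. norm (set_conv P k x) \<le> M"
proof -
  obtain B where B: "\<And>x J. finite J \<Longrightarrow> J \<subseteq> P \<Longrightarrow> (\<Sum>p\<in>J. 1 / (1 + (x - p)\<^sup>2)) \<le> B"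
    using uniform_discrete_sum_bound[OF assms(1)] by metis
  obtain C where C: "C > 0" "\<And>x. norm (k x) \<le> C / (1 + x\<^sup>2)"
    using quad_decayE[OF assms(2)] by blast
  have "norm (set_conv P k x) \<le> C * B" for x
    unfolding set_conv_def by (rule set_conv_bound[where x=x, OF B]) (use C in auto)
  then show ?thesis using that by blast
qed

text \<open>The mean value inequality is applied twice, to \<open>k'\<close> and then to
  \<open>k y - y k' x\<close> as a function of \<open>y\<close>. The values are complex, so there is
  no Lagrange remainder, and the factor 1/2 is given up.\<close>

lemma taylor_first_order_bound:
  fixes k :: "real \<Rightarrow> complex"
  assumes k': "\<And>x. (k has_vector_derivative k' x) (at x)"
    and k'': "\<And>x. (k' has_vector_derivative k'' x) (at x)"
    and b: "\<And>y. y \<in> closed_segment x (x + h) \<Longrightarrow> norm (k'' y) \<le> b"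
  shows "norm (k (x + h) - k x - of_real h * k' x) \<le> b * h\<^sup>2"
proof -
  let ?S = "closed_segment x (x + h)"
  have dist: "norm (y - x) \<le> \<bar>h\<bar>" if "y \<in> ?S" for y
    using that by (auto simp: closed_segment_eq_real_ivl split: if_splits)
  have b0: "b \<ge> 0" using b[of x] norm_ge_zero[of "k'' x"] by (meson ends_in_segment(1) order_trans)
  have 1: "norm (k' y - k' x) \<le> b * \<bar>h\<bar>" if y: "y \<in> ?S" for y
  proof -
    have "norm (k' y - k' x) \<le> b * norm (y - x)"
    proof (rule differentiable_bound[where S = ?S and f' = "\<lambda>y t. t *\<^sub>R k'' y"])
      fix z assume z: "z \<in> ?S"
      show "(k' has_derivative (\<lambda>t. t *\<^sub>R k'' z)) (at z within ?S)"
        using k''[of z] unfolding has_vector_derivative_def by (rule has_derivative_at_withinI)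
      show "onorm (\<lambda>t. t *\<^sub>R k'' z) \<le> b"
        by (rule onorm_le) (use b[OF z] in \<open>auto simp: mult.commute[of _ "\<bar>_\<bar>"] intro!: mult_left_mono\<close>)
    qed (use y in auto)
    also have "\<dots> \<le> b * \<bar>h\<bar>" using dist[OF y] b0 by (rule mult_left_mono)
    finally show ?thesis .
  qed
  have "norm ((k (x + h) - (x + h) *\<^sub>R k' x) - (k x - x *\<^sub>R k' x)) \<le> (b * \<bar>h\<bar>) * norm ((x + h) - x)"
  proof (rule differentiable_bound[where S = ?S and f = "\<lambda>y. k y - y *\<^sub>R k' x" and f' = "\<lambda>y t. t *\<^sub>R (k' y - k' x)"])
    fix z assume z: "z \<in> ?S"
    have "((\<lambda>y. k y - y *\<^sub>R k' x) has_vector_derivative (k' z - k' x)) (at z)"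
      using k'[of z] by (auto intro!: derivative_eq_intros)
    then show "((\<lambda>y. k y - y *\<^sub>R k' x) has_derivative (\<lambda>t. t *\<^sub>R (k' z - k' x))) (at z within ?S)"
      unfolding has_vector_derivative_def by (rule has_derivative_at_withinI)
    show "onorm (\<lambda>t. t *\<^sub>R (k' z - k' x)) \<le> b * \<bar>h\<bar>"
      by (rule onorm_le) (use 1[OF z] in \<open>auto simp: mult.commute[of _ "\<bar>_\<bar>"] intro!: mult_left_mono\<close>)
  qed auto
  then show ?thesis
    by (simp add: algebra_simps power2_eq_square scaleR_conv_of_real abs_mult_self_eq)
qed

text \<open>The Taylor remainder of the term at \<open>p\<close> is of order
  \<open>h^2 / (1 + (x - p)^2)\<close>, so the remainders sum to order \<open>h^2\<close>
  uniformly.\<close>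

lemma set_conv_has_vector_derivative:
  assumes P: "uniform_discrete P"
    and k': "\<And>x. (k has_vector_derivative k' x) (at x)"
    and k'': "\<And>x. (k' has_vector_derivative k'' x) (at x)"
    and decay: "quad_decay k" "quad_decay k'" "quad_decay k''"
  shows "(set_conv P k has_vector_derivative set_conv P k' x) (at x)"
proof -
  obtain B where B: "B > 0" "\<And>x J. finite J \<Longrightarrow> J \<subseteq> P \<Longrightarrow> (\<Sum>p\<in>J. 1 / (1 + (x - p)\<^sup>2)) \<le> B"
    using uniform_discrete_sum_bound[OF P] by metis
  obtain C where C: "C > 0" "\<And>x. norm (k'' x) \<le> C / (1 + x\<^sup>2)"
    using quad_decayE[OF decay(3)] by blast
  \<comment> \<open>From \<open>y^2 <= 2 z^2 + 2 (z - y)^2\<close> and \<open>|z - y| <= 1\<close>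
    follows \<open>1 + y^2 <= 3 (1 + z^2)\<close>; hence the factor 3.\<close>
  have near: "norm (k'' z) \<le> 3 * C / (1 + y\<^sup>2)" if "\<bar>h\<bar> \<le> 1" "z \<in> closed_segment y (y + h)" for y z h
  proof -
    have zy: "\<bar>z - y\<bar> \<le> 1" using that by (auto simp: closed_segment_eq_real_ivl split: if_splits)
    define w where "w = (z - y)\<^sup>2"
    have "y\<^sup>2 \<le> 2 * z\<^sup>2 + 2 * w"
      using zero_le_power2[of "2 * z - y"] unfolding w_def by (simp add: power2_eq_square algebra_simps)
    moreover have "w \<le> 1" unfolding w_def using zy by (simp add: abs_square_le_1)
    moreover have "0 \<le> z\<^sup>2" by simp
    ultimately have "1 + y\<^sup>2 \<le> 3 * (1 + z\<^sup>2)" unfolding distrib_left by linarith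
    then have "C * (1 + y\<^sup>2) \<le> C * (3 * (1 + z\<^sup>2))" using C(1) by (intro mult_left_mono) auto
    then have "C / (1 + z\<^sup>2) \<le> 3 * C / (1 + y\<^sup>2)"
      by (simp add: field_simps add_pos_nonneg)
    then show ?thesis using C(2)[of z] by linarith
  qed
  have main: "norm (set_conv P k (x + h) - set_conv P k x - of_real h * set_conv P k' x) \<le> 3 * C * B * h\<^sup>2"
    if h: "\<bar>h\<bar> \<le> 1" for h
  proof -
    have s: "(\<lambda>p. k (x + h - p)) summable_on P" "(\<lambda>p. k (x - p)) summable_on P" "(\<lambda>p. k' (x - p)) summable_on P"
      using quad_decay_summable[OF P] decay by (auto intro: abs_summable_summable)
    have "set_conv P k (x + h) - set_conv P k x - of_real h * set_conv P k' x
        = (\<Sum>\<^sub>\<infinity>p\<in>P. k (x + h - p) - k (x - p) - of_real h * k' (x - p))"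
      unfolding set_conv_def using s
      unfolding diff_conv_add_uminus
      by (intro infsumI[symmetric] has_sum_add has_sum_uminusI has_sum_cmult_right has_sum_infsum) auto
    also have "norm \<dots> \<le> (3 * C * h\<^sup>2) * B"
    proof (rule set_conv_bound[where x=x, OF B(2)])
      fix p assume "p \<in> P"
      have "norm (k ((x - p) + h) - k (x - p) - of_real h * k' (x - p)) \<le> 3 * C / (1 + (x - p)\<^sup>2) * h\<^sup>2"
        by (rule taylor_first_order_bound[OF k' k'']) (use near[OF h] in auto)
      then show "norm (k (x + h - p) - k (x - p) - of_real h * k' (x - p)) \<le> 3 * C * h\<^sup>2 / (1 + (x - p)\<^sup>2)"
        by (simp add: algebra_simps)
    qed (use C in auto)
    finally show ?thesis by (simp add: mult_ac)
  qed
  show ?thesis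
    unfolding has_vector_derivative_def has_derivative_at_alt
  proof (intro conjI allI impI bounded_linear_scaleR_left)
    fix e :: real assume e: "e > 0"
    define d where "d = min 1 (e / (3 * C * B))"
    have d: "d > 0" using e C(1) B(1) unfolding d_def by simp
    have "norm (set_conv P k y - set_conv P k x - (y - x) *\<^sub>R set_conv P k' x) \<le> e * norm (y - x)"
      if "norm (y - x) < d" for y
    proof -
      have "norm (set_conv P k (x + (y - x)) - set_conv P k x - of_real (y - x) * set_conv P k' x) \<le> 3 * C * B * (y - x)\<^sup>2"
        using that unfolding d_def by (intro main) auto
      also have "\<dots> = (3 * C * B * \<bar>y - x\<bar>) * \<bar>y - x\<bar>" by (simp add: power2_eq_square mult.assoc abs_mult_self_eq)
      also have "\<dots> \<le> e * \<bar>y - x\<bar>"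
      proof (rule mult_right_mono)
        have "\<bar>y - x\<bar> \<le> e / (3 * C * B)" using that unfolding d_def by simp
        then show "3 * C * B * \<bar>y - x\<bar> \<le> e" using C(1) B(1) by (simp add: field_simps)
      qed auto
      finally show ?thesis by (simp add: scaleR_conv_of_real)
    qed
    then show "\<exists>d>0. \<forall>y. norm (y - x) < d \<longrightarrow> norm (set_conv P k y - set_conv P k x - (y - x) *\<^sub>R set_conv P k' x) \<le> e * norm (y - x)"
      using d by blast
  qed
qed

subsection \<open>Band-limited kernels\<close>

text \<open>The inverse Fourier transform, up to normalization, of \<open>G\<close> cut to the band
  \<open>[-R,R]\<close>. The argument of \<open>G\<close> is complex so that zeros of entire
  functions can be divided out.\<close>

definition kern :: "real \<Rightarrow> (complex \<Rightarrow> complex) \<Rightarrow> real \<Rightarrow> complex" where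
  "kern R G x = integral {-R..R} (\<lambda>t. G (of_real t) * exp (\<i> * of_real (t * x)))"

text \<open>The double zeros at both ends kill the boundary terms of two integrations by parts,
  which gives quadratic decay.\<close>

definition cutoff :: "real \<Rightarrow> (complex \<Rightarrow> complex) \<Rightarrow> bool" where
  "cutoff R G \<longleftrightarrow> (\<exists>U. open U \<and> of_real ` {-R..R} \<subseteq> U \<and> G holomorphic_on U) \<and>
     (\<forall>z\<in>{of_real R, - of_real R}. G z = 0 \<and> deriv G z = 0)"

lemma cutoff_mult:
  assumes "R \<ge> 0" "cutoff R G" "open U" "of_real ` {-R..R} \<subseteq> U" "g holomorphic_on U"
  shows "cutoff R (\<lambda>z. g z * G z)"
proof -
  obtain V where V: "open V" "of_real ` {-R..R} \<subseteq> V" "G holomorphic_on V"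
    using assms(2) unfolding cutoff_def by blast
  have W: "open (U \<inter> V)" "of_real ` {-R..R} \<subseteq> U \<inter> V" "(\<lambda>z. g z * G z) holomorphic_on (U \<inter> V)"
    using V assms by (auto intro!: holomorphic_intros elim: holomorphic_on_subset)
  have "g z * G z = 0 \<and> deriv (\<lambda>z. g z * G z) z = 0" if z: "z \<in> {of_real R, - of_real R}" for z
  proof -
    have "z \<in> of_real ` {-R..R}" using z assms(1) by (force simp flip: of_real_minus)
    then have "g field_differentiable (at z)" "G field_differentiable (at z)"
      using assms V by (auto intro: holomorphic_on_imp_differentiable_at)
    then have "deriv (\<lambda>z. g z * G z) z = g z * deriv G z + deriv g z * G z"
      by (rule deriv_mult)
    then show ?thesis using assms(2) z unfolding cutoff_def by auto
  qed
  then show ?thesis unfolding cutoff_def using W by blast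
qed

lemma cutoff_continuous:
  assumes "cutoff R G"
  shows "continuous_on {-R..R} (\<lambda>t. G (of_real t))"
proof -
  obtain V where V: "open V" "of_real ` {-R..R} \<subseteq> V" "G holomorphic_on V"
    using assms(1) unfolding cutoff_def by blast
  have "continuous_on (of_real ` {-R..R}) G"
    by (rule continuous_on_subset[OF holomorphic_on_imp_continuous_on[OF V(3)] V(2)])
  then show ?thesis
    by (rule continuous_on_compose2) (auto intro!: continuous_intros)
qed

text \<open>The derivatives are parameters, to be instantiated by \<open>deriv\<close> in general
  and by explicit polynomials for the concrete kernel.\<close>

lemma kern_by_parts:
  assumes R: "R \<ge> 0"
    and G1: "\<And>t. t \<in> {-R..R} \<Longrightarrow> (G has_field_derivative G1 (of_real t)) (at (of_real t))"
    and G2: "\<And>t. t \<in> {-R..R} \<Longrightarrow> (G1 has_field_derivative G2 (of_real t)) (at (of_real t))"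
    and cont: "continuous_on {-R..R} (\<lambda>t. G2 (of_real t))"
    and z: "\<And>z. z \<in> {of_real R, - of_real R} \<Longrightarrow> G z = 0 \<and> G1 z = 0"
  shows "(of_real x)\<^sup>2 * kern R G x = - kern R G2 x"
proof -
  \<comment> \<open>One antiderivative for both integrations by parts: in its derivative the terms
    with \<open>G1\<close> cancel, and division by \<open>x\<close> is avoided.\<close>
  define F where "F z = exp (\<i> * z * of_real x) * (\<i> * of_real x * G z - G1 z)" for z :: complex
  have FR: "F (of_real R) = 0" "F (of_real (-R)) = 0" using z unfolding F_def by auto
  let ?e = "\<lambda>t::real. exp (\<i> * of_real (t * x))"
  have "((\<lambda>t. F (of_real t)) has_vector_derivative
      (- ((of_real x)\<^sup>2 * (G (of_real t) * ?e t)) - G2 (of_real t) * ?e t)) (at t within {-R..R})"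
    if "t \<in> {-R..R}" for t
  proof (rule has_vector_derivative_real_field)
    let ?z = "complex_of_real t" and ?x = "complex_of_real x"
    have "((\<lambda>z. exp (\<i> * z * ?x)) has_field_derivative exp (\<i> * ?z * ?x) * (\<i> * ?x)) (at ?z)"
      by (auto intro!: derivative_eq_intros)
    then have "(F has_field_derivative exp (\<i> * ?z * ?x) * (\<i> * ?x) * (\<i> * ?x * G ?z - G1 ?z) +
        (\<i> * ?x * G1 ?z - G2 ?z) * exp (\<i> * ?z * ?x)) (at ?z)"
      unfolding F_def by (intro DERIV_mult DERIV_diff DERIV_cmult G1 G2 that)
    then show "(F has_field_derivative - (?x\<^sup>2 * (G ?z * ?e t)) - G2 ?z * ?e t) (at ?z)"
      by (rule DERIV_cong) (simp add: algebra_simps power2_eq_square)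
  qed
  then have FTC: "((\<lambda>t. - ((of_real x)\<^sup>2 * (G (of_real t) * ?e t)) - G2 (of_real t) * ?e t) has_integral F (of_real R) - F (of_real (-R))) {-R..R}"
    using R by (intro fundamental_theorem_of_calculus) auto
  have "continuous_on {-R..R} (\<lambda>t. G (of_real t))"
  proof (rule continuous_on_compose2[of "of_real ` {-R..R}" G])
    show "continuous_on (of_real ` {-R..R}) G"
      by (rule continuous_at_imp_continuous_on) (use DERIV_isCont[OF G1] in auto)
  qed (auto intro!: continuous_intros)
  then have i: "(\<lambda>t. G (of_real t) * ?e t) integrable_on {-R..R}" "(\<lambda>t. G2 (of_real t) * ?e t) integrable_on {-R..R}"
    using cont by (auto intro!: integrable_continuous_interval continuous_intros)
  have "integral {-R..R} (\<lambda>t. - ((of_real x)\<^sup>2 * (G (of_real t) * ?e t)) - G2 (of_real t) * ?e t)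
     = - ((of_real x)\<^sup>2 * kern R G x) - kern R G2 x"
    unfolding kern_def using i by (subst integral_diff) (auto intro!: integrable_neg integrable_on_mult_right)
  with FTC FR have "- ((of_real x)\<^sup>2 * kern R G x) - kern R G2 x = 0"
    using integral_unique[OF FTC] by simp
  then show ?thesis by algebra
qed

lemma norm_kern_le:
  assumes "R \<ge> 0" "continuous_on {-R..R} (\<lambda>t. G (of_real t))" "\<And>t. t \<in> {-R..R} \<Longrightarrow> norm (G (of_real t)) \<le> M"
  shows "norm (kern R G x) \<le> 2 * R * M"
proof -
  have "norm (kern R G x) \<le> M * (R - (-R))"
    unfolding kern_def
    by (rule integral_bound) (use assms in \<open>auto intro!: continuous_intros simp: norm_mult norm_exp_i_times\<close>)
  then show ?thesis by (simp add: algebra_simps)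
qed

lemma kern_quad_decay:
  assumes R: "R \<ge> 0" and G: "cutoff R G"
  shows "quad_decay (kern R G)"
proof -
  obtain U where U: "open U" "of_real ` {-R..R} \<subseteq> U" "G holomorphic_on U"
    using G unfolding cutoff_def by blast
  have hol: "deriv G holomorphic_on U" "deriv (deriv G) holomorphic_on U"
    by (intro holomorphic_deriv U)+
  have c2: "continuous_on {-R..R} (\<lambda>t. deriv (deriv G) (of_real t))"
    by (rule continuous_on_compose2[OF holomorphic_on_imp_continuous_on[OF hol(2)]])
      (use U(2) in \<open>auto intro!: continuous_intros\<close>)
  note c0 = cutoff_continuous[OF G]
  have bdd: "\<exists>M. \<forall>t\<in>{-R..R}. norm (f t) \<le> M" if "continuous_on {-R..R} f" for f :: "real \<Rightarrow> complex"
  proof -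
    have "bounded (f ` {-R..R})"
      using that by (intro compact_imp_bounded compact_continuous_image) auto
    then show ?thesis by (auto simp: bounded_iff)
  qed
  obtain M0 M2 where M: "\<And>t. t \<in> {-R..R} \<Longrightarrow> norm (G (of_real t)) \<le> M0"
      "\<And>t. t \<in> {-R..R} \<Longrightarrow> norm (deriv (deriv G) (of_real t)) \<le> M2"
    using bdd[OF c0] bdd[OF c2] by blast
  have "norm (kern R G x) \<le> (2 * R * M0 + 2 * R * M2) / (1 + x\<^sup>2)" for x
  proof -
    have "(of_real x)\<^sup>2 * kern R G x = - kern R (deriv (deriv G)) x"
    proof (rule kern_by_parts[OF R _ _ c2])
      fix t assume "t \<in> {-R..R}"
      then have t: "of_real t \<in> U" using U(2) by auto
      show "(G has_field_derivative deriv G (of_real t)) (at (of_real t))"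
        by (rule holomorphic_derivI[OF U(3,1) t])
      show "(deriv G has_field_derivative deriv (deriv G) (of_real t)) (at (of_real t))"
        by (rule holomorphic_derivI[OF hol(1) U(1) t])
    qed (use G in \<open>auto simp: cutoff_def\<close>)
    then have "norm ((of_real x)\<^sup>2 * kern R G x) = norm (kern R (deriv (deriv G)) x)" by simp
    then have "x\<^sup>2 * norm (kern R G x) = norm (kern R (deriv (deriv G)) x)"
      by (simp add: norm_mult norm_power)
    moreover have "norm (kern R (deriv (deriv G)) x) \<le> 2 * R * M2"
      by (rule norm_kern_le[OF R c2 M(2)])
    moreover have "norm (kern R G x) \<le> 2 * R * M0"
      by (rule norm_kern_le[OF R c0 M(1)])
    ultimately have "norm (kern R G x) * (1 + x\<^sup>2) \<le> 2 * R * M0 + 2 * R * M2"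
      by (simp add: algebra_simps)
    then show ?thesis by (simp add: pos_le_divide_eq add_pos_nonneg)
  qed
  then show ?thesis unfolding quad_decay_def by blast
qed

lemma kern_has_vector_derivative:
  assumes "continuous_on {-R..R} (\<lambda>t. G (of_real t))"
  shows "(kern R G has_vector_derivative kern R (\<lambda>z. \<i> * z * G z) x) (at x)"
proof -
  have "((\<lambda>x. integral (cbox (-R) R) (\<lambda>t. G (of_real t) * exp (\<i> * of_real (t * x)))) has_vector_derivative
     integral (cbox (-R) R) (\<lambda>t. \<i> * of_real t * G (of_real t) * exp (\<i> * of_real (t * x)))) (at x within UNIV)"
  proof (rule leibniz_rule_vector_derivative)
    fix x t :: real
    have "((\<lambda>z. G (of_real t) * exp (\<i> * (of_real t * z))) has_field_derivative
       \<i> * of_real t * G (of_real t) * exp (\<i> * (of_real t * of_real x))) (at (of_real x))"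
      by (auto intro!: derivative_eq_intros)
    from has_vector_derivative_real_field[OF this]
    show "((\<lambda>x. G (of_real t) * exp (\<i> * of_real (t * x))) has_vector_derivative
        \<i> * of_real t * G (of_real t) * exp (\<i> * of_real (t * x))) (at x within UNIV)"
      by simp
    show "(\<lambda>t. G (of_real t) * exp (\<i> * of_real (t * x))) integrable_on cbox (-R) R"
      using assms by (auto intro!: integrable_continuous_interval continuous_intros)
  next
    have "continuous_on (UNIV \<times> cbox (-R) R) (\<lambda>p. G (of_real (snd p)))"
      by (rule continuous_on_compose2[OF assms]) (auto intro!: continuous_intros)
    then show "continuous_on (UNIV \<times> cbox (-R) R)
      (\<lambda>(x, t). \<i> * of_real t * G (of_real t) * exp (\<i> * of_real (t * x)))"
      unfolding case_prod_unfold by (intro continuous_intros)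
  qed auto
  then show ?thesis unfolding kern_def[abs_def] by simp
qed

lemma kern_continuous:
  assumes "continuous_on {-R..R} (\<lambda>t. G (of_real t))"
  shows "continuous_on S (kern R G)"
  using kern_has_vector_derivative[OF assms]
  by (intro continuous_at_imp_continuous_on) (blast intro: has_vector_derivative_continuous)

lemma set_conv_kern_has_vector_derivative:
  assumes P: "uniform_discrete P" and R: "R \<ge> 0" and G: "cutoff R G"
  shows "(set_conv P (kern R G) has_vector_derivative set_conv P (kern R (\<lambda>z. \<i> * z * G z)) x) (at x)"
proof -
  have 1: "cutoff R (\<lambda>z. \<i> * z * G z)"
    using cutoff_mult[OF R G, of UNIV "\<lambda>z. \<i> * z"] by (auto intro!: holomorphic_intros)
  have 2: "cutoff R (\<lambda>z. \<i> * z * (\<i> * z * G z))"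
    using cutoff_mult[OF R 1, of UNIV "\<lambda>z. \<i> * z"] by (auto intro!: holomorphic_intros)
  show ?thesis
    by (rule set_conv_has_vector_derivative[OF P, where k'' = "kern R (\<lambda>z. \<i> * z * (\<i> * z * G z))"])
      (auto intro!: kern_has_vector_derivative cutoff_continuous kern_quad_decay G R 1 2)
qed

lemma quad_decay_integrable:
  assumes "continuous_on UNIV k" "quad_decay k"
  shows "integrable lborel k"
proof -
  obtain C where C: "C > 0" "\<And>x. norm (k x) \<le> C / (1 + x\<^sup>2)"
    using quad_decayE[OF assms(2)] by blast
  have "integrable lborel (\<lambda>x::real. inverse (1 + x\<^sup>2))"
    using integrable_inverse_1_plus_square by (simp add: set_integrable_def einterval_def)
  then have "integrable lborel (\<lambda>x::real. C * inverse (1 + x\<^sup>2))" by simp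
  then show ?thesis
  proof (rule Bochner_Integration.integrable_bound)
    show "k \<in> borel_measurable lborel"
      using borel_measurable_continuous_onI[OF assms(1)] by simp
    have "norm (k x) \<le> norm (C * inverse (1 + x\<^sup>2))" for x
      using order_trans[OF C(2)[of x] abs_ge_self] by (simp add: divide_inverse)
    then show "AE x in lborel. norm (k x) \<le> norm (C * inverse (1 + x\<^sup>2))" by simp
  qed
qed

lemma uniform_discrete_Int_bounded_finite:
  fixes P :: "real set"
  assumes "uniform_discrete P" "bounded B"
  shows "finite (P \<inter> B)"
proof -
  have "uniform_discrete (P \<inter> B) \<and> bounded (P \<inter> B)"
    using uniform_discrete_subset[OF assms(1), of "P \<inter> B"] bounded_Int[of P B] assms(2) by simp
  then show ?thesis by (simp only: uniform_discrete_finite_iff)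
qed

text \<open>Replaces the net of finite subsets by a sequence, as required by dominated
  convergence.\<close>

lemma has_sum_exhaust:
  fixes f :: "real \<Rightarrow> complex"
  assumes "(f has_sum s) P" "uniform_discrete P"
  shows "(\<lambda>n. \<Sum>p\<in>P \<inter> {-real n..real n}. f p) \<longlonglongrightarrow> s"
proof -
  have fin: "finite (P \<inter> {-real n..real n})" for n
    by (rule uniform_discrete_Int_bounded_finite[OF assms(2)]) simp
  have "filterlim (\<lambda>n. P \<inter> {-real n..real n}) (finite_subsets_at_top P) sequentially"
    unfolding filterlim_finite_subsets_at_top
  proof (intro allI impI)
    fix X assume X: "finite X \<and> X \<subseteq> P"
    then have "bounded X" by (simp add: finite_imp_bounded)
    then obtain b where b: "\<And>x. x \<in> X \<Longrightarrow> \<bar>x\<bar> \<le> b" unfolding bounded_iff by auto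
    obtain N where N: "b \<le> real N" using real_arch_simple by blast
    show "\<forall>\<^sub>F n in sequentially. finite (P \<inter> {-real n..real n}) \<and> X \<subseteq> P \<inter> {-real n..real n} \<and> P \<inter> {-real n..real n} \<subseteq> P"
      using eventually_ge_at_top[of N]
    proof eventually_elim
      case (elim n)
      then have "b \<le> real n" using N by linarith
      then have "x \<in> {-real n..real n}" if "x \<in> X" for x using b[OF that] by auto
      then show ?case using X fin[of n] by blast
    qed
  qed
  then show ?thesis
    using assms(1) unfolding has_sum_def by (rule filterlim_compose[rotated])
qed

text \<open>Associativity of convolution: the counting measure of \<open>P\<close> may act before or
  after convolving \<open>h\<close> with \<open>k\<close>. The finite partial sums over
  \<open>P\<close> are bounded uniformly, so a multiple of \<open>norm (k (x - z))\<close>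
  dominates.\<close>

lemma set_conv_integral:
  fixes h k :: "real \<Rightarrow> complex"
  assumes P: "uniform_discrete P" and h: "continuous_on UNIV h" "quad_decay h"
    and k: "continuous_on UNIV k" "quad_decay k"
    and hk: "\<And>x. K x = (LINT z|lborel. h z * k (x - z))" "quad_decay K"
  shows "integrable lborel (\<lambda>z. set_conv P h z * k (x - z))"
    "set_conv P K x = (LINT z|lborel. set_conv P h z * k (x - z))"
proof -
  obtain B where B: "B > 0" "\<And>x J. finite J \<Longrightarrow> J \<subseteq> P \<Longrightarrow> (\<Sum>p\<in>J. 1 / (1 + (x - p)\<^sup>2)) \<le> B"
    using uniform_discrete_sum_bound[OF P] by metis
  obtain C where C: "C > 0" "\<And>x. norm (h x) \<le> C / (1 + x\<^sup>2)"
    using quad_decayE[OF h(2)] by blast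
  define S where "S n = P \<inter> {-real n..real n}" for n
  have fin: "finite (S n)" for n
    unfolding S_def by (rule uniform_discrete_Int_bounded_finite[OF P]) simp
  define s where "s n z = (\<Sum>p\<in>S n. h (z - p)) * k (x - z)" for n z
  have [measurable]: "h \<in> borel_measurable borel" "k \<in> borel_measurable borel"
    using h k by (auto intro: borel_measurable_continuous_onI)
  have kx: "integrable lborel (\<lambda>z. k (x - z))"
    using lborel_integrable_real_affine[OF quad_decay_integrable[OF k], of "-1" x] by simp
  have sm: "s n \<in> borel_measurable lborel" for n unfolding s_def by measurable
  have lim: "(\<lambda>n. s n z) \<longlonglongrightarrow> set_conv P h z * k (x - z)" for z
    unfolding s_def S_def set_conv_def
    by (intro tendsto_intros has_sum_exhaust[OF _ P] has_sum_infsum)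
      (rule abs_summable_summable[OF quad_decay_summable[OF P h(2)]])
  have bound: "norm (s n z) \<le> C * B * norm (k (x - z))" for n z
  proof -
    have "norm (\<Sum>p\<in>S n. h (z - p)) = norm (infsum (\<lambda>p. h (z - p)) (S n))" using fin by simp
    also have "\<dots> \<le> C * B"
      by (rule set_conv_bound[where x = z]) (use B C in \<open>auto simp: S_def\<close>)
    finally show ?thesis unfolding s_def norm_mult by (rule mult_right_mono) auto
  qed
  have meas: "(\<lambda>z. set_conv P h z * k (x - z)) \<in> borel_measurable lborel"
    by (rule borel_measurable_LIMSEQ_metric[OF sm]) (use lim in auto)
  have w: "integrable lborel (\<lambda>z. C * B * norm (k (x - z)))"
    using kx by (intro integrable_mult_right integrable_norm)
  show "integrable lborel (\<lambda>z. set_conv P h z * k (x - z))"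
    by (rule integrable_dominated_convergence[where s = s, OF meas sm w]) (use lim bound in auto)
  have "(\<lambda>n. LINT z|lborel. s n z) \<longlonglongrightarrow> (LINT z|lborel. set_conv P h z * k (x - z))"
    by (rule integral_dominated_convergence[where s = s, OF meas sm w]) (use lim bound in auto)
  moreover have "(LINT z|lborel. s n z) = (\<Sum>p\<in>S n. K (x - p))" for n
  proof -
    have i: "integrable lborel (\<lambda>z. h (z - p) * k (x - z))" for p
    proof (rule Bochner_Integration.integrable_bound)
      show "integrable lborel (\<lambda>z. C * norm (k (x - z)))"
        using kx by (intro integrable_mult_right integrable_norm)
      have "norm (h (z - p)) \<le> C" for z
      proof (rule order_trans[OF C(2)])
        show "C / (1 + (z - p)\<^sup>2) \<le> C"
          using C(1) divide_left_mono[of 1 "1 + (z - p)\<^sup>2" C] by (simp add: add_pos_nonneg)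
      qed
      then show "AE z in lborel. norm (h (z - p) * k (x - z)) \<le> norm (C * norm (k (x - z)))"
        using C(1) by (auto simp: norm_mult abs_mult intro!: mult_right_mono)
    qed auto
    have "K (x - p) = (LINT z|lborel. h (z - p) * k (x - z))" for p
    proof -
      have "K (x - p) = (LINT z|lborel. h z * k (x - p - z))" by (rule hk)
      also have "\<dots> = (LINT z|lborel. h (-p + 1 * z) * k (x - p - (-p + 1 * z)))"
        by (subst lborel_integral_real_affine[of 1 _ "-p"]) auto
      finally show ?thesis by (simp add: algebra_simps)
    qed
    then show ?thesis
      unfolding s_def sum_distrib_right using i by simp
  qed
  moreover have "(\<lambda>n. \<Sum>p\<in>S n. K (x - p)) \<longlonglongrightarrow> set_conv P K x"
    unfolding S_def set_conv_def
    by (intro has_sum_exhaust[OF _ P] has_sum_infsum)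
      (rule abs_summable_summable[OF quad_decay_summable[OF P hk(2)]])
  ultimately show "set_conv P K x = (LINT z|lborel. set_conv P h z * k (x - z))"
    using LIMSEQ_unique by auto
qed

text \<open>The Fourier-Laplace transform at complex frequency \<open>z\<close>. Integration over a
  compact interval makes it entire; it is applied to functions vanishing outside that
  interval.\<close>

definition fourier :: "real \<Rightarrow> (real \<Rightarrow> complex) \<Rightarrow> complex \<Rightarrow> complex" where
  "fourier L h z = integral {-L..L} (\<lambda>y. h y * exp (- (\<i> * z * of_real y)))"

lemma fourier_holomorphic:
  assumes "continuous_on UNIV h"
  shows "fourier L h holomorphic_on UNIV"
proof -
  have "(\<lambda>z. integral (cbox (-L) L) (\<lambda>y. h y * exp (- (\<i> * z * of_real y)))) holomorphic_on UNIV"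
  proof (rule leibniz_rule_holomorphic)
    fix z t
    show "((\<lambda>z. h t * exp (- (\<i> * z * of_real t))) has_field_derivative
       - (\<i> * of_real t) * (h t * exp (- (\<i> * z * of_real t)))) (at z within UNIV)"
      by (auto intro!: derivative_eq_intros)
    show "(\<lambda>y. h y * exp (- (\<i> * z * of_real y))) integrable_on cbox (-L) L"
      by (auto intro!: integrable_continuous_interval continuous_intros continuous_on_subset[OF assms])
  next
    have "continuous_on (UNIV \<times> cbox (-L) L) (\<lambda>p. h (snd p))"
      by (rule continuous_on_compose2[OF assms]) (auto intro!: continuous_intros)
    then show "continuous_on (UNIV \<times> cbox (-L) L) (\<lambda>(z, t). - (\<i> * of_real t) * (h t * exp (- (\<i> * z * of_real t))))"
      unfolding case_prod_unfold by (intro continuous_intros)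
  qed auto
  then show ?thesis by (simp add: fourier_def[abs_def])
qed

text \<open>Multiplication of the symbol by the transform of \<open>h\<close> is convolution of the
  kernel with \<open>h\<close>. Both integrals run over compact intervals, so Fubini for continuous
  functions is enough.\<close>

lemma kern_fourier:
  assumes h: "continuous_on UNIV h" "\<And>x. \<bar>x\<bar> > L \<Longrightarrow> h x = 0" and g: "continuous_on {-R..R} (\<lambda>t. g (of_real t))"
  shows "kern R (\<lambda>z. fourier L h z * g z) x = (LINT z|lborel. h z * kern R g (x - z))"
proof -
  let ?f = "\<lambda>(t::real) (y::real). h y * exp (- (\<i> * of_real t * of_real y)) * (g (of_real t) * exp (\<i> * of_real (t * x)))"
  have "kern R (\<lambda>z. fourier L h z * g z) x = integral (cbox (-R) R) (\<lambda>t. integral (cbox (-L) L) (\<lambda>y. ?f t y))"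
  proof -
    have "fourier L h (of_real t) * g (of_real t) * exp (\<i> * of_real (t * x)) = integral {-L..L} (\<lambda>y. ?f t y)" for t
      unfolding fourier_def mult.assoc[of _ "g _"] by (rule integral_mult_left[symmetric])
    then show ?thesis unfolding kern_def cbox_interval by presburger
  qed
  also have "\<dots> = integral (cbox (-L) L) (\<lambda>y. integral (cbox (-R) R) (\<lambda>t. ?f t y))"
  proof (rule integral_swap_continuous)
    have "continuous_on (cbox (-R, -L) (R, L)) (\<lambda>p. h (snd p))"
      by (rule continuous_on_compose2[OF h(1)]) (auto intro!: continuous_intros)
    moreover have "continuous_on (cbox (-R, -L) (R, L)) (\<lambda>p. g (of_real (fst p)))"
      by (rule continuous_on_compose2[OF g]) (auto intro!: continuous_intros simp: cbox_Pair_eq)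
    ultimately show "continuous_on (cbox (-R, -L) (R, L)) (\<lambda>(t, y). ?f t y)"
      unfolding case_prod_unfold by (intro continuous_intros)
  qed
  also have "\<dots> = integral {-L..L} (\<lambda>y. h y * kern R g (x - y))"
    unfolding kern_def cbox_interval
  proof (intro integral_cong)
    fix y
    have "integral {-R..R} (\<lambda>t. ?f t y) = integral {-R..R} (\<lambda>t. h y * (g (of_real t) * exp (\<i> * of_real (t * (x - y)))))"
      by (intro integral_cong) (simp add: algebra_simps exp_diff exp_minus exp_add field_simps)
    then show "integral {-R..R} (\<lambda>t. ?f t y) = h y * integral {-R..R} (\<lambda>t. g (of_real t) * exp (\<i> * of_real (t * (x - y))))"
      by simp
  qed
  also have "\<dots> = (LINT y:{-L..L}|lborel. h y * kern R g (x - y))"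
  proof (rule set_borel_integral_eq_integral(2)[symmetric])
    have "continuous_on {-L..L} (\<lambda>y. kern R g (x - y))"
      by (rule continuous_on_compose2[OF kern_continuous[OF g, of UNIV]]) (auto intro!: continuous_intros)
    then show "set_integrable lborel {-L..L} (\<lambda>y. h y * kern R g (x - y))"
      using continuous_on_subset[OF h(1)] by (intro borel_integrable_atLeastAtMost') (auto intro!: continuous_intros)
  qed
  also have "\<dots> = (LINT z|lborel. h z * kern R g (x - z))"
    unfolding set_lebesgue_integral_def using h(2)
    by (intro Bochner_Integration.integral_cong refl) (auto simp: indicator_def abs_le_iff not_le)
  finally show ?thesis .
qed

lemma compact_support_quad_decay:
  assumes h: "continuous_on UNIV h" "\<And>x. \<bar>x\<bar> > L \<Longrightarrow> h x = 0"
  shows "quad_decay h"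
proof -
  have "bounded (h ` {-\<bar>L\<bar>..\<bar>L\<bar>})"
    using h(1) by (intro compact_imp_bounded compact_continuous_image) (auto elim: continuous_on_subset)
  then obtain M where M: "\<And>x. x \<in> {-\<bar>L\<bar>..\<bar>L\<bar>} \<Longrightarrow> norm (h x) \<le> M" unfolding bounded_iff by blast
  have M0: "M \<ge> 0" using norm_ge_zero[of "h 0"] M[of 0] by (rule order_trans) auto
  have "norm (h x) \<le> M * (1 + L\<^sup>2) / (1 + x\<^sup>2)" for x
  proof (cases "\<bar>x\<bar> > \<bar>L\<bar>")
    case True
    then show ?thesis using h(2)[of x] M0 by simp
  next
    case False
    then have "norm (h x) \<le> M" by (intro M) auto
    moreover have "x\<^sup>2 \<le> L\<^sup>2" using False by (simp flip: abs_le_square_iff)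
    ultimately have "norm (h x) * (1 + x\<^sup>2) \<le> M * (1 + L\<^sup>2)" using M0 by (intro mult_mono) auto
    then show ?thesis by (simp add: pos_le_divide_eq add_pos_nonneg)
  qed
  then show ?thesis unfolding quad_decay_def by blast
qed

text \<open>Convolving the assumed equation with \<open>kern R g\<close> turns the constant
  \<open>c\<close> into \<open>c\<close> times the integral of that kernel.\<close>

lemma set_conv_kern_constant:
  assumes P: "uniform_discrete P" "uniform_discrete Q"
    and h: "continuous_on UNIV h" "\<And>x. \<bar>x\<bar> > L \<Longrightarrow> h x = 0"
    and eq: "\<And>x. set_conv P h x + \<sigma> * set_conv Q h x = c"
    and R: "R \<ge> 0" and g: "cutoff R g"
  obtains c' where "\<And>x. set_conv P (kern R (\<lambda>z. fourier L h z * g z)) x + \<sigma> * set_conv Q (kern R (\<lambda>z. fourier L h z * g z)) x = c'"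
proof -
  let ?K = "kern R (\<lambda>z. fourier L h z * g z)" and ?k = "kern R g"
  have hd: "quad_decay h" by (rule compact_support_quad_decay[OF h])
  have Kd: "quad_decay ?K"
    by (rule kern_quad_decay[OF R], rule cutoff_mult[OF R g, of UNIV])
      (use fourier_holomorphic[OF h(1)] in auto)
  have kd: "quad_decay ?k" by (rule kern_quad_decay[OF R g])
  note gc = cutoff_continuous[OF g]
  have kc: "continuous_on UNIV ?k" by (rule kern_continuous[OF gc])
  have Keq: "?K x = (LINT z|lborel. h z * ?k (x - z))" for x by (rule kern_fourier[OF h gc])
  have "set_conv P ?K x + \<sigma> * set_conv Q ?K x = c * (LINT z|lborel. ?k z)" for x
  proof -
    note I = set_conv_integral[OF _ h(1) hd kc kd Keq Kd, where x = x]
    have "set_conv P ?K x + \<sigma> * set_conv Q ?K x =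
        (LINT z|lborel. set_conv P h z * ?k (x - z)) + (LINT z|lborel. \<sigma> * (set_conv Q h z * ?k (x - z)))"
      unfolding I(2)[OF P(1)] I(2)[OF P(2)] integral_mult_right_zero ..
    also have "\<dots> = (LINT z|lborel. set_conv P h z * ?k (x - z) + \<sigma> * (set_conv Q h z * ?k (x - z)))"
      using I(1)[OF P(1)] I(1)[OF P(2)] by (intro Bochner_Integration.integral_add[symmetric] integrable_mult_right)
    also have "\<dots> = (LINT z|lborel. c * ?k (x - z))"
      by (intro Bochner_Integration.integral_cong refl)
        (metis (no_types) eq distrib_right mult.assoc)
    also have "\<dots> = c * (LINT z|lborel. ?k (x + (-1) * z))" by simp
    also have "(LINT z|lborel. ?k (x + (-1) * z)) = (LINT z|lborel. ?k z)"
      using lborel_integral_real_affine[of "-1" ?k x] by simp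
    finally show ?thesis .
  qed
  then show ?thesis using that by blast
qed

subsection \<open>Convolutions with band-limited kernels are trigonometric polynomials\<close>

text \<open>A nonzero entire function has finitely many zeros in a compact set. The list
  \<open>zs\<close> carries multiplicities, and the induction is on the number of distinct
  zeros.\<close>

lemma entire_factor_zeros:
  assumes "f holomorphic_on UNIV" "\<exists>z. f z \<noteq> 0" "compact K"
  shows "\<exists>zs q. q holomorphic_on UNIV \<and> set zs \<subseteq> K \<and> (\<forall>z\<in>K. q z \<noteq> 0) \<and>
    (\<forall>z. f z = prod_list (map (\<lambda>w. z - w) zs) * q z)"
  using assms
proof (induction "card {z\<in>K. f z = 0}" arbitrary: f rule: less_induct)
  case less
  show ?case
  proof (cases "\<exists>\<xi>\<in>K. f \<xi> = 0")
    case False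
    then show ?thesis using less.prems by (intro exI[of _ "[]"] exI[of _ f]) auto
  next
    case True
    then obtain \<xi> where \<xi>: "\<xi> \<in> K" "f \<xi> = 0" by blast
    have nc: "\<not> f constant_on UNIV"
      using less.prems(2) \<xi>(2) unfolding constant_on_def by (metis UNIV_I)
    have fin: "finite {z\<in>K. f z = 0}"
      by (rule holomorphic_compact_finite_zeros[OF less.prems(1) _ _ less.prems(3) _ nc]) auto
    obtain g r n where g: "0 < n" "0 < r" "g holomorphic_on ball \<xi> r"
      "\<And>w. w \<in> ball \<xi> r \<Longrightarrow> f w = (w - \<xi>)^n * g w" "\<And>w. w \<in> ball \<xi> r \<Longrightarrow> g w \<noteq> 0"
      by (rule holomorphic_factor_zero_nonconstant[OF less.prems(1) _ _ _ \<xi>(2) nc]) auto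
    define q where "q z = (if z = \<xi> then g \<xi> else f z / (z - \<xi>)^n)" for z
    have qg: "q w = g w" if "w \<in> ball \<xi> r" for w
      using g(4)[OF that] by (auto simp: q_def)
    have "q holomorphic_on ball \<xi> r"
      using g(3) by (rule holomorphic_transform) (use qg in auto)
    moreover have "q holomorphic_on (- {\<xi>})"
    proof (rule holomorphic_transform)
      show "(\<lambda>z. f z / (z - \<xi>)^n) holomorphic_on (- {\<xi>})"
        by (auto intro!: holomorphic_intros holomorphic_on_subset[OF less.prems(1)])
    qed (auto simp: q_def)
    ultimately have "q holomorphic_on (ball \<xi> r \<union> - {\<xi>})"
      by (intro holomorphic_on_Un) auto
    moreover have "ball \<xi> r \<union> - {\<xi>} = UNIV" using g(2) by auto
    ultimately have q1: "q holomorphic_on UNIV" by simp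
    have q\<xi>: "q \<xi> \<noteq> 0" using g(5)[of \<xi>] g(2) by (simp add: q_def)
    have fq: "f z = (z - \<xi>)^n * q z" for z
      using \<xi>(2) g(1) by (auto simp: q_def)
    \<comment> \<open>The whole order \<open>n\<close> was divided out, so \<open>\<xi>\<close> is
      no longer a zero and the count drops.\<close>
    have "{z\<in>K. q z = 0} \<subset> {z\<in>K. f z = 0}"
      using \<xi> q\<xi> fq by auto
    then have "card {z\<in>K. q z = 0} < card {z\<in>K. f z = 0}"
      using fin by (rule psubset_card_mono[rotated])
    from less.hyps[OF this q1 _ less.prems(3)] q\<xi>
    obtain zs q' where zs: "q' holomorphic_on UNIV" "set zs \<subseteq> K" "\<forall>z\<in>K. q' z \<noteq> 0"
      "\<forall>z. q z = prod_list (map (\<lambda>w. z - w) zs) * q' z" by blast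
    have "f z = prod_list (map (\<lambda>w. z - w) (replicate n \<xi> @ zs)) * q' z" for z
      using fq[of z] zs(4) by (simp add: map_replicate_const mult.assoc)
    moreover have "set (replicate n \<xi> @ zs) \<subseteq> K" using zs(2) \<xi>(1) by auto
    ultimately show ?thesis using zs by blast
  qed
qed

text \<open>At the frequency \<open>\<i> * n\<close> the transform is the integral of
  \<open>h y * exp y ^ n\<close>. If all of these vanish, \<open>h\<close> is orthogonal to every
  polynomial in \<open>exp y\<close>; by Weierstrass approximation of \<open>h (ln s)\<close> the
  integral of \<open>h^2\<close> is then 0.\<close>

lemma fourier_nonzero:
  fixes h :: "real \<Rightarrow> real"
  assumes h: "continuous_on UNIV h" and L: "L > 0" and x: "x \<in> {-L..L}" "h x \<noteq> 0"
  shows "\<exists>z. fourier L (\<lambda>y. of_real (h y)) z \<noteq> 0"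
proof (rule ccontr)
  assume "\<not> ?thesis"
  then have z: "fourier L (\<lambda>y. of_real (h y)) z = 0" for z by blast
  have hc: "continuous_on S h" for S by (rule continuous_on_subset[OF h]) simp
  have mom: "integral {-L..L} (\<lambda>y. h y * exp y ^ n) = 0" for n :: nat
  proof -
    have "(\<lambda>y. h y * exp y ^ n) integrable_on {-L..L}"
      by (intro integrable_continuous_interval continuous_intros hc)
    then have "((\<lambda>y. complex_of_real (h y * exp y ^ n)) has_integral of_real (integral {-L..L} (\<lambda>y. h y * exp y ^ n))) {-L..L}"
      by (intro has_integral_of_real) (simp add: integrable_integral)
    then have "integral {-L..L} (\<lambda>y. complex_of_real (h y * exp y ^ n)) = of_real (integral {-L..L} (\<lambda>y. h y * exp y ^ n))"
      by (rule integral_unique)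
    moreover have "integral {-L..L} (\<lambda>y. complex_of_real (h y * exp y ^ n)) = fourier L (\<lambda>y. of_real (h y)) (\<i> * of_nat n)"
      unfolding fourier_def
    proof (intro integral_cong)
      fix y
      have "- (\<i> * (\<i> * of_nat n) * complex_of_real y) = of_nat n * of_real y"
        by (simp flip: mult.assoc)
      then show "complex_of_real (h y * exp y ^ n) = of_real (h y) * exp (- (\<i> * (\<i> * of_nat n) * of_real y))"
        by (simp add: exp_of_nat_mult exp_of_real)
    qed
    ultimately show ?thesis using z by simp
  qed
  let ?S = "{exp (-L)..exp L}"
  have bound: "integral {-L..L} (\<lambda>y. (h y)\<^sup>2) \<le> e * integral {-L..L} (\<lambda>y. \<bar>h y\<bar>)" if e: "e > 0" for e
  proof -
    have "s \<noteq> 0" if "s \<in> ?S" for s using that exp_gt_zero[of "-L"] by auto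
    then have "continuous_on ?S (\<lambda>s. h (ln s))"
      by (intro continuous_on_compose2[OF h] continuous_on_ln continuous_on_id) auto
    from Stone_Weierstrass_real_polynomial_function[OF compact_Icc this e]
    obtain p where p: "real_polynomial_function p" "\<And>s. s \<in> ?S \<Longrightarrow> \<bar>h (ln s) - p s\<bar> < e" by blast
    from p(1)[unfolded real_polynomial_function_iff_sum]
    obtain a n where p_eq: "p = (\<lambda>x. \<Sum>i\<le>n. a i * x ^ i)" by blast
    have "integral {-L..L} (\<lambda>y. h y * p (exp y)) = integral {-L..L} (\<lambda>y. \<Sum>i\<le>n. a i * (h y * exp y ^ i))"
      unfolding p_eq sum_distrib_left by (intro integral_cong sum.cong refl) (simp only: mult_ac)
    also have "\<dots> = (\<Sum>i\<le>n. integral {-L..L} (\<lambda>y. a i * (h y * exp y ^ i)))"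
      by (intro integral_sum integrable_continuous_interval continuous_intros hc) auto
    also have "\<dots> = 0" by (simp add: mom)
    finally have 0: "integral {-L..L} (\<lambda>y. h y * p (exp y)) = 0" .
    have pc: "continuous_on {-L..L} (\<lambda>y. p (exp y))"
      unfolding p_eq by (intro continuous_intros)
    have "integral {-L..L} (\<lambda>y. (h y)\<^sup>2) = integral {-L..L} (\<lambda>y. (h y)\<^sup>2) - integral {-L..L} (\<lambda>y. h y * p (exp y))"
      using 0 by simp
    also have "\<dots> = integral {-L..L} (\<lambda>y. (h y)\<^sup>2 - h y * p (exp y))"
      by (intro integral_diff[symmetric] integrable_continuous_interval continuous_intros hc pc)
    also have "\<dots> \<le> integral {-L..L} (\<lambda>y. e * \<bar>h y\<bar>)"
    proof (rule integral_le)
      fix y assume "y \<in> {-L..L}"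
      then have "\<bar>h (ln (exp y)) - p (exp y)\<bar> < e" by (intro p(2)) auto
      then have "\<bar>h y\<bar> * \<bar>h y - p (exp y)\<bar> \<le> \<bar>h y\<bar> * e" by (intro mult_left_mono) auto
      then have "\<bar>h y * (h y - p (exp y))\<bar> \<le> e * \<bar>h y\<bar>" by (simp add: abs_mult mult.commute)
      then show "(h y)\<^sup>2 - h y * p (exp y) \<le> e * \<bar>h y\<bar>"
        unfolding power2_eq_square right_diff_distrib by linarith
    qed (intro integrable_continuous_interval continuous_intros hc pc)+
    finally show ?thesis by simp
  qed
  have "integral {-L..L} (\<lambda>y. (h y)\<^sup>2) \<le> 0"
  proof (rule field_le_epsilon)
    let ?I = "integral {-L..L} (\<lambda>y. \<bar>h y\<bar>)"
    fix e :: real assume e: "e > 0"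
    have I: "?I \<ge> 0" by (intro integral_nonneg integrable_continuous_interval continuous_intros hc) auto
    \<comment> \<open>Adding 1 in the denominator covers the case \<open>?I = 0\<close>.\<close>
    have "integral {-L..L} (\<lambda>y. (h y)\<^sup>2) \<le> e / (?I + 1) * ?I" using e I by (intro bound) simp
    also have "\<dots> \<le> e"
    proof -
      have "e * ?I \<le> e * (?I + 1)" using e by (intro mult_left_mono) auto
      then show ?thesis using I by (simp add: pos_divide_le_eq)
    qed
    finally show "integral {-L..L} (\<lambda>y. (h y)\<^sup>2) \<le> 0 + e" by simp
  qed
  moreover have "integral {-L..L} (\<lambda>y. (h y)\<^sup>2) \<ge> 0"
    by (intro integral_nonneg integrable_continuous_interval continuous_intros hc) auto
  ultimately have "integral {-L..L} (\<lambda>y. (h y)\<^sup>2) = 0" by simp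
  moreover have "continuous_on {-L..L} (\<lambda>y. (h y)\<^sup>2)" by (intro continuous_intros hc)
  ultimately have "\<forall>y\<in>{-L..L}. (h y)\<^sup>2 = 0"
    using integral_eq_0_iff[of "-L" L "\<lambda>y. (h y)\<^sup>2"] L by simp
  then show False using x by auto
qed

definition trig_poly :: "(real \<Rightarrow> complex) \<Rightarrow> bool" where
  "trig_poly u \<longleftrightarrow> (\<exists>\<Lambda> c. finite \<Lambda> \<and> (\<forall>x. u x = (\<Sum>\<mu>\<in>\<Lambda>. c \<mu> * exp (\<i> * of_real (\<mu> * x)))))"

lemma exp_i_has_vector_derivative:
  "((\<lambda>x. exp (\<i> * of_real (\<mu> * x))) has_vector_derivative \<i> * of_real \<mu> * exp (\<i> * of_real (\<mu> * x))) (at x)"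
proof -
  have "((\<lambda>z. exp (\<i> * (of_real \<mu> * z))) has_field_derivative \<i> * of_real \<mu> * exp (\<i> * (of_real \<mu> * of_real x))) (at (of_real x))"
    by (auto intro!: derivative_eq_intros)
  from has_vector_derivative_real_field[OF this] show ?thesis by simp
qed

text \<open>A resonant frequency on the right-hand side would force linear growth of the solution.\<close>

lemma trig_poly_of_bounded_ode:
  assumes u: "trig_poly u"
    and v: "\<And>x. (v has_vector_derivative \<i> * (u x + of_real \<nu> * v x)) (at x)"
    and bd: "\<And>x. norm (v x) \<le> M"
  shows "trig_poly v"
proof -
  obtain \<Lambda> c where \<Lambda>: "finite \<Lambda>" "\<And>x. u x = (\<Sum>\<mu>\<in>\<Lambda>. c \<mu> * exp (\<i> * of_real (\<mu> * x)))"
    using u unfolding trig_poly_def by blast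
  \<comment> \<open>Solving \<open>v' = i (u + \<nu> v)\<close> frequency by frequency divides by
    \<open>\<mu> - \<nu>\<close>; the resonant frequency \<open>\<nu>\<close> is split off as
    \<open>c0\<close>.\<close>
  define d where "d \<mu> = c \<mu> / of_real (\<mu> - \<nu>)" for \<mu>
  define T where "T x = (\<Sum>\<mu>\<in>\<Lambda> - {\<nu>}. d \<mu> * exp (\<i> * of_real (\<mu> * x)))" for x
  define c0 where "c0 = (if \<nu> \<in> \<Lambda> then c \<nu> else 0)"
  have u_split: "u x = (\<Sum>\<mu>\<in>\<Lambda> - {\<nu>}. c \<mu> * exp (\<i> * of_real (\<mu> * x))) + c0 * exp (\<i> * of_real (\<nu> * x))" for x
    using \<Lambda> by (cases "\<nu> \<in> \<Lambda>") (auto simp: c0_def sum.remove[of \<Lambda> \<nu>])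
  have T': "(T has_vector_derivative \<i> * ((\<Sum>\<mu>\<in>\<Lambda> - {\<nu>}. c \<mu> * exp (\<i> * of_real (\<mu> * x))) + of_real \<nu> * T x)) (at x)" for x
  proof -
    have "(T has_vector_derivative (\<Sum>\<mu>\<in>\<Lambda> - {\<nu>}. d \<mu> * (\<i> * of_real \<mu> * exp (\<i> * of_real (\<mu> * x))))) (at x)"
      unfolding T_def by (intro has_vector_derivative_sum has_vector_derivative_mult_right exp_i_has_vector_derivative)
    also have "(\<Sum>\<mu>\<in>\<Lambda> - {\<nu>}. d \<mu> * (\<i> * of_real \<mu> * exp (\<i> * of_real (\<mu> * x))))
        = \<i> * ((\<Sum>\<mu>\<in>\<Lambda> - {\<nu>}. c \<mu> * exp (\<i> * of_real (\<mu> * x))) + of_real \<nu> * T x)"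
      unfolding T_def sum_distrib_left sum.distrib[symmetric]
    proof (rule sum.cong)
      fix \<mu> assume "\<mu> \<in> \<Lambda> - {\<nu>}"
      then have c_eq: "c \<mu> = d \<mu> * (of_real \<mu> - of_real \<nu>)" unfolding d_def by simp
      show "d \<mu> * (\<i> * of_real \<mu> * exp (\<i> * of_real (\<mu> * x))) =
          \<i> * (c \<mu> * exp (\<i> * of_real (\<mu> * x)) + of_real \<nu> * (d \<mu> * exp (\<i> * of_real (\<mu> * x))))"
        unfolding c_eq by (simp add: algebra_simps)
    qed simp
    finally show ?thesis .
  qed
  \<comment> \<open>The integrating factor leaves the constant derivative \<open>\<i> * c0\<close>,
    so \<open>y\<close> is affine; boundedness then forces \<open>c0 = 0\<close>.\<close>
  define y where "y x = (v x - T x) * exp (\<i> * of_real ((-\<nu>) * x))" for x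
  have "(y has_vector_derivative \<i> * c0) (at x)" for x
  proof -
    have "(y has_vector_derivative (v x - T x) * (\<i> * of_real (-\<nu>) * exp (\<i> * of_real ((-\<nu>) * x))) +
       (\<i> * (u x + of_real \<nu> * v x) - \<i> * ((\<Sum>\<mu>\<in>\<Lambda> - {\<nu>}. c \<mu> * exp (\<i> * of_real (\<mu> * x))) + of_real \<nu> * T x)) *
         exp (\<i> * of_real ((-\<nu>) * x))) (at x)"
      unfolding y_def
      by (intro has_vector_derivative_mult has_vector_derivative_diff v T' exp_i_has_vector_derivative)
    also have "(v x - T x) * (\<i> * of_real (-\<nu>) * exp (\<i> * of_real ((-\<nu>) * x))) +
       (\<i> * (u x + of_real \<nu> * v x) - \<i> * ((\<Sum>\<mu>\<in>\<Lambda> - {\<nu>}. c \<mu> * exp (\<i> * of_real (\<mu> * x))) + of_real \<nu> * T x)) *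
         exp (\<i> * of_real ((-\<nu>) * x)) = \<i> * c0 * (exp (\<i> * of_real (\<nu> * x)) * exp (\<i> * of_real ((-\<nu>) * x)))"
      unfolding u_split[of x] by (simp add: algebra_simps)
    also have "exp (\<i> * of_real (\<nu> * x)) * exp (\<i> * of_real ((-\<nu>) * x)) = 1"
      by (simp flip: exp_add)
    finally show ?thesis by simp
  qed
  then have "((\<lambda>x. y x - of_real x * (\<i> * c0)) has_vector_derivative 0) (at x)" for x
    by (auto intro!: derivative_eq_intros)
  then have "((\<lambda>x. y x - of_real x * (\<i> * c0)) has_derivative (\<lambda>h. 0)) (at x within UNIV)" for x
    unfolding has_vector_derivative_def by simp
  then obtain y0 where y0: "\<And>x. y x - of_real x * (\<i> * c0) = y0"
    using has_derivative_zero_constant[of UNIV "\<lambda>x. y x - of_real x * (\<i> * c0)"] by auto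
  have ybd: "norm (y x) \<le> M + (\<Sum>\<mu>\<in>\<Lambda> - {\<nu>}. norm (d \<mu>))" for x
  proof -
    have "norm (y x) = norm (v x - T x)" unfolding y_def norm_mult by (simp add: norm_exp_i_times flip: of_real_mult of_real_minus)
    also have "\<dots> \<le> norm (v x) + norm (T x)" by (rule norm_triangle_ineq4)
    also have "norm (T x) \<le> (\<Sum>\<mu>\<in>\<Lambda> - {\<nu>}. norm (d \<mu>))"
      unfolding T_def by (rule sum_norm_le) (simp add: norm_mult norm_exp_i_times flip: of_real_mult)
    finally show ?thesis using bd[of x] by linarith
  qed
  have "c0 = 0"
  proof (rule ccontr)
    assume c0: "c0 \<noteq> 0"
    let ?B = "M + (\<Sum>\<mu>\<in>\<Lambda> - {\<nu>}. norm (d \<mu>)) + norm y0"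
    define x where "x = (\<bar>?B\<bar> + 1) / norm c0"
    have x: "x > 0" "x * norm c0 > ?B" using c0 unfolding x_def by (simp_all add: add_nonneg_pos)
    have "x * norm c0 = norm (of_real x * (\<i> * c0))" using x by (simp add: norm_mult)
    also have "\<dots> = norm (y x - y0)" using y0[of x] by (simp add: algebra_simps)
    also have "\<dots> \<le> norm (y x) + norm y0" by (rule norm_triangle_ineq4)
    also have "\<dots> \<le> ?B" using ybd[of x] by simp
    finally show False using x by simp
  qed
  then have yy: "y x = y0" for x using y0[of x] by simp
  have v_eq: "v x = T x + y0 * exp (\<i> * of_real (\<nu> * x))" for x
  proof -
    have "y0 * exp (\<i> * of_real (\<nu> * x)) = (v x - T x) * (exp (\<i> * of_real ((-\<nu>) * x)) * exp (\<i> * of_real (\<nu> * x)))"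
      unfolding yy[of x, symmetric] y_def by simp
    also have "exp (\<i> * of_real ((-\<nu>) * x)) * exp (\<i> * of_real (\<nu> * x)) = 1"
      by (simp flip: exp_add)
    finally show ?thesis by simp
  qed
  show ?thesis
    unfolding trig_poly_def
  proof (intro exI[of _ "insert \<nu> \<Lambda>"] exI[of _ "d(\<nu> := y0)"] conjI allI)
    fix x
    have "(\<Sum>\<mu>\<in>insert \<nu> \<Lambda>. (d(\<nu> := y0)) \<mu> * exp (\<i> * of_real (\<mu> * x))) =
      y0 * exp (\<i> * of_real (\<nu> * x)) + (\<Sum>\<mu>\<in>\<Lambda> - {\<nu>}. (d(\<nu> := y0)) \<mu> * exp (\<i> * of_real (\<mu> * x)))"
      using \<Lambda>(1) by (subst sum.insert_remove) auto
    also have "(\<Sum>\<mu>\<in>\<Lambda> - {\<nu>}. (d(\<nu> := y0)) \<mu> * exp (\<i> * of_real (\<mu> * x))) = T x"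
      unfolding T_def by (rule sum.cong) auto
    finally show "v x = (\<Sum>\<mu>\<in>insert \<nu> \<Lambda>. (d(\<nu> := y0)) \<mu> * exp (\<i> * of_real (\<mu> * x)))"
      by (simp add: v_eq)
  qed (use \<Lambda> in auto)
qed

lemma trig_poly_const: "trig_poly (\<lambda>x. c)"
  unfolding trig_poly_def by (intro exI[of _ "{0}"] exI[of _ "\<lambda>_. c"]) auto

lemma kern_cong:
  assumes "\<And>t. t \<in> {-R..R} \<Longrightarrow> G (of_real t) = H (of_real t)"
  shows "kern R G = kern R H"
  unfolding kern_def[abs_def] by (intro ext integral_cong) (use assms in auto)

lemma kern_lin:
  assumes "continuous_on {-R..R} (\<lambda>t. G (of_real t))" "continuous_on {-R..R} (\<lambda>t. H (of_real t))"
  shows "kern R (\<lambda>z. a * G z + b * H z) x = a * kern R G x + b * kern R H x"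
proof -
  let ?e = "\<lambda>t. exp (\<i> * of_real (t * x))"
  have "kern R (\<lambda>z. a * G z + b * H z) x = integral {-R..R} (\<lambda>t. a * (G (of_real t) * ?e t) + b * (H (of_real t) * ?e t))"
    unfolding kern_def by (intro integral_cong) (simp add: algebra_simps)
  also have "\<dots> = integral {-R..R} (\<lambda>t. a * (G (of_real t) * ?e t)) + integral {-R..R} (\<lambda>t. b * (H (of_real t) * ?e t))"
    by (intro integral_add integrable_continuous_interval continuous_intros assms)
  finally show ?thesis unfolding kern_def by simp
qed

lemma set_conv_lin:
  assumes "uniform_discrete P" "quad_decay k" "quad_decay l" "\<And>x. m x = a * k x + b * l x"
  shows "set_conv P m x = a * set_conv P k x + b * set_conv P l x"
proof -
  have "(\<lambda>p. k (x - p)) summable_on P" "(\<lambda>p. l (x - p)) summable_on P"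
    using quad_decay_summable[OF assms(1)] assms by (auto intro: abs_summable_summable)
  then show ?thesis
    unfolding set_conv_def assms(4)
    by (intro infsumI has_sum_add has_sum_cmult_right has_sum_infsum)
qed

text \<open>The factor \<open>z - \<nu>\<close> of the symbol acts on the convolution as a
  first-order differential operator. Removing it means solving an ODE whose right-hand side is a
  trigonometric polynomial, and quadratic decay keeps the solution bounded.\<close>

lemma trig_poly_divide_zero:
  assumes P: "uniform_discrete P" "uniform_discrete Q" and R: "R \<ge> 0" and G: "cutoff R G"
    and tp: "trig_poly (\<lambda>x. set_conv P (kern R (\<lambda>z. (z - of_real \<nu>) * G z)) x
                      + \<sigma> * set_conv Q (kern R (\<lambda>z. (z - of_real \<nu>) * G z)) x)"
  shows "trig_poly (\<lambda>x. set_conv P (kern R G) x + \<sigma> * set_conv Q (kern R G) x)"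
proof -
  have c1: "cutoff R (\<lambda>z. (z - of_real \<nu>) * G z)"
    by (rule cutoff_mult[OF R G, of UNIV]) (auto intro!: holomorphic_intros)
  have "kern R (\<lambda>z. \<i> * z * G z) = kern R (\<lambda>z. \<i> * ((z - of_real \<nu>) * G z) + (\<i> * of_real \<nu>) * G z)"
    by (rule kern_cong) (simp add: algebra_simps)
  then have k: "kern R (\<lambda>z. \<i> * z * G z) x = \<i> * kern R (\<lambda>z. (z - of_real \<nu>) * G z) x + (\<i> * of_real \<nu>) * kern R G x" for x
    using kern_lin[OF cutoff_continuous[OF c1] cutoff_continuous[OF G]] by simp
  note dec = kern_quad_decay[OF R c1] kern_quad_decay[OF R G]
  obtain M1 where M1: "\<And>x. norm (set_conv P (kern R G) x) \<le> M1"
    using set_conv_bounded[OF P(1) dec(2)] by blast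
  obtain M2 where M2: "\<And>x. norm (set_conv Q (kern R G) x) \<le> M2"
    using set_conv_bounded[OF P(2) dec(2)] by blast
  show ?thesis
  proof (rule trig_poly_of_bounded_ode[OF tp, where \<nu> = \<nu>])
    fix x
    have "((\<lambda>x. set_conv P (kern R G) x + \<sigma> * set_conv Q (kern R G) x) has_vector_derivative
       set_conv P (kern R (\<lambda>z. \<i> * z * G z)) x + \<sigma> * set_conv Q (kern R (\<lambda>z. \<i> * z * G z)) x) (at x)"
      by (intro has_vector_derivative_add has_vector_derivative_mult_right
          set_conv_kern_has_vector_derivative P R G)
    then show "((\<lambda>x. set_conv P (kern R G) x + \<sigma> * set_conv Q (kern R G) x) has_vector_derivative
      \<i> * (set_conv P (kern R (\<lambda>z. (z - of_real \<nu>) * G z)) x + \<sigma> * set_conv Q (kern R (\<lambda>z. (z - of_real \<nu>) * G z)) x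
        + of_real \<nu> * (set_conv P (kern R G) x + \<sigma> * set_conv Q (kern R G) x))) (at x)"
      unfolding set_conv_lin[OF P(1) dec k] set_conv_lin[OF P(2) dec k]
      by (simp add: algebra_simps)
    show "norm (set_conv P (kern R G) x + \<sigma> * set_conv Q (kern R G) x) \<le> M1 + norm \<sigma> * M2"
      using M1[of x] M2[of x]
      by (intro norm_triangle_le add_mono) (auto simp: norm_mult intro!: mult_left_mono)
  qed
qed

lemma trig_poly_divide_zeros:
  assumes P: "uniform_discrete P" "uniform_discrete Q" and R: "R \<ge> 0" and G: "cutoff R G"
    and zs: "set zs \<subseteq> of_real ` {-R..R}"
    and tp: "trig_poly (\<lambda>x. set_conv P (kern R (\<lambda>z. prod_list (map (\<lambda>w. z - w) zs) * G z)) x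
                      + \<sigma> * set_conv Q (kern R (\<lambda>z. prod_list (map (\<lambda>w. z - w) zs) * G z)) x)"
  shows "trig_poly (\<lambda>x. set_conv P (kern R G) x + \<sigma> * set_conv Q (kern R G) x)"
  using zs tp
proof (induction zs)
  case Nil
  then show ?case by simp
next
  case (Cons w zs)
  obtain \<nu> where \<nu>: "w = of_real \<nu>" using Cons.prems(1) by auto
  have hol: "(\<lambda>z. prod_list (map (\<lambda>w. z - w) zs)) holomorphic_on UNIV"
    by (induction zs) (auto intro!: holomorphic_intros)
  have "cutoff R (\<lambda>z. prod_list (map (\<lambda>w. z - w) zs) * G z)"
    by (rule cutoff_mult[OF R G, of UNIV]) (use hol in auto)
  from trig_poly_divide_zero[OF P R this, of \<nu> \<sigma>] Cons.prems(2)
  have "trig_poly (\<lambda>x. set_conv P (kern R (\<lambda>z. prod_list (map (\<lambda>w. z - w) zs) * G z)) x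
                      + \<sigma> * set_conv Q (kern R (\<lambda>z. prod_list (map (\<lambda>w. z - w) zs) * G z)) x)"
    by (simp add: \<nu> mult.assoc)
  then show ?case using Cons by simp
qed

text \<open>The transform of \<open>h\<close> is a product of linear factors with zeros on the band
  and a factor \<open>q\<close> without zeros there. The multiplier \<open>M / q\<close> is
  admissible and leaves only the linear factors, which are removed one by one. Zeros off the band
  stay inside \<open>q\<close>.\<close>

lemma set_conv_kern_trig_poly:
  fixes h :: "real \<Rightarrow> real"
  assumes P: "uniform_discrete P" "uniform_discrete Q"
    and h: "continuous_on UNIV h" "\<And>x. \<bar>x\<bar> > L \<Longrightarrow> h x = 0" "h x0 \<noteq> 0"
    and eq: "\<And>x. set_conv P (\<lambda>y. of_real (h y)) x + \<sigma> * set_conv Q (\<lambda>y. of_real (h y)) x = c"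
    and R: "R \<ge> 0" and M: "cutoff R M"
  shows "trig_poly (\<lambda>x. set_conv P (kern R M) x + \<sigma> * set_conv Q (kern R M) x)"
proof -
  \<comment> \<open>A strictly positive radius of support, as demanded by
    \<open>fourier_nonzero\<close>.\<close>
  define L' where "L' = \<bar>L\<bar> + 1"
  have L': "L' > 0" "\<And>x. \<bar>x\<bar> > L' \<Longrightarrow> of_real (h x) = (0::complex)"
    using h(2) unfolding L'_def by auto
  have hc: "continuous_on UNIV (\<lambda>y. complex_of_real (h y))"
    using h(1) by (intro continuous_intros)
  let ?F = "fourier L' (\<lambda>y. of_real (h y))"
  have "x0 \<in> {-L'..L'}" using L'(2)[of x0] h(3) by (cases "\<bar>x0\<bar> > L'") auto
  then have nz: "\<exists>z. ?F z \<noteq> 0" by (rule fourier_nonzero[OF h(1) L'(1) _ h(3)])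
  have "compact (complex_of_real ` {-R..R})"
    by (intro compact_continuous_image continuous_intros) auto
  from entire_factor_zeros[OF fourier_holomorphic[OF hc] nz this]
  obtain zs q where zs: "q holomorphic_on UNIV" "set zs \<subseteq> of_real ` {-R..R}" "\<forall>z\<in>of_real ` {-R..R}. q z \<noteq> 0"
    "\<forall>z. ?F z = prod_list (map (\<lambda>w. z - w) zs) * q z" by blast
  have "open {z. q z \<noteq> 0}"
    using holomorphic_on_imp_continuous_on[OF zs(1)]
    by (intro open_Collect_neq) (auto intro!: continuous_intros)
  then have g: "cutoff R (\<lambda>z. inverse (q z) * M z)"
    by (rule cutoff_mult[OF R M]) (use zs in \<open>auto intro!: holomorphic_intros elim: holomorphic_on_subset\<close>)
  obtain c' where c': "\<And>x. set_conv P (kern R (\<lambda>z. ?F z * (inverse (q z) * M z))) x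
      + \<sigma> * set_conv Q (kern R (\<lambda>z. ?F z * (inverse (q z) * M z))) x = c'"
    using set_conv_kern_constant[OF P hc L'(2) eq R g] by blast
  have "kern R (\<lambda>z. ?F z * (inverse (q z) * M z)) = kern R (\<lambda>z. prod_list (map (\<lambda>w. z - w) zs) * M z)"
    by (rule kern_cong) (use zs(3,4) in \<open>auto simp: field_simps\<close>)
  then have "trig_poly (\<lambda>x. set_conv P (kern R (\<lambda>z. prod_list (map (\<lambda>w. z - w) zs) * M z)) x
      + \<sigma> * set_conv Q (kern R (\<lambda>z. prod_list (map (\<lambda>w. z - w) zs) * M z)) x)"
    using c' trig_poly_const[of c'] by simp
  then show ?thesis by (rule trig_poly_divide_zeros[OF P R M zs(2)])
qed

subsection \<open>Almost periods\<close>

text \<open>Dirichlet's simultaneous approximation, applied to the frequencies of both functions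
  divided by \<open>2 * pi\<close>, gives one positive integer \<open>t\<close> for both. The bound
  \<open>t >= 1\<close> later keeps the corrected period positive.\<close>

lemma trig_poly_common_almost_period:
  assumes "trig_poly u" "trig_poly v" "e > 0"
  obtains t where "t \<ge> 1" "\<And>x. norm (u (x + t) - u x) < e" "\<And>x. norm (v (x + t) - v x) < e"
proof -
  obtain \<Lambda> c where u: "finite \<Lambda>" "\<And>x. u x = (\<Sum>\<mu>\<in>\<Lambda>. c \<mu> * exp (\<i> * of_real (\<mu> * x)))"
    using assms(1) unfolding trig_poly_def by blast
  obtain \<Lambda>' c' where v: "finite \<Lambda>'" "\<And>x. v x = (\<Sum>\<mu>\<in>\<Lambda>'. c' \<mu> * exp (\<i> * of_real (\<mu> * x)))"
    using assms(2) unfolding trig_poly_def by blast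
  define B where "B = (\<Sum>\<mu>\<in>\<Lambda>. norm (c \<mu>)) + (\<Sum>\<mu>\<in>\<Lambda>'. norm (c' \<mu>)) + 1"
  have s0: "(\<Sum>\<mu>\<in>\<Lambda>. norm (c \<mu>)) \<ge> 0" "(\<Sum>\<mu>\<in>\<Lambda>'. norm (c' \<mu>)) \<ge> 0" by (auto intro: sum_nonneg)
  then have B: "B > 0" unfolding B_def by linarith
  obtain N :: nat where N: "2 * pi * B / e < real N" using reals_Archimedean2 by blast
  have "0 < 2 * pi * B / e" using B assms(3) by simp
  then have "real N > 0" using N by linarith
  then have N0: "N > 0" by simp
  have small: "2 * pi / N * B < e" using N N0 assms(3) by (simp add: field_simps)
  define n where "n = card (\<Lambda> \<union> \<Lambda>')"
  obtain f where f: "bij_betw f {..<n} (\<Lambda> \<union> \<Lambda>')"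
    using ex_bij_betw_nat_finite[OF finite_UnI[OF u(1) v(1)]] unfolding n_def atLeast0LessThan by blast
  obtain q p where q: "0 < q" "\<And>i. i < n \<Longrightarrow> \<bar>of_int q * (f i / (2 * pi)) - of_int (p i)\<bar> < 1 / N"
    by (rule Dirichlet_approx_simult[OF N0, of n "\<lambda>i. f i / (2 * pi)"]) (rule that)
  define t where "t = real_of_int q"
  have close: "norm (exp (\<i> * of_real (\<mu> * t)) - 1) \<le> 2 * pi / N" if "\<mu> \<in> \<Lambda> \<union> \<Lambda>'" for \<mu>
  proof -
    have "\<mu> \<in> f ` {..<n}" using f that by (simp add: bij_betw_def)
    then obtain i where i: "i < n" "\<mu> = f i" by blast
    define a where "a = \<mu> * t - 2 * pi * of_int (p i)"
    have "a = 2 * pi * (of_int q * (f i / (2 * pi)) - of_int (p i))"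
      unfolding a_def t_def i(2) right_diff_distrib by simp
    then have "\<bar>a\<bar> = 2 * pi * \<bar>of_int q * (f i / (2 * pi)) - of_int (p i)\<bar>"
      by (simp only: abs_mult) simp
    also have "\<dots> \<le> 2 * pi * (1 / N)" using q(2)[OF i(1)] by (intro mult_left_mono) auto
    finally have a: "\<bar>a\<bar> \<le> 2 * pi / N" by simp
    have "exp (\<i> * of_real (\<mu> * t)) = exp (\<i> * of_real a + 2 * of_int (p i) * of_real pi * \<i>)"
      unfolding a_def by (simp add: algebra_simps)
    also have "\<dots> = exp (\<i> * of_real a)"
      using exp_integer_2pi[of "of_int (p i)"] by (simp add: exp_add)
    finally have "norm (exp (\<i> * of_real (\<mu> * t)) - 1) = 2 * \<bar>sin (a / 2)\<bar>"
      using dist_exp_i_1[of a] by simp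
    also have "\<dots> \<le> \<bar>a\<bar>" using abs_sin_x_le_abs_x[of "a / 2"] by simp
    finally show ?thesis using a by linarith
  qed
  have gen: "norm ((\<Sum>\<mu>\<in>K. d \<mu> * exp (\<i> * of_real (\<mu> * (x + t)))) - (\<Sum>\<mu>\<in>K. d \<mu> * exp (\<i> * of_real (\<mu> * x)))) < e"
    if K: "K \<subseteq> \<Lambda> \<union> \<Lambda>'" "(\<Sum>\<mu>\<in>K. norm (d \<mu>)) \<le> B" for K d x
  proof -
    have "(\<Sum>\<mu>\<in>K. d \<mu> * exp (\<i> * of_real (\<mu> * (x + t)))) - (\<Sum>\<mu>\<in>K. d \<mu> * exp (\<i> * of_real (\<mu> * x)))
        = (\<Sum>\<mu>\<in>K. d \<mu> * exp (\<i> * of_real (\<mu> * x)) * (exp (\<i> * of_real (\<mu> * t)) - 1))"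
      unfolding sum_subtractf[symmetric] by (intro sum.cong refl) (simp add: algebra_simps exp_add)
    also have "norm \<dots> \<le> (\<Sum>\<mu>\<in>K. norm (d \<mu>) * (2 * pi / N))"
    proof (rule sum_norm_le)
      fix \<mu> assume "\<mu> \<in> K"
      then have "norm (d \<mu>) * norm (exp (\<i> * of_real (\<mu> * t)) - 1) \<le> norm (d \<mu>) * (2 * pi / N)"
        using close[of \<mu>] K by (intro mult_left_mono) auto
      then show "norm (d \<mu> * exp (\<i> * of_real (\<mu> * x)) * (exp (\<i> * of_real (\<mu> * t)) - 1)) \<le> norm (d \<mu>) * (2 * pi / N)"
        unfolding norm_mult norm_exp_i_times by simp
    qed
    also have "\<dots> = 2 * pi / N * (\<Sum>\<mu>\<in>K. norm (d \<mu>))"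
      by (simp only: sum_distrib_right[symmetric] mult.commute)
    also have "\<dots> \<le> 2 * pi / N * B" using K(2) by (intro mult_left_mono) auto
    also have "\<dots> < e" by (rule small)
    finally show ?thesis .
  qed
  show ?thesis
  proof (rule that[of t])
    show "t \<ge> 1" using q(1) unfolding t_def by linarith
    show "norm (u (x + t) - u x) < e" for x
      unfolding u(2) by (rule gen) (use s0 in \<open>auto simp: B_def\<close>)
    show "norm (v (x + t) - v x) < e" for x
      unfolding v(2) by (rule gen) (use s0 in \<open>auto simp: B_def\<close>)
  qed
qed

section \<open>A concentrated band-limited kernel\<close>

text \<open>The simplest nonnegative multiplier on the band with double zeros at both ends.\<close>

definition bump :: "real \<Rightarrow> complex \<Rightarrow> complex" where
  "bump R z = ((of_real R)\<^sup>2 - z\<^sup>2)\<^sup>2"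

lemma bump_deriv:
  "(bump R has_field_derivative - 4 * z * ((of_real R)\<^sup>2 - z\<^sup>2)) (at z)"
  unfolding bump_def[abs_def] by (auto intro!: derivative_eq_intros)

lemma bump_cutoff: "R \<ge> 0 \<Longrightarrow> cutoff R (bump R)"
  unfolding cutoff_def using DERIV_imp_deriv[OF bump_deriv]
  by (auto simp: bump_def[abs_def] intro!: exI[of _ UNIV] holomorphic_intros)

lemma kern_bump_0:
  assumes "R \<ge> 0"
  shows "norm (kern R (bump R) 0) \<ge> R ^ 5"
proof -
  have "((\<lambda>t. (R\<^sup>2 - t\<^sup>2)\<^sup>2) has_integral
      (R^4 * R - 2 * R\<^sup>2 * R^3 / 3 + R^5 / 5) - (R^4 * (-R) - 2 * R\<^sup>2 * (-R)^3 / 3 + (-R)^5 / 5)) {-R..R}"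
  proof (rule fundamental_theorem_of_calculus)
    fix t assume "t \<in> {-R..R}"
    show "((\<lambda>t. R^4 * t - 2 * R\<^sup>2 * t^3 / 3 + t^5 / 5) has_vector_derivative (R\<^sup>2 - t\<^sup>2)\<^sup>2) (at t within {-R..R})"
      unfolding has_real_derivative_iff_has_vector_derivative[symmetric]
      by (auto intro!: derivative_eq_intros simp: power2_eq_square algebra_simps power4_eq_xxxx)
  qed (use assms in auto)
  also have "(R^4 * R - 2 * R\<^sup>2 * R^3 / 3 + R^5 / 5) - (R^4 * (-R) - 2 * R\<^sup>2 * (-R)^3 / 3 + (-R)^5 / 5) = 16 / 15 * R ^ 5"
    by (simp add: field_simps power_numeral_reduce)
  finally have "((\<lambda>t. complex_of_real ((R\<^sup>2 - t\<^sup>2)\<^sup>2)) has_integral of_real (16 / 15 * R ^ 5)) {-R..R}"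
    by (rule has_integral_of_real)
  then have "kern R (bump R) 0 = of_real (16 / 15 * R ^ 5)"
    unfolding kern_def by (simp add: integral_unique bump_def)
  then have "norm (kern R (bump R) 0) = \<bar>16 / 15 * R ^ 5\<bar>" by (simp only: norm_of_real)
  then show ?thesis using zero_le_power[OF assms, of 5] by linarith
qed

text \<open>The second derivative \<open>12 t^2 - 4 R^2\<close> is at most \<open>8 R^2\<close> in
  size on a band of length \<open>2 R\<close>. The order \<open>R^3\<close> away from 0, against the
  peak of order \<open>R^5\<close> at 0, makes the kernel concentrate as \<open>R\<close>
  grows.\<close>

lemma kern_bump_decay:
  assumes R: "R \<ge> 0"
  shows "x\<^sup>2 * norm (kern R (bump R) x) \<le> 16 * R ^ 3"
proof -
  let ?G2 = "\<lambda>z::complex. 12 * z\<^sup>2 - 4 * (of_real R)\<^sup>2"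
  have c: "continuous_on {-R..R} (\<lambda>t. ?G2 (of_real t))" by (intro continuous_intros)
  have "(of_real x)\<^sup>2 * kern R (bump R) x = - kern R ?G2 x"
  proof (rule kern_by_parts[OF R bump_deriv _ c])
    fix t
    show "((\<lambda>z. - 4 * z * ((of_real R)\<^sup>2 - z\<^sup>2)) has_field_derivative ?G2 (of_real t)) (at (of_real t))"
      by (auto intro!: derivative_eq_intros simp: power2_eq_square algebra_simps)
  qed (auto simp: bump_def)
  then have "norm ((of_real x)\<^sup>2 * kern R (bump R) x) = norm (kern R ?G2 x)" by simp
  then have "x\<^sup>2 * norm (kern R (bump R) x) = norm (kern R ?G2 x)" by (simp add: norm_mult norm_power)
  also have "\<dots> \<le> 2 * R * (8 * R\<^sup>2)"
  proof (rule norm_kern_le[OF R c])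
    fix t assume "t \<in> {-R..R}"
    then have "t\<^sup>2 \<le> R\<^sup>2" using R by (intro power2_le_iff_abs_le[THEN iffD2]) auto
    then have "\<bar>12 * t\<^sup>2 - 4 * R\<^sup>2\<bar> \<le> 8 * R\<^sup>2" using zero_le_power2[of t] by linarith
    moreover have "?G2 (of_real t) = of_real (12 * t\<^sup>2 - 4 * R\<^sup>2)" by simp
    ultimately show "norm (?G2 (of_real t)) \<le> 8 * R\<^sup>2" by (simp only: norm_of_real)
  qed
  finally show ?thesis by (simp add: power_numeral_reduce)
qed

lemma set_conv_kern_far:
  assumes P: "\<And>x J. finite J \<Longrightarrow> J \<subseteq> P \<Longrightarrow> (\<Sum>p\<in>J. 1 / (1 + (x - p)\<^sup>2)) \<le> B"
    and d: "d > 0" and far: "\<And>p. p \<in> P \<Longrightarrow> \<bar>x - p\<bar> \<ge> d" and R: "R \<ge> 0"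
  shows "norm (set_conv P (kern R (bump R)) x) \<le> 16 * R ^ 3 * (1 + 1 / d\<^sup>2) * B"
  unfolding set_conv_def
proof (rule set_conv_bound[where x = x, OF P])
  fix p assume "p \<in> P"
  then have pd: "d\<^sup>2 \<le> (x - p)\<^sup>2" using far[of p] d by (simp flip: abs_le_square_iff)
  then have pos: "0 < (x - p)\<^sup>2" using d by (metis less_le_trans zero_less_power)
  have "1 + (x - p)\<^sup>2 \<le> (1 + 1 / d\<^sup>2) * (x - p)\<^sup>2"
    using pd d by (simp add: field_simps)
  then have "norm (kern R (bump R) (x - p)) * (1 + (x - p)\<^sup>2) \<le> norm (kern R (bump R) (x - p)) * ((1 + 1 / d\<^sup>2) * (x - p)\<^sup>2)"
    by (intro mult_left_mono) auto
  also have "\<dots> = (1 + 1 / d\<^sup>2) * ((x - p)\<^sup>2 * norm (kern R (bump R) (x - p)))" by (simp only: mult_ac)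
  also have "\<dots> \<le> (1 + 1 / d\<^sup>2) * (16 * R ^ 3)"
    by (intro mult_left_mono kern_bump_decay R) auto
  finally show "norm (kern R (bump R) (x - p)) \<le> 16 * R ^ 3 * (1 + 1 / d\<^sup>2) / (1 + (x - p)\<^sup>2)"
    by (simp add: pos_le_divide_eq add_pos_nonneg mult_ac)
qed (use R in auto)

text \<open>For large \<open>R\<close> the smoothed counting measure has size at least
  \<open>9/10 R^5\<close> at points of \<open>P\<close> and at most \<open>R^5 / 10\<close> at
  points away from \<open>P\<close>. A change by less than \<open>R^5 / 2\<close> cannot lead from
  one to the other.\<close>

lemma almost_period_match:
  assumes P: "uniform_discrete P" and e: "e > 0"
  obtains R0 where "R0 > 0" "\<And>R t p. R \<ge> R0 \<Longrightarrow>
     (\<And>x. norm (set_conv P (kern R (bump R)) (x + t) - set_conv P (kern R (bump R)) x) < R ^ 5 / 2) \<Longrightarrow>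
     p \<in> P \<Longrightarrow> (\<exists>p'\<in>P. \<bar>p + t - p'\<bar> < e) \<and> (\<exists>p'\<in>P. \<bar>p - t - p'\<bar> < e)"
proof -
  obtain B where B: "B > 0" "\<And>x J. finite J \<Longrightarrow> J \<subseteq> P \<Longrightarrow> (\<Sum>p\<in>J. 1 / (1 + (x - p)\<^sup>2)) \<le> B"
    using uniform_discrete_sum_bound[OF P] by metis
  obtain d0 where d0: "d0 > 0" "\<And>p q. p \<in> P \<Longrightarrow> q \<in> P \<Longrightarrow> dist p q < d0 \<Longrightarrow> p = q"
    using P unfolding uniform_discrete_def by blast
  \<comment> \<open>One distance for two uses: below \<open>d0\<close> it separates \<open>p\<close>
    from the rest of \<open>P\<close>, and below \<open>e\<close> it covers points with no neighbour
    within \<open>e\<close>.\<close>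
  define d where "d = min d0 e"
  have d: "d > 0" using d0 e unfolding d_def by simp
  define C where "C = 16 * (1 + 1 / d\<^sup>2) * B"
  have C: "C > 0" unfolding C_def using B(1) by (simp add: add_pos_nonneg)
  \<comment> \<open>\<open>R >= 10 C\<close> and \<open>R >= 1\<close> turn the far-field bound
    \<open>C R^3\<close> into \<open>R^5 / 10\<close>.\<close>
  define R0 where "R0 = 10 * C + 1"
  have far: "norm (set_conv P' (kern R (bump R)) x) \<le> R ^ 5 / 10"
    if P': "P' \<subseteq> P" "\<And>p. p \<in> P' \<Longrightarrow> \<bar>x - p\<bar> \<ge> d" and R: "R \<ge> R0" for P' R x
  proof -
    have R1: "R \<ge> 1" "10 * C \<le> R" using R C unfolding R0_def by auto
    have "norm (set_conv P' (kern R (bump R)) x) \<le> 16 * R ^ 3 * (1 + 1 / d\<^sup>2) * B"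
      by (rule set_conv_kern_far[OF _ d]) (use B P' R1 in auto)
    also have "\<dots> = C * R ^ 3" unfolding C_def by simp
    also have "\<dots> \<le> R ^ 5 / 10"
    proof -
      have "10 * C * R ^ 3 \<le> R * R ^ 3" using R1 by (intro mult_right_mono) auto
      also have "\<dots> \<le> R * (R * R ^ 3)" using R1 by (intro mult_left_mono) (auto simp: mult_le_cancel_right1)
      also have "\<dots> = R ^ 5" by (simp add: power_numeral_reduce)
      finally show ?thesis by simp
    qed
    finally show ?thesis .
  qed
  have near: "norm (set_conv P (kern R (bump R)) p) \<ge> R ^ 5 - R ^ 5 / 10" if p: "p \<in> P" and R: "R \<ge> R0" for p R
  proof -
    have R1: "R \<ge> 0" using R C unfolding R0_def by auto
    have s: "(\<lambda>q. kern R (bump R) (p - q)) summable_on P"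
      by (rule abs_summable_summable[OF quad_decay_summable[OF P kern_quad_decay[OF R1 bump_cutoff[OF R1]]]])
    have "set_conv P (kern R (bump R)) p = set_conv (P - {p}) (kern R (bump R)) p + kern R (bump R) 0"
    proof -
      have "set_conv P (kern R (bump R)) p = (\<Sum>\<^sub>\<infinity>q\<in>(P - {p}) \<union> {p}. kern R (bump R) (p - q))"
        unfolding set_conv_def using p by (simp add: insert_absorb)
      also have "\<dots> = (\<Sum>\<^sub>\<infinity>q\<in>P - {p}. kern R (bump R) (p - q)) + (\<Sum>\<^sub>\<infinity>q\<in>{p}. kern R (bump R) (p - q))"
        by (rule infsum_Un_disjoint) (use s in \<open>auto intro: summable_on_subset_banach\<close>)
      finally show ?thesis unfolding set_conv_def by simp
    qed
    then have "norm (kern R (bump R) 0) \<le> norm (set_conv P (kern R (bump R)) p) + norm (set_conv (P - {p}) (kern R (bump R)) p)"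
      by (metis add_diff_cancel_left' norm_triangle_ineq4)
    moreover have "norm (set_conv (P - {p}) (kern R (bump R)) p) \<le> R ^ 5 / 10"
    proof (rule far[OF _ _ R])
      fix q assume q: "q \<in> P - {p}"
      show "\<bar>p - q\<bar> \<ge> d"
      proof (rule ccontr)
        assume "\<not> \<bar>p - q\<bar> \<ge> d"
        then have "dist p q < d0" unfolding d_def dist_real_def by auto
        then show False using d0(2)[of p q] p q by auto
      qed
    qed auto
    ultimately show ?thesis using kern_bump_0[OF R1] by linarith
  qed
  have key: "\<exists>p'\<in>P. \<bar>y - p'\<bar> < e" if p: "p \<in> P" and R: "R \<ge> R0"
    and c: "norm (set_conv P (kern R (bump R)) p - set_conv P (kern R (bump R)) y) < R ^ 5 / 2" for p y R
  proof (rule ccontr)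
    assume "\<not> (\<exists>p'\<in>P. \<bar>y - p'\<bar> < e)"
    then have "norm (set_conv P (kern R (bump R)) y) \<le> R ^ 5 / 10"
      by (intro far[OF _ _ R]) (auto simp: d_def not_less min.coboundedI2)
    moreover have "norm (set_conv P (kern R (bump R)) p) \<le> norm (set_conv P (kern R (bump R)) y)
        + norm (set_conv P (kern R (bump R)) p - set_conv P (kern R (bump R)) y)"
      by (metis add.commute norm_triangle_sub)
    moreover have "R ^ 5 > 0" using R C unfolding R0_def by simp
    ultimately show False using near[OF p R] c by linarith
  qed
  show ?thesis
  proof (rule that[of R0])
    fix R t p assume R: "R \<ge> R0" and *: "\<And>x. norm (set_conv P (kern R (bump R)) (x + t) - set_conv P (kern R (bump R)) x) < R ^ 5 / 2"
      and p: "p \<in> P"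
    \<comment> \<open>The hypothesis at \<open>x = p\<close> treats \<open>p + t\<close>; at
      \<open>x = p - t\<close> it compares the value at \<open>p - t\<close> with the large one at
      \<open>p\<close>.\<close>
    show "(\<exists>p'\<in>P. \<bar>p + t - p'\<bar> < e) \<and> (\<exists>p'\<in>P. \<bar>p - t - p'\<bar> < e)"
      using key[OF p R, of "p + t"] key[OF p R, of "p - t"] *[of p] *[of "p - t"] by (simp add: norm_minus_commute)
  qed (use C in \<open>simp add: R0_def\<close>)
qed

subsection \<open>Rigidity of tilings of the line\<close>

lemma lmeasurable_Int_Ioc:
  assumes "E \<in> lmeasurable"
  shows "E \<inter> {x<..y::real} \<in> lmeasurable"
  using assms by (rule fmeasurable.Int) (simp add: bounded_set_imp_lmeasurable)

lemma measure_Ioc_lebesgue: "x \<le> y \<Longrightarrow> measure lebesgue {x<..y::real} = y - x"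
  by simp

lemma measure_Int_Icc_Ioc:
  assumes "E \<in> lmeasurable"
  shows "measure lebesgue (E \<inter> {x..y::real}) = measure lebesgue (E \<inter> {x<..y})"
proof -
  have "negligible {x}" by simp
  then have "AE z in lebesgue. z \<notin> {x}" by (metis AE_not_in negligible_iff_null_sets)
  then have "AE z in lebesgue. z \<in> E \<inter> {x..y} \<longleftrightarrow> z \<in> E \<inter> {x<..y}"
    by eventually_elim auto
  then show ?thesis
    using assms by (intro measure_eq_AE) auto
qed

lemma AE_lebesgue_shift:
  assumes "AE x in lebesgue. P (x::real)"
  shows "AE x in lebesgue. P (x + c)"
proof -
  obtain N where N: "N \<in> null_sets lebesgue" "{x. \<not> P x} \<subseteq> N"
    using assms unfolding eventually_ae_filter by auto
  then have "negligible N" by (simp add: negligible_iff_null_sets)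
  then have "negligible ((+) (-c) ` N)" by (rule negligible_translation)
  then have "(+) (-c) ` N \<in> null_sets lebesgue" by (simp add: negligible_iff_null_sets)
  then show ?thesis
  proof (rule AE_I'[rotated, rotated])
    show "{x \<in> space lebesgue. \<not> P (x + c)} \<subseteq> (+) (-c) ` N"
    proof
      fix x assume "x \<in> {x \<in> space lebesgue. \<not> P (x + c)}"
      then have "x + c \<in> N" using N by auto
      moreover have "x = -c + (x + c)" by simp
      ultimately show "x \<in> (+) (-c) ` N" by (rule image_eqI[rotated])
    qed
  qed
qed

lemma lebesgue_right_derivative:
  fixes f :: "real \<Rightarrow> real"
  assumes "\<And>a b. f integrable_on {a..b}"
  obtains N where "negligible N"
    "\<And>x e. x \<notin> N \<Longrightarrow> 0 < e \<Longrightarrow> \<exists>d>0. \<forall>h. 0 < h \<and> h < d \<longrightarrow> \<bar>integral {x..x + h} f / h - f x\<bar> < e"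
proof -
  have "\<And>a b. f integrable_on cbox a b" using assms by simp
  from integrable_ccontinuous_explicit[OF this]
  obtain N where N: "negligible N"
    "\<And>x e. x \<notin> N \<Longrightarrow> 0 < e \<Longrightarrow> \<exists>d>0. \<forall>h. 0 < h \<and> h < d \<longrightarrow>
        norm (integral (cbox x (x + h *\<^sub>R One)) f /\<^sub>R h ^ DIM(real) - f x) < e" by blast
  show ?thesis
    by (rule that[OF N(1)]) (use N(2) in \<open>simp add: divide_inverse mult.commute\<close>)
qed

lemma indicator_integrable_on_Icc:
  fixes E :: "real set"
  assumes "E \<in> lmeasurable"
  shows "indicat_real E integrable_on {a..b}" "integral {a..b} (indicat_real E) = measure lebesgue (E \<inter> {a..b})"
proof -
  have "E \<inter> {a..b} \<in> lmeasurable" using assms by (rule fmeasurable.Int) simp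
  then have i: "(indicat_real (E \<inter> {a..b}) has_integral measure lebesgue (E \<inter> {a..b})) UNIV"
    using lmeasurable_iff_has_integral by blast
  have "(\<lambda>x. if x \<in> {a..b} then indicat_real E x else 0) = indicat_real (E \<inter> {a..b})"
    by (auto simp: indicator_def)
  with i have "((\<lambda>x. if x \<in> {a..b} then indicat_real E x else 0) has_integral measure lebesgue (E \<inter> {a..b})) UNIV"
    by simp
  then have "(indicat_real E has_integral measure lebesgue (E \<inter> {a..b})) {a..b}"
    by (simp only: has_integral_restrict_UNIV)
  then show "indicat_real E integrable_on {a..b}" "integral {a..b} (indicat_real E) = measure lebesgue (E \<inter> {a..b})"
    by (auto intro: has_integral_integrable integral_unique)
qed

text \<open>One-sided density is the form used by rigidity, which measures the tile in intervals to
  the right of a point.\<close>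

lemma right_density_point:
  fixes E :: "real set"
  assumes E: "E \<in> lmeasurable" "measure lebesgue E > 0"
  obtains x d where "d > 0" "\<And>h. 0 < h \<Longrightarrow> h \<le> d \<Longrightarrow> measure lebesgue (E \<inter> {x<..x + h}) \<ge> 9 / 10 * h"
proof -
  obtain N where N: "negligible N"
    "\<And>x e. x \<notin> N \<Longrightarrow> 0 < e \<Longrightarrow> \<exists>d>0. \<forall>h. 0 < h \<and> h < d \<longrightarrow> \<bar>integral {x..x + h} (indicat_real E) / h - indicat_real E x\<bar> < e"
    using lebesgue_right_derivative[of "indicat_real E", OF indicator_integrable_on_Icc(1)[OF E(1)]] by blast
  have "\<not> E \<subseteq> N"
    using negligible_subset[OF N(1)] E negligible_imp_measure0 by (metis less_irrefl)
  then obtain x where x: "x \<in> E" "x \<notin> N" by blast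
  from N(2)[OF x(2), of "1 / 10"] obtain d where d: "d > 0"
    "\<And>h. 0 < h \<Longrightarrow> h < d \<Longrightarrow> \<bar>integral {x..x + h} (indicat_real E) / h - indicat_real E x\<bar> < 1 / 10" by auto
  show ?thesis
  proof (rule that[of "d / 2" x])
    fix h assume h: "0 < h" "h \<le> d / 2"
    have "\<bar>integral {x..x + h} (indicat_real E) / h - 1\<bar> < 1 / 10" using d(2)[of h] d(1) h x by simp
    then have "\<bar>measure lebesgue (E \<inter> {x<..x + h}) / h - 1\<bar> < 1 / 10"
      by (simp only: indicator_integrable_on_Icc(2)[OF E(1)] measure_Int_Icc_Ioc[OF E(1)])
    then have "9 / 10 < measure lebesgue (E \<inter> {x<..x + h}) / h" by linarith
    then show "measure lebesgue (E \<inter> {x<..x + h}) \<ge> 9 / 10 * h" using h by (simp add: pos_less_divide_eq)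
  qed (use d in auto)
qed

lemma translation_mem: "x \<in> (+) a ` E \<longleftrightarrow> x - a \<in> (E :: real set)"
  by (auto intro!: image_eqI[of _ _ "x - a"])

text \<open>A Steinhaus-type fact: two copies of \<open>E\<close>, each filling 9/10 of an interval
  of length \<open>d\<close>, lie in an interval of length \<open>d + c\<close> and must overlap
  when \<open>c < d / 10\<close>. The negated almost-everywhere form contradicts disjointness of
  tiles directly.\<close>

lemma overlap_positive:
  fixes E :: "real set"
  assumes E: "E \<in> lmeasurable" "measure lebesgue E > 0"
  obtains d where "d > 0" "\<And>c. \<bar>c\<bar> < d \<Longrightarrow> \<not> (AE x in lebesgue. \<not> (x \<in> E \<and> x - c \<in> E))"
proof -
  obtain x d where d: "d > 0" "\<And>h. 0 < h \<Longrightarrow> h \<le> d \<Longrightarrow> measure lebesgue (E \<inter> {x<..x + h}) \<ge> 9 / 10 * h"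
    using right_density_point[OF E] by blast
  have pos: "\<not> (AE x in lebesgue. \<not> (x \<in> E \<and> x - c \<in> E))" if c: "0 \<le> c" "c < d / 10" for c
  proof
    assume ae: "AE x in lebesgue. \<not> (x \<in> E \<and> x - c \<in> E)"
    let ?A = "E \<inter> {x<..x + d}" and ?B = "(+) c ` (E \<inter> {x<..x + d})"
    have m: "?A \<in> lmeasurable" "?B \<in> lmeasurable"
      using lmeasurable_Int_Ioc[OF E(1)] by (auto intro: measurable_translation)
    have "measure lebesgue (?A \<union> ?B) = measure lebesgue ?A + measure lebesgue ?B"
    proof (rule measure_Un_AE[OF _ m])
      show "AE z in lebesgue. z \<notin> ?A \<or> z \<notin> ?B" using ae by eventually_elim (auto simp: translation_mem)
    qed
    also have "measure lebesgue ?B = measure lebesgue ?A" by (rule measure_translation)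
    finally have "measure lebesgue (?A \<union> ?B) \<ge> 18 / 10 * d" using d(2)[of d] d(1) by simp
    moreover have "measure lebesgue (?A \<union> ?B) \<le> measure lebesgue {x<..x + d + c}"
      using m c by (intro measure_mono_fmeasurable) (auto simp: bounded_set_imp_lmeasurable fmeasurableD)
    moreover have "measure lebesgue {x<..x + d + c} = d + c" using d(1) c by (subst measure_Ioc_lebesgue) auto
    ultimately show False using c d(1) by linarith
  qed
  show ?thesis
  proof (rule that[of "d / 10"])
    fix c assume c: "\<bar>c\<bar> < d / 10"
    show "\<not> (AE x in lebesgue. \<not> (x \<in> E \<and> x - c \<in> E))"
    proof (cases "c \<ge> 0")
      case True
      then show ?thesis using pos c by auto
    next
      case False
      show ?thesis
      proof
        assume "AE x in lebesgue. \<not> (x \<in> E \<and> x - c \<in> E)"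
        from AE_lebesgue_shift[OF this, of c]
        have "AE x in lebesgue. \<not> (x \<in> E \<and> x - (-c) \<in> E)" by eventually_elim auto
        then show False using pos[of "-c"] False c by auto
      qed
    qed
  qed (use d in auto)
qed

text \<open>Tiles are indexed rather than collected in a set, so that equal translates in different
  roles are counted separately and each tile can move on its own.\<close>

definition fam_tiling :: "'i set \<Rightarrow> ('i \<Rightarrow> real) \<Rightarrow> ('i \<Rightarrow> real set) \<Rightarrow> bool" where
  "fam_tiling I a E \<longleftrightarrow> (AE x in lebesgue. \<exists>!i. i \<in> I \<and> x - a i \<in> E i)"

lemma fam_tiling_shift:
  assumes "fam_tiling I a E"
  shows "fam_tiling I (\<lambda>i. a i + c) E"
proof -
  have "AE x in lebesgue. \<exists>!i. i \<in> I \<and> (x + (-c)) - a i \<in> E i"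
    using assms unfolding fam_tiling_def by (rule AE_lebesgue_shift)
  then show ?thesis unfolding fam_tiling_def by (simp add: algebra_simps)
qed

text \<open>Integration of the covering identity over \<open>{x<..y}\<close>, where the finitely
  many tiles in \<open>J\<close> are the only ones that matter.\<close>

lemma fam_tiling_measure:
  assumes t: "fam_tiling I a E" and J: "finite J" "J \<subseteq> I" and E: "\<And>i. i \<in> J \<Longrightarrow> E i \<in> lmeasurable"
    and far: "\<And>i z. i \<in> I - J \<Longrightarrow> z \<in> {x<..y} \<Longrightarrow> z - a i \<notin> E i" and xy: "x \<le> y"
  shows "(\<Sum>i\<in>J. measure lebesgue (E i \<inter> {x - a i<..y - a i})) = y - x"
proof -
  let ?T = "\<lambda>i. (+) (a i) ` (E i \<inter> {x - a i<..y - a i})"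
  have m: "?T i \<in> lmeasurable" if "i \<in> J" for i
    using lmeasurable_Int_Ioc[OF E[OF that]] by (rule measurable_translation)
  have "(\<Sum>i\<in>J. measure lebesgue (E i \<inter> {x - a i<..y - a i})) = (\<Sum>i\<in>J. measure lebesgue (?T i))"
    by (simp add: measure_translation)
  also have "\<dots> = (\<Sum>i\<in>J. integral\<^sup>L lebesgue (indicat_real (?T i)))" by simp
  also have "\<dots> = integral\<^sup>L lebesgue (\<lambda>z. \<Sum>i\<in>J. indicat_real (?T i) z)"
  proof (rule Bochner_Integration.integral_sum[symmetric])
    fix i assume "i \<in> J"
    then show "integrable lebesgue (indicat_real (?T i))"
      using m[of i] unfolding fmeasurable_def by (intro integrable_real_indicator) blast+
  qed
  also have "\<dots> = integral\<^sup>L lebesgue (indicat_real {x<..y})"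
  proof (rule integral_cong_AE)
    show "(\<lambda>z. \<Sum>i\<in>J. indicat_real (?T i) z) \<in> borel_measurable lebesgue"
      using m by (intro borel_measurable_sum borel_measurable_indicator) (auto simp: fmeasurableD)
    show "indicat_real {x<..y} \<in> borel_measurable lebesgue" by (intro borel_measurable_indicator) auto
    show "AE z in lebesgue. (\<Sum>i\<in>J. indicat_real (?T i) z) = indicat_real {x<..y} z"
      using t unfolding fam_tiling_def
    proof eventually_elim
      case (elim z)
      then obtain k where k: "k \<in> I" "z - a k \<in> E k" "\<And>i. i \<in> I \<Longrightarrow> z - a i \<in> E i \<Longrightarrow> i = k"
        by (elim ex1E) blast
      show ?case
      proof (cases "z \<in> {x<..y}")
        case True
        then have kJ: "k \<in> J" using far[of k z] k by blast
        have "(\<Sum>i\<in>J. indicat_real (?T i) z) = (\<Sum>i\<in>J. if i = k then 1 else 0)"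
        proof (rule sum.cong)
          fix i assume i: "i \<in> J"
          have "z \<in> ?T i \<longleftrightarrow> z - a i \<in> E i" unfolding translation_mem using True by simp
          also have "\<dots> \<longleftrightarrow> i = k" using i J(2) k by blast
          finally have "z \<in> ?T i \<longleftrightarrow> i = k" .
          then show "indicat_real (?T i) z = (if i = k then 1 else 0)" by (auto simp: indicator_def)
        qed simp
        also have "\<dots> = 1" using kJ J(1) by simp
        finally show ?thesis using True by simp
      next
        case False
        then have "indicat_real (?T i) z = 0" for i
          by (intro indicator_simps(2)) (auto simp only: translation_mem Int_iff greaterThanAtMost_iff diff_less_eq le_diff_eq diff_add_cancel diff_le_eq less_diff_eq)
        then show ?thesis by (simp only: sum.neutral_const indicator_simps(2)[OF False])
      qed
    qed
  qed
  also have "\<dots> = measure lebesgue {x<..y}" unfolding Bochner_Integration.integral_indicator by simp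
  also have "\<dots> = y - x" by (rule measure_Ioc_lebesgue[OF xy])
  finally show ?thesis .
qed

lemma measure_Ioc_split:
  fixes E :: "real set"
  assumes "E \<in> lmeasurable" "u \<le> v" "v \<le> w"
  shows "measure lebesgue (E \<inter> {u<..w}) = measure lebesgue (E \<inter> {u<..v}) + measure lebesgue (E \<inter> {v<..w})"
proof -
  have "E \<inter> {u<..w} = (E \<inter> {u<..v}) \<union> (E \<inter> {v<..w})" using assms by auto
  also have "measure lebesgue \<dots> = measure lebesgue (E \<inter> {u<..v}) + measure lebesgue (E \<inter> {v<..w})"
    by (rule measure_Un_AE) (use lmeasurable_Int_Ioc[OF assms(1)] in auto)
  finally show ?thesis .
qed

lemma measure_Ioc_le:
  fixes E :: "real set"
  assumes "E \<in> lmeasurable" "u \<le> v"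
  shows "measure lebesgue (E \<inter> {u<..v}) \<le> v - u"
proof -
  have "measure lebesgue (E \<inter> {u<..v}) \<le> measure lebesgue {u<..v}"
    using lmeasurable_Int_Ioc[OF assms(1), of u v]
    by (intro measure_mono_fmeasurable) (auto simp: bounded_set_imp_lmeasurable fmeasurableD)
  then show ?thesis using assms(2) by simp
qed

text \<open>Integrating the difference of the two tilings shows that the total mass swept by the tiles
across a point, when each tile \<open>i\<close> moves by its own displacement, does not depend on the point.
At a density point of a tile that mass is nearly the displacement of that tile.\<close>

lemma fam_tiling_rigid:
  fixes I :: "'i set" and a e :: "'i \<Rightarrow> real"
  assumes fin: "\<And>B. finite {i\<in>I. \<bar>a i\<bar> \<le> B}"
    and E: "\<And>i. i \<in> I \<Longrightarrow> E i \<in> lmeasurable" "\<And>i. i \<in> I \<Longrightarrow> E i \<subseteq> {-L..L}"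
    and t1: "fam_tiling I a E" and t2: "fam_tiling I (\<lambda>i. a i - e i) E"
    and eb: "\<And>i. i \<in> I \<Longrightarrow> \<bar>e i\<bar> \<le> \<epsilon>"
    and dens: "\<And>i. i \<in> I \<Longrightarrow> \<exists>x. \<forall>h. 0 < h \<and> h \<le> 2 * \<epsilon> \<longrightarrow> measure lebesgue (E i \<inter> {x<..x + h}) \<ge> 9 / 10 * h"
    and ij: "i0 \<in> I" "j0 \<in> I"
  shows "e i0 = e j0"
proof -
  define m s where "m = Inf (e ` I)" and "s = Sup (e ` I)"
  define M where "M = s - m"
  have bdd: "bdd_above (e ` I)" "bdd_below (e ` I)"
    using eb by (auto intro!: bdd_aboveI[of _ \<epsilon>] bdd_belowI[of _ "-\<epsilon>"] simp: abs_le_iff minus_le_iff)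
  have ms: "m \<le> e i" "e i \<le> s" if "i \<in> I" for i
    using that bdd unfolding m_def s_def by (auto intro: cInf_lower cSup_upper)
  have "s \<le> \<epsilon>" unfolding s_def using ij eb by (intro cSup_least) (auto simp: abs_le_iff)
  moreover have "-\<epsilon> \<le> m" unfolding m_def using ij eb by (intro cInf_greatest) (auto simp: abs_le_iff minus_le_iff)
  ultimately have M2: "M \<le> 2 * \<epsilon>" unfolding M_def by linarith
  have "M \<le> 0"
  proof (rule ccontr)
    assume "\<not> M \<le> 0"
    then have M: "M > 0" by simp
    \<comment> \<open>\<open>k\<close> and \<open>l\<close> have displacements within
      \<open>M / 10\<close> of the supremum and of the infimum; comparing the mass swept at a
      density point of each will give the contradiction.\<close>
    obtain k where k: "k \<in> I" "s - M / 10 < e k"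
      using less_cSup_iff[of "e ` I" "s - M / 10"] bdd ij M unfolding s_def by auto
    obtain l where l: "l \<in> I" "e l < m + M / 10"
      using cInf_less_iff[of "e ` I" "m + M / 10"] bdd ij M unfolding m_def by auto
    \<comment> \<open>A common shift by \<open>m\<close> makes all displacements nonnegative, so
      every tile sweeps in one direction.\<close>
    define f where "f i = e i - m" for i
    have f: "0 \<le> f i" "f i \<le> M" if "i \<in> I" for i using ms[OF that] unfolding f_def M_def by auto
    have fk: "f k \<ge> 9 / 10 * M" using k unfolding f_def M_def by (simp add: field_simps)
    have fl: "f l \<le> M / 10" using l unfolding f_def by linarith
    have t3: "fam_tiling I (\<lambda>i. a i - f i) E"
      using fam_tiling_shift[OF t2, of m] unfolding f_def by (simp add: algebra_simps)
    obtain xk where xk: "\<And>h. 0 < h \<Longrightarrow> h \<le> 2 * \<epsilon> \<Longrightarrow> measure lebesgue (E k \<inter> {xk<..xk + h}) \<ge> 9 / 10 * h"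
      using dens[OF k(1)] by blast
    obtain xl where xl: "\<And>h. 0 < h \<Longrightarrow> h \<le> 2 * \<epsilon> \<Longrightarrow> measure lebesgue (E l \<inter> {xl<..xl + h}) \<ge> 9 / 10 * h"
      using dens[OF l(1)] by blast
    define z w where "z = a k + xk" and "w = a l + xl"
    \<comment> \<open>Chosen so that tiles outside \<open>J\<close> miss all intervals considered,
      even after a displacement up to \<open>M\<close>, while \<open>k\<close> and \<open>l\<close>
      lie in \<open>J\<close>.\<close>
    define B where "B = \<bar>z\<bar> + \<bar>w\<bar> + \<bar>L\<bar> + 2 * M + \<bar>a k\<bar> + \<bar>a l\<bar>"
    define J where "J = {i\<in>I. \<bar>a i\<bar> \<le> B}"
    have J: "finite J" "J \<subseteq> I" "k \<in> J" "l \<in> J"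
      using fin k l M unfolding J_def B_def by auto
    have far: "v - (a i - g) \<notin> E i" if "i \<in> I - J" "v \<in> {x<..y}" "0 \<le> g" "g \<le> M"
      "\<bar>x\<bar> \<le> \<bar>z\<bar> + \<bar>w\<bar> + M" "\<bar>y\<bar> \<le> \<bar>z\<bar> + \<bar>w\<bar> + M" for i v g x y
    proof
      assume "v - (a i - g) \<in> E i"
      then have "v - (a i - g) \<in> {-L..L}" using E(2)[of i] that(1) by blast
      then have "\<bar>v - (a i - g)\<bar> \<le> L" unfolding atLeastAtMost_iff by linarith
      moreover have "\<bar>a i\<bar> > B" using that unfolding J_def by auto
      moreover have "\<bar>v\<bar> \<le> \<bar>z\<bar> + \<bar>w\<bar> + M" using that by auto
      ultimately show False using that(3,4) unfolding B_def by linarith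
    qed
    \<comment> \<open>The total mass swept across \<open>x\<close>; the two tilings will show that
      it is the same at \<open>z\<close> and \<open>w\<close>.\<close>
    define S where "S x = (\<Sum>i\<in>J. measure lebesgue (E i \<inter> {x - a i<..x - a i + f i}))" for x
    have S_eq: "S x = S y" if xy: "x \<le> y" "\<bar>x\<bar> \<le> \<bar>z\<bar> + \<bar>w\<bar> + M" "\<bar>y\<bar> \<le> \<bar>z\<bar> + \<bar>w\<bar> + M" for x y
    proof -
      have 1: "(\<Sum>i\<in>J. measure lebesgue (E i \<inter> {x - a i<..y - a i})) = y - x"
        by (rule fam_tiling_measure[OF t1 J(1,2) _ _ xy(1)]) (use E(1) J(2) far[where g = 0, OF _ _ _ _ xy(2,3)] M in auto)
      have 2: "(\<Sum>i\<in>J. measure lebesgue (E i \<inter> {x - (a i - f i)<..y - (a i - f i)})) = y - x"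
      proof (rule fam_tiling_measure[OF t3 J(1,2) _ _ xy(1)])
        fix i v assume "i \<in> I - J" "v \<in> {x<..y}"
        then show "v - (a i - f i) \<notin> E i" using far[OF _ _ f xy(2,3)] by blast
      qed (use E(1) J(2) in auto)
      \<comment> \<open>Both sides measure \<open>E i\<close> between \<open>x - a i\<close> and
        \<open>y - a i + f i\<close>, cut in two different ways.\<close>
      have "measure lebesgue (E i \<inter> {x - a i<..x - a i + f i}) + measure lebesgue (E i \<inter> {x - (a i - f i)<..y - (a i - f i)})
          = measure lebesgue (E i \<inter> {y - a i<..y - a i + f i}) + measure lebesgue (E i \<inter> {x - a i<..y - a i})"
        if i: "i \<in> J" for i
      proof -
        have iI: "i \<in> I" using i J(2) by blast
        have e: "x - (a i - f i) = x - a i + f i" "y - (a i - f i) = y - a i + f i" by auto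
        show ?thesis
          unfolding e using measure_Ioc_split[OF E(1)[OF iI], of "x - a i" "x - a i + f i" "y - a i + f i"]
            measure_Ioc_split[OF E(1)[OF iI], of "x - a i" "y - a i" "y - a i + f i"] xy(1) f[OF iI] by simp
      qed
      then have "S x + (\<Sum>i\<in>J. measure lebesgue (E i \<inter> {x - (a i - f i)<..y - (a i - f i)})) =
          S y + (\<Sum>i\<in>J. measure lebesgue (E i \<inter> {x - a i<..y - a i}))"
        unfolding S_def sum.distrib[symmetric] by (rule sum.cong[OF refl])
      then show ?thesis unfolding 1 2 by (rule add_right_imp_eq)
    qed
    have zw: "\<bar>z\<bar> \<le> \<bar>z\<bar> + \<bar>w\<bar> + M" "\<bar>w\<bar> \<le> \<bar>z\<bar> + \<bar>w\<bar> + M" using M by linarith+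
    have "S z = S w"
    proof (cases "z \<le> w")
      case True
      then show ?thesis by (rule S_eq[OF _ zw])
    next
      case False
      then have "w \<le> z" by linarith
      from S_eq[OF this zw(2,1)] show ?thesis by (rule sym)
    qed
    \<comment> \<open>Tile \<open>k\<close> alone sweeps 9/10 of \<open>f k\<close>, and
      \<open>f k >= 9/10 M\<close>.\<close>
    moreover have "S z \<ge> 81 / 100 * M"
    proof -
      have "9 / 10 * f k \<le> measure lebesgue (E k \<inter> {xk<..xk + f k})"
        using fk M f(2)[OF k(1)] M2 by (intro xk) auto
      also have "\<dots> = measure lebesgue (E k \<inter> {z - a k<..z - a k + f k})" unfolding z_def by simp
      also have "\<dots> \<le> S z"
        unfolding S_def using J by (intro member_le_sum) auto
      finally show ?thesis using fk by linarith
    qed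
    \<comment> \<open>Tile \<open>l\<close> fills 9/10 of the interval of length \<open>M\<close>
      after \<open>w\<close>, leaving at most \<open>M / 10\<close> to the others; \<open>l\<close>
      itself sweeps at most \<open>f l <= M / 10\<close>.\<close>
    moreover have "S w \<le> 2 / 10 * M"
    proof -
      have tot: "(\<Sum>i\<in>J. measure lebesgue (E i \<inter> {w - a i<..(w + M) - a i})) = (w + M) - w"
        by (rule fam_tiling_measure[OF t1 J(1,2)]) (use E(1) J(2) far[where g = 0 and x = w and y = "w + M"] M in auto)
      have "S w = measure lebesgue (E l \<inter> {w - a l<..w - a l + f l}) + (\<Sum>i\<in>J - {l}. measure lebesgue (E i \<inter> {w - a i<..w - a i + f i}))"
        unfolding S_def by (rule sum.remove[OF J(1,4)])
      also have "\<dots> \<le> f l + (\<Sum>i\<in>J - {l}. measure lebesgue (E i \<inter> {w - a i<..(w + M) - a i}))"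
      proof (intro add_mono sum_mono)
        show "measure lebesgue (E l \<inter> {w - a l<..w - a l + f l}) \<le> f l"
          using measure_Ioc_le[OF E(1)[OF l(1)], of "w - a l" "w - a l + f l"] f[OF l(1)] by simp
        fix i assume "i \<in> J - {l}"
        then have iI: "i \<in> I" using J(2) by blast
        show "measure lebesgue (E i \<inter> {w - a i<..w - a i + f i}) \<le> measure lebesgue (E i \<inter> {w - a i<..(w + M) - a i})"
          using lmeasurable_Int_Ioc[OF E(1)[OF iI]] f[OF iI]
          by (intro measure_mono_fmeasurable) (auto simp: fmeasurableD)
      qed
      also have "\<dots> = f l + (M - measure lebesgue (E l \<inter> {w - a l<..(w + M) - a l}))"
        using tot sum.remove[OF J(1,4), of "\<lambda>i. measure lebesgue (E i \<inter> {w - a i<..(w + M) - a i})"] by linarith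
      finally have "S w \<le> f l + (M - measure lebesgue (E l \<inter> {w - a l<..(w + M) - a l}))" .
      moreover have "measure lebesgue (E l \<inter> {w - a l<..(w + M) - a l}) \<ge> 9 / 10 * M"
        using xl[of M] M M2 unfolding w_def by (simp add: algebra_simps)
      ultimately show ?thesis using fl by linarith
    qed
    ultimately show False using M by linarith
  qed
  then show ?thesis using ms[OF ij(1)] ms[OF ij(2)] unfolding M_def by linarith
qed

subsection \<open>Tilings of two copies of the line\<close>

lemma fam_tiling_reindex:
  assumes t: "fam_tiling I a E" and g: "bij_betw g I' I"
    and a': "\<And>i. i \<in> I' \<Longrightarrow> a' i = a (g i)" and E': "\<And>i. i \<in> I' \<Longrightarrow> E' i = E (g i)"
  shows "fam_tiling I' a' E'"
  using t unfolding fam_tiling_def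
proof eventually_elim
  case (elim x)
  from elim obtain k where k: "k \<in> I \<and> x - a k \<in> E k" and uniq: "\<forall>i. i \<in> I \<and> x - a i \<in> E i \<longrightarrow> i = k"
    by (rule ex1E)
  have gI: "g ` I' = I" "inj_on g I'" using g by (simp_all add: bij_betw_def)
  from k have "k \<in> g ` I'" unfolding gI(1) by (rule conjunct1)
  then obtain k' where k': "k = g k'" "k' \<in> I'" by (rule imageE)
  show ?case
  proof (rule ex1I[of _ k'])
    show "k' \<in> I' \<and> x - a' k' \<in> E' k'"
      unfolding a'[OF k'(2)] E'[OF k'(2)] k'(1)[symmetric] using k k'(2) by (intro conjI) simp_all
    fix i assume i: "i \<in> I' \<and> x - a' i \<in> E' i"
    then have iI: "i \<in> I'" by (rule conjunct1)
    have "g i \<in> I" unfolding gI(1)[symmetric] using iI by (rule imageI)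
    moreover have "x - a (g i) \<in> E (g i)" using i unfolding a'[OF iI] E'[OF iI] by (rule conjunct2)
    ultimately have "g i = k" using uniq by simp
    then show "i = k'" unfolding k'(1) by (rule inj_onD[OF gI(2) _ iI k'(2)])
  qed
qed

text \<open>The disjoint union of \<open>P\<close> and \<open>Q\<close>: the tag keeps a common
  point of both as two indices.\<close>

definition two_idx :: "real set \<Rightarrow> real set \<Rightarrow> (real \<times> bool) set" where
  "two_idx P Q = {i. fst i \<in> (if snd i then P else Q)}"

text \<open>A tiling of one copy of the line. In logarithmic coordinates the positive half-line is
  \<open>sheet P Q F G\<close> and the negative one is \<open>sheet P Q G F\<close>.\<close>

definition sheet :: "real set \<Rightarrow> real set \<Rightarrow> real set \<Rightarrow> real set \<Rightarrow> bool" where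
  "sheet P Q F G \<longleftrightarrow> fam_tiling (two_idx P Q) fst (\<lambda>i. if snd i then F else G)"

lemma sheet_swap:
  assumes "sheet P Q F G"
  shows "sheet Q P G F"
  unfolding sheet_def
proof (rule fam_tiling_reindex[OF assms[unfolded sheet_def], where g = "\<lambda>i. (fst i, \<not> snd i)"])
  show "bij_betw (\<lambda>i. (fst i, \<not> snd i)) (two_idx Q P) (two_idx P Q)"
    by (rule bij_betw_byWitness[where f' = "\<lambda>i. (fst i, \<not> snd i)"]) (auto simp: two_idx_def)
qed auto

text \<open>Two translates of \<open>F\<close> by close amounts overlap in positive measure, which
  uniqueness of the covering tile forbids.\<close>

lemma sheet_uniform_discrete:
  assumes s: "sheet P Q F G" and F: "F \<in> lmeasurable" "measure lebesgue F > 0"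
  shows "uniform_discrete P"
proof -
  obtain d where d: "d > 0" "\<And>c. \<bar>c\<bar> < d \<Longrightarrow> \<not> (AE x in lebesgue. \<not> (x \<in> F \<and> x - c \<in> F))"
    using overlap_positive[OF F] by blast
  have "p = q" if pq: "p \<in> P" "q \<in> P" "dist p q < d" for p q
  proof (rule ccontr)
    assume ne: "p \<noteq> q"
    have "AE x in lebesgue. \<not> (x - p \<in> F \<and> x - q \<in> F)"
      using s unfolding sheet_def fam_tiling_def
    proof eventually_elim
      case (elim x)
      show ?case
      proof
        assume a: "x - p \<in> F \<and> x - q \<in> F"
        from elim obtain k where k: "\<And>i. i \<in> two_idx P Q \<and> x - fst i \<in> (if snd i then F else G) \<Longrightarrow> i = k"
          by (elim ex1E) blast
        have "(p, True) = k" by (rule k) (use pq a in \<open>simp add: two_idx_def\<close>)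
        moreover have "(q, True) = k" by (rule k) (use pq a in \<open>simp add: two_idx_def\<close>)
        ultimately show False using ne by (metis prod.inject)
      qed
    qed
    from AE_lebesgue_shift[OF this, of p]
    have "AE x in lebesgue. \<not> (x \<in> F \<and> x - (q - p) \<in> F)" by eventually_elim (auto simp: algebra_simps)
    then show False using d(2)[of "q - p"] pq(3) by (auto simp: dist_real_def abs_minus_commute)
  qed
  then show ?thesis unfolding uniform_discrete_def using d(1) by blast
qed

text \<open>The indicator of \<open>F\<close> convolved with that of a unit interval: a 1-Lipschitz
  substitute for the indicator.\<close>

definition window :: "real set \<Rightarrow> real \<Rightarrow> real" where
  "window F y = measure lebesgue (F \<inter> {y<..y + 1})"

lemma window_continuous:
  assumes F: "F \<in> lmeasurable"
  shows "continuous_on S (window F)"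
proof -
  have le: "\<bar>window F x - window F y\<bar> \<le> \<bar>x - y\<bar>" if "x \<le> y" for x y
  proof -
    have m: "F \<inter> {u<..v} \<in> lmeasurable" for u v using lmeasurable_Int_Ioc[OF F] .
    have "window F x \<le> measure lebesgue ((F \<inter> {y<..y + 1}) \<union> (F \<inter> {x<..y}))"
      unfolding window_def using m that by (intro measure_mono_fmeasurable) (auto simp: fmeasurableD)
    also have "\<dots> \<le> window F y + measure lebesgue (F \<inter> {x<..y})"
      unfolding window_def using m by (intro measure_Un_le) (auto simp: fmeasurableD)
    also have "\<dots> \<le> window F y + (y - x)" using measure_Ioc_le[OF F that] by simp
    finally have 1: "window F x \<le> window F y + (y - x)" .
    have "window F y \<le> measure lebesgue ((F \<inter> {x<..x + 1}) \<union> (F \<inter> {x + 1<..y + 1}))"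
      unfolding window_def using m that by (intro measure_mono_fmeasurable) (auto simp: fmeasurableD)
    also have "\<dots> \<le> window F x + measure lebesgue (F \<inter> {x + 1<..y + 1})"
      unfolding window_def using m by (intro measure_Un_le) (auto simp: fmeasurableD)
    also have "\<dots> \<le> window F x + (y - x)" using measure_Ioc_le[OF F, of "x + 1" "y + 1"] that by simp
    finally show ?thesis using 1 that by linarith
  qed
  have "dist (window F x) (window F y) \<le> 1 * dist x y" for x y
    using le[of x y] le[of y x] by (cases "x \<le> y") (auto simp: dist_real_def abs_minus_commute)
  then have "1-lipschitz_on S (window F)" by (intro lipschitz_onI) auto
  then show ?thesis by (rule lipschitz_on_continuous_on)
qed

lemma window_outside:
  assumes "F \<subseteq> {-L..L}" "\<bar>x\<bar> > \<bar>L\<bar> + 1"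
  shows "window F x = 0"
proof -
  have "F \<inter> {x<..x + 1} = {}"
  proof (rule ccontr)
    assume "F \<inter> {x<..x + 1} \<noteq> {}"
    then obtain y where "y \<in> F" "x < y" "y \<le> x + 1" by auto
    moreover from this have "y \<in> {-L..L}" using assms(1) by blast
    ultimately have "-L \<le> y" "y \<le> L" "x < y" "y \<le> x + 1" by auto
    then show False using assms(2) by linarith
  qed
  then show ?thesis unfolding window_def by simp
qed

text \<open>Smoothing loses nothing on bounded sets. Unit windows stack to windows of any integer
  length; those reaching beyond the support differ by the measure of an arbitrary interval, and
  Lebesgue differentiation recovers the set.\<close>

lemma window_eq_imp_AE_eq:
  assumes F: "F \<in> lmeasurable" "F \<subseteq> {-L..L}" and G: "G \<in> lmeasurable" "G \<subseteq> {-L..L}"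
    and eq: "\<And>x. window F x = window G x"
  shows "AE x in lebesgue. x \<in> F \<longleftrightarrow> x \<in> G"
proof -
  have n: "measure lebesgue (F \<inter> {x<..x + real n}) = measure lebesgue (G \<inter> {x<..x + real n})" for x n
  proof (induction n)
    case (Suc n)
    have e: "x + real (Suc n) = (x + real n) + 1" by simp
    show ?case
      unfolding e using measure_Ioc_split[OF F(1), of x "x + real n" "x + real n + 1"]
        measure_Ioc_split[OF G(1), of x "x + real n" "x + real n + 1"] Suc eq[of "x + real n"]
      unfolding window_def by simp
  qed simp
  have tail: "measure lebesgue (F \<inter> {x<..y}) = measure lebesgue (G \<inter> {x<..y})" if xy: "x \<le> y" for x y
  proof -
    obtain n :: nat where nn: "\<bar>x\<bar> + \<bar>L\<bar> + \<bar>y\<bar> \<le> real n" using real_arch_simple by blast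
    have cut: "H \<inter> {x<..x + real n} = H \<inter> {x<..y + real n}" if "H \<subseteq> {-L..L}" for H
    proof -
      have "L \<le> x + real n" using nn by linarith
      then show ?thesis using that xy by fastforce
    qed
    have "measure lebesgue (H \<inter> {x<..y}) = measure lebesgue (H \<inter> {x<..x + real n}) - measure lebesgue (H \<inter> {y<..y + real n})"
      if "H \<in> lmeasurable" "H \<subseteq> {-L..L}" for H
      using measure_Ioc_split[OF that(1), of x y "y + real n"] xy cut[OF that(2)] by simp
    then show ?thesis using F G n by simp
  qed
  define f where "f x = indicat_real F x - indicat_real G x" for x
  have int: "f integrable_on {a..b}" "integral {a..b} f = measure lebesgue (F \<inter> {a..b}) - measure lebesgue (G \<inter> {a..b})" for a b
    unfolding f_def using indicator_integrable_on_Icc[OF F(1)] indicator_integrable_on_Icc[OF G(1)]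
    by (auto intro!: integrable_diff simp: integral_diff)
  obtain N where N: "negligible N"
    "\<And>x e. x \<notin> N \<Longrightarrow> 0 < e \<Longrightarrow> \<exists>d>0. \<forall>h. 0 < h \<and> h < d \<longrightarrow> \<bar>integral {x..x + h} f / h - f x\<bar> < e"
    using lebesgue_right_derivative[of f, OF int(1)] by blast
  have "f x = 0" if xN: "x \<notin> N" for x
  proof (rule ccontr)
    assume "f x \<noteq> 0"
    then obtain d where d: "d > 0" "\<And>h. 0 < h \<Longrightarrow> h < d \<Longrightarrow> \<bar>integral {x..x + h} f / h - f x\<bar> < \<bar>f x\<bar>"
      using N(2)[OF xN, of "\<bar>f x\<bar>"] by auto
    have "integral {x..x + d / 2} f = 0"
      using tail[of x "x + d / 2"] d(1) unfolding int(2) measure_Int_Icc_Ioc[OF F(1)] measure_Int_Icc_Ioc[OF G(1)] by simp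
    then show False using d(2)[of "d / 2"] d(1) by simp
  qed
  moreover have "f x \<noteq> 0" if "\<not> (x \<in> F \<longleftrightarrow> x \<in> G)" for x
    using that unfolding f_def by (cases "x \<in> F"; cases "x \<in> G") simp_all
  ultimately have sub: "{x. \<not> (x \<in> F \<longleftrightarrow> x \<in> G)} \<subseteq> N" by blast
  show ?thesis
    by (rule AE_I'[of N]) (use N(1) sub in \<open>auto simp: negligible_iff_null_sets\<close>)
qed

lemma set_conv_finite_support:
  assumes P: "uniform_discrete P" and z: "\<And>p. p \<in> P \<Longrightarrow> \<bar>p\<bar> > B \<Longrightarrow> k (x - p) = 0"
  shows "set_conv P k x = (\<Sum>p\<in>P \<inter> {-B..B}. k (x - p))"
proof -
  have "finite (P \<inter> {-B..B})" by (rule uniform_discrete_Int_bounded_finite[OF P]) simp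
  moreover have "(\<Sum>\<^sub>\<infinity>p\<in>P. k (x - p)) = (\<Sum>\<^sub>\<infinity>p\<in>P \<inter> {-B..B}. k (x - p))"
    by (rule infsum_cong_neutral) (use z in force)+
  ultimately show ?thesis unfolding set_conv_def by simp
qed

text \<open>The unit interval to the right of \<open>x\<close> has measure 1 and is shared among the
  tiles, so the identity holds for every \<open>x\<close>.\<close>

lemma sheet_window:
  assumes P: "uniform_discrete P" "uniform_discrete Q"
    and F: "F \<in> lmeasurable" "F \<subseteq> {-L..L}" and G: "G \<in> lmeasurable" "G \<subseteq> {-L..L}"
    and s: "sheet P Q F G"
  shows "set_conv P (\<lambda>y. of_real (window F y)) x + set_conv Q (\<lambda>y. of_real (window G y)) x = 1"
proof -
  define B where "B = \<bar>x\<bar> + \<bar>L\<bar> + 1"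
  define P0 Q0 where "P0 = P \<inter> {-B..B}" and "Q0 = Q \<inter> {-B..B}"
  have fin: "finite P0" "finite Q0"
    unfolding P0_def Q0_def using P by (auto intro!: uniform_discrete_Int_bounded_finite)
  have out: "window H (x - p) = 0" if "H \<subseteq> {-L..L}" "\<bar>p\<bar> > B" for H p
    by (rule window_outside[OF that(1)]) (use that(2) in \<open>simp add: B_def\<close>)
  let ?E = "\<lambda>i::real \<times> bool. if snd i then F else G"
  have "(\<Sum>i\<in>two_idx P0 Q0. measure lebesgue (?E i \<inter> {x - fst i<..(x + 1) - fst i})) = (x + 1) - x"
  proof (rule fam_tiling_measure[OF s[unfolded sheet_def]])
    have e: "two_idx P0 Q0 = P0 \<times> {True} \<union> Q0 \<times> {False}" by (auto simp: two_idx_def split: if_splits)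
    show "finite (two_idx P0 Q0)" unfolding e using fin by auto
    show "two_idx P0 Q0 \<subseteq> two_idx P Q" unfolding two_idx_def P0_def Q0_def by (auto split: if_splits)
    fix i z assume i: "i \<in> two_idx P Q - two_idx P0 Q0" "z \<in> {x<..x + 1}"
    then have "\<bar>fst i\<bar> > B" unfolding two_idx_def P0_def Q0_def by (auto split: if_splits)
    then have "\<bar>z - fst i\<bar> > L" using i(2) unfolding B_def greaterThanAtMost_iff by linarith
    then show "z - fst i \<notin> ?E i" using F(2) G(2) by (auto split: if_splits simp: abs_if)
  qed (use F G in auto)
  moreover have "(\<Sum>i\<in>two_idx P0 Q0. measure lebesgue (?E i \<inter> {x - fst i<..(x + 1) - fst i}))
      = (\<Sum>p\<in>P0. window F (x - p)) + (\<Sum>q\<in>Q0. window G (x - q))"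
  proof -
    have e: "two_idx P0 Q0 = (\<lambda>p. (p, True)) ` P0 \<union> (\<lambda>q. (q, False)) ` Q0" by (auto simp: two_idx_def split: if_splits)
    show ?thesis
      unfolding e using fin
      by (subst sum.union_disjoint) (auto simp: sum.reindex inj_on_def window_def algebra_simps)
  qed
  ultimately have "(\<Sum>p\<in>P0. window F (x - p)) + (\<Sum>q\<in>Q0. window G (x - q)) = 1" by simp
  then have "complex_of_real ((\<Sum>p\<in>P0. window F (x - p)) + (\<Sum>q\<in>Q0. window G (x - q))) = 1" by simp
  moreover have "set_conv P (\<lambda>y. of_real (window F y)) x = of_real (\<Sum>p\<in>P0. window F (x - p))"
    unfolding P0_def of_real_sum by (rule set_conv_finite_support[OF P(1)]) (use out[OF F(2)] in auto)
  moreover have "set_conv Q (\<lambda>y. of_real (window G y)) x = of_real (\<Sum>p\<in>Q0. window G (x - p))"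
    unfolding Q0_def of_real_sum by (rule set_conv_finite_support[OF P(2)]) (use out[OF G(2)] in auto)
  ultimately show ?thesis by simp
qed

subsection \<open>Dilations of tilings\<close>

text \<open>Frobenius modulo \<open>p\<close>, stated with an explicit multiple of \<open>p\<close>
  so that it serves both for integers and for the group ring.\<close>

lemma sum_power_prime:
  fixes x :: "'i \<Rightarrow> 'a::comm_ring_1"
  assumes "finite I" "prime p"
  shows "\<exists>y. (\<Sum>i\<in>I. x i) ^ p = (\<Sum>i\<in>I. x i ^ p) + of_nat p * y"
proof -
  have p0: "p > 0" using assms(2) by (simp add: prime_gt_0_nat)
  have two: "\<exists>y. (a + b) ^ p = a ^ p + b ^ p + of_nat p * y" for a b :: 'a
  proof -
    have "(a + b) ^ p = (\<Sum>k\<le>p. of_nat (p choose k) * a ^ k * b ^ (p - k))" by (rule binomial_ring)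
    also have "{..p} = insert 0 (insert p {0<..<p})" using p0 by auto
    also have "(\<Sum>k\<in>insert 0 (insert p {0<..<p}). of_nat (p choose k) * a ^ k * b ^ (p - k)) =
        b ^ p + (a ^ p + (\<Sum>k\<in>{0<..<p}. of_nat (p choose k) * a ^ k * b ^ (p - k)))"
      using p0 by simp
    also have "(\<Sum>k\<in>{0<..<p}. of_nat (p choose k) * a ^ k * b ^ (p - k)) =
        (\<Sum>k\<in>{0<..<p}. of_nat p * (of_nat ((p choose k) div p) * a ^ k * b ^ (p - k)))"
    proof (rule sum.cong)
      fix k assume "k \<in> {0<..<p}"
      then have "p dvd (p choose k)" using assms(2) by (intro dvd_choose_prime) auto
      then have "(of_nat (p choose k) :: 'a) = of_nat p * of_nat ((p choose k) div p)"
        by (metis dvd_mult_div_cancel of_nat_mult)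
      then show "of_nat (p choose k) * a ^ k * b ^ (p - k) = of_nat p * (of_nat ((p choose k) div p) * a ^ k * b ^ (p - k))"
        by (simp only: mult.assoc)
    qed simp
    finally show ?thesis unfolding sum_distrib_left[symmetric] by (auto simp: add_ac)
  qed
  show ?thesis
    using assms(1)
  proof induction
    case empty
    then show ?case using p0 by (intro exI[of _ 0]) (simp add: zero_power)
  next
    case (insert j J)
    obtain y where y: "(\<Sum>i\<in>J. x i) ^ p = (\<Sum>i\<in>J. x i ^ p) + of_nat p * y" using insert.IH by blast
    obtain z where z: "(x j + (\<Sum>i\<in>J. x i)) ^ p = x j ^ p + (\<Sum>i\<in>J. x i) ^ p + of_nat p * z" using two by blast
    show ?case using insert.hyps y z by (intro exI[of _ "y + z"]) (simp add: algebra_simps)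
  qed
qed

text \<open>Fermat's little theorem, obtained from Frobenius for a sum of \<open>n\<close>
  ones.\<close>

lemma power_prime_minus_one_cong:
  assumes "prime p" "\<not> p dvd n"
  shows "int p dvd int n ^ (p - 1) - 1"
proof -
  obtain y :: int where y: "(\<Sum>i<n. 1::int) ^ p = (\<Sum>i<n. 1 ^ p) + of_nat p * y"
    using sum_power_prime[of "{..<n}" p "\<lambda>_. 1"] assms(1) by auto
  have "int n ^ p = int n * int n ^ (p - 1)"
    using prime_gt_0_nat[OF assms(1)] by (simp flip: power_Suc)
  then have "int p dvd int n * (int n ^ (p - 1) - 1)"
    using y by (simp add: algebra_simps dvd_def)
  moreover have "prime (int p)" using assms(1) by simp
  moreover have "\<not> int p dvd int n" using assms(2) by simp
  ultimately show ?thesis using prime_dvd_multD by blast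
qed

text \<open>Finitely supported integer functions on a group form its integral group ring under
  convolution. This is the value at \<open>y\<close> of the convolution of \<open>g\<close> with
  \<open>\<psi>\<close>.\<close>

definition group_ring_ev :: "('g::ab_group_add \<Rightarrow> int) \<Rightarrow> 'g \<Rightarrow> ('g \<Rightarrow>\<^sub>0 int) \<Rightarrow> int" where
  "group_ring_ev \<psi> y g = (\<Sum>s\<in>Poly_Mapping.keys g. Poly_Mapping.lookup g s * \<psi> (y - s))"

lemma group_ring_ev_superset:
  assumes "finite S" "Poly_Mapping.keys g \<subseteq> S"
  shows "group_ring_ev \<psi> y g = (\<Sum>s\<in>S. Poly_Mapping.lookup g s * \<psi> (y - s))"
  unfolding group_ring_ev_def
  by (rule sum.mono_neutral_left[OF assms]) (auto simp: in_keys_iff)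

lemma group_ring_ev_add:
  "group_ring_ev \<psi> y (f + g) = group_ring_ev \<psi> y f + group_ring_ev \<psi> y g"
proof -
  let ?S = "Poly_Mapping.keys f \<union> Poly_Mapping.keys g"
  have "finite ?S" by simp
  then show ?thesis
    using group_ring_ev_superset[of ?S f \<psi> y] group_ring_ev_superset[of ?S g \<psi> y]
      group_ring_ev_superset[OF _ Poly_Mapping.keys_add, of f g \<psi> y]
    by (simp add: lookup_add algebra_simps sum.distrib)
qed

lemma group_ring_ev_0: "group_ring_ev \<psi> y 0 = 0"
  by (simp add: group_ring_ev_def)

lemma group_ring_ev_sum:
  "group_ring_ev \<psi> y (\<Sum>i\<in>I. f i) = (\<Sum>i\<in>I. group_ring_ev \<psi> y (f i))"
  by (induction I rule: infinite_finite_induct) (auto simp: group_ring_ev_0 group_ring_ev_add)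

lemma group_ring_ev_of_nat_mult:
  "group_ring_ev \<psi> y (of_nat n * g) = int n * group_ring_ev \<psi> y g"
  by (induction n) (auto simp: group_ring_ev_0 group_ring_ev_add distrib_right)

lemma group_ring_ev_single:
  "group_ring_ev \<psi> y (Poly_Mapping.single s c) = c * \<psi> (y - s)"
  using group_ring_ev_superset[of "{s}" "Poly_Mapping.single s c" \<psi> y] by simp

lemma poly_mapping_eq_sum_single:
  fixes g :: "'a \<Rightarrow>\<^sub>0 'b::comm_monoid_add"
  shows "g = (\<Sum>k\<in>Poly_Mapping.keys g. Poly_Mapping.single k (Poly_Mapping.lookup g k))"
proof (rule poly_mapping_eqI)
  fix s
  have "Poly_Mapping.lookup (\<Sum>k\<in>Poly_Mapping.keys g. Poly_Mapping.single k (Poly_Mapping.lookup g k)) s =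
      (\<Sum>k\<in>Poly_Mapping.keys g. if k = s then Poly_Mapping.lookup g k else 0)"
    by (simp add: lookup_sum lookup_single when_def)
  also have "\<dots> = Poly_Mapping.lookup g s"
    by (auto simp: in_keys_iff)
  finally show "Poly_Mapping.lookup g s = Poly_Mapping.lookup (\<Sum>k\<in>Poly_Mapping.keys g. Poly_Mapping.single k (Poly_Mapping.lookup g k)) s"
    by simp
qed

lemma group_ring_ev_single_mult:
  "group_ring_ev \<psi> y (Poly_Mapping.single s 1 * g) = group_ring_ev \<psi> (y - s) g"
proof -
  have "Poly_Mapping.single s 1 * g =
      (\<Sum>k\<in>Poly_Mapping.keys g. Poly_Mapping.single (s + k) (Poly_Mapping.lookup g k))"
    by (subst poly_mapping_eq_sum_single[of g]) (simp add: sum_distrib_left mult_single)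
  then have "group_ring_ev \<psi> y (Poly_Mapping.single s 1 * g) =
      (\<Sum>k\<in>Poly_Mapping.keys g. Poly_Mapping.lookup g k * \<psi> (y - (s + k)))"
    by (simp only: group_ring_ev_sum group_ring_ev_single)
  then show ?thesis by (simp only: group_ring_ev_def[of \<psi> "y - s"] diff_diff_eq)
qed

text \<open>The \<open>n\<close>-fold sum of \<open>v\<close>, taken in both coordinates so that
  powers of a point mass are point masses at dilates.\<close>

definition dilate :: "nat \<Rightarrow> real \<times> int \<Rightarrow> real \<times> int" where
  "dilate n v = (real n * fst v, int n * snd v)"

lemma dilate_dilate: "dilate m (dilate n v) = dilate (m * n) v"
  by (simp add: dilate_def)

lemma single_power_dilate:
  "Poly_Mapping.single v (1::int) ^ n = Poly_Mapping.single (dilate n v) 1"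
proof (induction n)
  case 0
  then show ?case by (simp add: dilate_def zero_prod_def flip: single_one)
next
  case (Suc n)
  have "v + dilate n v = dilate (Suc n) v" by (simp add: dilate_def prod_eq_iff algebra_simps)
  then show ?case using Suc by (simp add: mult_single)
qed

lemma minus_dilate_closed:
  assumes "\<And>y. y \<in> S \<Longrightarrow> y - v \<in> S" "y \<in> S"
  shows "y - dilate n v \<in> S"
proof (induction n)
  case 0
  then show ?case using assms(2) by (simp add: dilate_def flip: zero_prod_def)
next
  case (Suc n)
  have "y - dilate (Suc n) v = (y - dilate n v) - v" by (simp add: dilate_def prod_eq_iff algebra_simps)
  then show ?case using assms(1)[OF Suc] by (simp only:)
qed

text \<open>Modulo \<open>p\<close>, the \<open>p\<close>-th convolution power of the translation set is its dilate by \<open>p\<close>; since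
the level of the dilated system lies between \<open>0\<close> and the number of tiles, which is below \<open>p\<close>, the
congruence is an equality.\<close>

lemma tiling_dilate_prime:
  fixes v :: "'i \<Rightarrow> real \<times> int" and \<psi> :: "real \<times> int \<Rightarrow> int"
  assumes I: "finite I" "prime p" "card I < p"
    and \<psi>: "\<And>y. \<psi> y \<ge> 0" "\<And>y. y \<in> S \<Longrightarrow> \<psi> y \<le> 1"
    and closed: "\<And>y i. y \<in> S \<Longrightarrow> i \<in> I \<Longrightarrow> y - v i \<in> S"
    and eq: "\<And>y. y \<in> S \<Longrightarrow> (\<Sum>i\<in>I. \<psi> (y - v i)) = 1"
    and y: "y \<in> S"
  shows "(\<Sum>i\<in>I. \<psi> (y - dilate p (v i))) = 1"
proof -
  define B where "B = (\<Sum>i\<in>I. Poly_Mapping.single (v i) (1::int))"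
  \<comment> \<open>The first factor \<open>B\<close> turns \<open>\<psi>\<close> into the constant
    1 on \<open>S\<close>; each further factor multiplies by the number of tiles.\<close>
  have pow: "group_ring_ev \<psi> y (B ^ Suc n) = int (card I) ^ n" if "y \<in> S" for y n
    using that
  proof (induction n arbitrary: y)
    case 0
    then show ?case using eq by (simp add: B_def group_ring_ev_sum group_ring_ev_single)
  next
    case (Suc n)
    have "group_ring_ev \<psi> y (B * B ^ Suc n) = (\<Sum>i\<in>I. group_ring_ev \<psi> (y - v i) (B ^ Suc n))"
      using group_ring_ev_sum[of \<psi> y "\<lambda>i. Poly_Mapping.single (v i) 1 * B ^ Suc n" I]
      unfolding group_ring_ev_single_mult sum_distrib_right[symmetric] B_def[symmetric] .
    also have "\<dots> = (\<Sum>i\<in>I. int (card I) ^ n)"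
      using Suc closed by (intro sum.cong) auto
    finally show ?case by simp
  qed
  have p0: "p > 0" using I(2) by (simp add: prime_gt_0_nat)
  obtain z where z: "B ^ p = (\<Sum>i\<in>I. Poly_Mapping.single (v i) (1::int) ^ p) + of_nat p * z"
    unfolding B_def using sum_power_prime[OF I(1,2)] by blast
  let ?X = "\<Sum>i\<in>I. \<psi> (y - dilate p (v i))"
  have "int (card I) ^ (p - 1) = group_ring_ev \<psi> y (B ^ p)"
    using pow[OF y, of "p - 1"] p0 by simp
  also have "\<dots> = ?X + int p * group_ring_ev \<psi> y z"
    unfolding z group_ring_ev_add group_ring_ev_of_nat_mult group_ring_ev_sum single_power_dilate group_ring_ev_single by simp
  finally have X: "int (card I) ^ (p - 1) = ?X + int p * group_ring_ev \<psi> y z" .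
  have "I \<noteq> {}" using eq[OF y] by auto
  then have "card I > 0" using I(1) by (simp add: card_gt_0_iff)
  then have "\<not> p dvd card I" using I(3) by (auto dest: dvd_imp_le)
  then have "int p dvd int (card I) ^ (p - 1) - 1" by (rule power_prime_minus_one_cong[OF I(2)])
  then have "int p dvd ?X - 1 + int p * group_ring_ev \<psi> y z" using X by (simp add: algebra_simps)
  then have dvd: "int p dvd ?X - 1" by (simp add: dvd_add_left_iff)
  have X0: "0 \<le> ?X" using \<psi>(1) by (intro sum_nonneg) auto
  have "?X \<le> (\<Sum>i\<in>I. 1)"
  proof (rule sum_mono)
    fix i assume "i \<in> I"
    then show "\<psi> (y - dilate p (v i)) \<le> 1"
      using closed y by (intro \<psi>(2) minus_dilate_closed) auto
  qed
  then have X1: "?X < int p" using I(3) by simp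
  have p2: "p \<ge> 2" using I(2) by (rule prime_ge_2_nat)
  show "?X = 1"
  proof (rule ccontr)
    assume "?X \<noteq> 1"
    \<comment> \<open>\<open>?X - 1\<close> lies between -1 and \<open>p - 2\<close>, where 0 is the
      only multiple of \<open>p\<close>.\<close>
    then have "int p \<le> \<bar>?X - 1\<bar>" using dvd_imp_le_int[OF _ dvd] by simp
    then show False using X0 X1 p2 by linarith
  qed
qed

text \<open>One prime factor of \<open>n\<close> is treated at a time; the dilated translates again
  keep \<open>S\<close> invariant and cover at level 1, so the prime step repeats.\<close>

lemma tiling_dilate:
  fixes v :: "'i \<Rightarrow> real \<times> int" and \<psi> :: "real \<times> int \<Rightarrow> int"
  assumes I: "finite I" and n: "n \<noteq> 0" "\<And>p. prime p \<Longrightarrow> p dvd n \<Longrightarrow> card I < p"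
    and \<psi>: "\<And>y. \<psi> y \<ge> 0" "\<And>y. y \<in> S \<Longrightarrow> \<psi> y \<le> 1"
    and closed: "\<And>y i. y \<in> S \<Longrightarrow> i \<in> I \<Longrightarrow> y - v i \<in> S"
    and eq: "\<And>y. y \<in> S \<Longrightarrow> (\<Sum>i\<in>I. \<psi> (y - v i)) = 1"
  shows "\<And>y. y \<in> S \<Longrightarrow> (\<Sum>i\<in>I. \<psi> (y - dilate n (v i))) = 1"
  using n
proof (induction n rule: prime_divisors_induct)
  case zero
  then show ?case by simp
next
  case (unit n)
  then show ?case using eq by (simp add: dilate_def)
next
  case (factor p n)
  have IH: "(\<Sum>i\<in>I. \<psi> (y - dilate n (v i))) = 1" if "y \<in> S" for y
    using that factor.prems by (intro factor.IH) auto
  have "(\<Sum>i\<in>I. \<psi> (y - dilate p (dilate n (v i)))) = 1"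
    by (rule tiling_dilate_prime[OF I factor.hyps _ \<psi> _ IH factor.prems(1)])
      (use factor closed in \<open>auto intro: minus_dilate_closed\<close>)
  then show ?case by (simp add: dilate_dilate)
qed

section \<open>From almost periods to exact periods\<close>

lemma window_quad_decay:
  assumes "F \<in> lmeasurable" "F \<subseteq> {-L..L}"
  shows "quad_decay (\<lambda>y. of_real (window F y))"
  by (rule compact_support_quad_decay[where L = "\<bar>L\<bar> + 1"])
    (use window_continuous[OF assms(1)] window_outside[OF assms(2)] in \<open>auto intro!: continuous_intros\<close>)

text \<open>The sum of the window functions is nonzero because they are nonnegative and
  \<open>F\<close> is not null. For their difference this is what \<open>ne\<close> provides; when
  \<open>Q\<close> is empty, sum and difference of the convolutions coincide.\<close>

lemma sheets_almost_period:
  assumes P: "uniform_discrete P" "uniform_discrete Q"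
    and F: "F \<in> lmeasurable" "F \<subseteq> {-L..L}" "measure lebesgue F > 0" and G: "G \<in> lmeasurable" "G \<subseteq> {-L..L}"
    and s: "sheet P Q F G" "sheet P Q G F"
    and ne: "Q = {} \<or> \<not> (AE x in lebesgue. x \<in> F \<longleftrightarrow> x \<in> G)" and e: "e > 0"
  obtains t where "t \<ge> 1"
    "\<And>p. p \<in> P \<Longrightarrow> (\<exists>p'\<in>P. \<bar>p + t - p'\<bar> < e) \<and> (\<exists>p'\<in>P. \<bar>p - t - p'\<bar> < e)"
    "\<And>p. p \<in> Q \<Longrightarrow> (\<exists>p'\<in>Q. \<bar>p + t - p'\<bar> < e) \<and> (\<exists>p'\<in>Q. \<bar>p - t - p'\<bar> < e)"
proof -
  obtain R1 where R1: "R1 > 0" "\<And>R t p. R \<ge> R1 \<Longrightarrow>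
     (\<And>x. norm (set_conv P (kern R (bump R)) (x + t) - set_conv P (kern R (bump R)) x) < R ^ 5 / 2) \<Longrightarrow>
     p \<in> P \<Longrightarrow> (\<exists>p'\<in>P. \<bar>p + t - p'\<bar> < e) \<and> (\<exists>p'\<in>P. \<bar>p - t - p'\<bar> < e)"
    using almost_period_match[OF P(1) e] by blast
  obtain R2 where R2: "R2 > 0" "\<And>R t p. R \<ge> R2 \<Longrightarrow>
     (\<And>x. norm (set_conv Q (kern R (bump R)) (x + t) - set_conv Q (kern R (bump R)) x) < R ^ 5 / 2) \<Longrightarrow>
     p \<in> Q \<Longrightarrow> (\<exists>p'\<in>Q. \<bar>p + t - p'\<bar> < e) \<and> (\<exists>p'\<in>Q. \<bar>p - t - p'\<bar> < e)"
    using almost_period_match[OF P(2) e] by blast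
  define R where "R = max R1 R2"
  have R: "R > 0" "R \<ge> 0" "R \<ge> R1" "R \<ge> R2" using R1(1) R2(1) unfolding R_def by auto
  let ?uP = "set_conv P (kern R (bump R))" and ?uQ = "set_conv Q (kern R (bump R))"
  let ?wF = "\<lambda>y. complex_of_real (window F y)" and ?wG = "\<lambda>y. complex_of_real (window G y)"
  note dF = window_quad_decay[OF F(1,2)] and dG = window_quad_decay[OF G]
  note e1 = sheet_window[OF P F(1,2) G s(1)] and e2 = sheet_window[OF P G F(1,2) s(2)]
  have out: "window F x = 0" "window G x = 0" if "\<bar>x\<bar> > \<bar>L\<bar> + 1" for x
    using window_outside[OF F(2) that] window_outside[OF G(2) that] by auto
  obtain x1 where x1: "window F x1 \<noteq> 0"
  proof (rule ccontr)
    assume "\<not> thesis"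
    then have "window F x = window {} x" for x using that unfolding window_def by auto
    then have "AE x in lebesgue. x \<in> F \<longleftrightarrow> x \<in> {}" by (intro window_eq_imp_AE_eq[OF F(1,2)]) auto
    from measure_eq_AE[OF this] have "measure lebesgue F = measure lebesgue ({} :: real set)" using F(1) by auto
    then show False using F(3) by simp
  qed
  have pos: "trig_poly (\<lambda>x. ?uP x + 1 * ?uQ x)"
  proof (rule set_conv_kern_trig_poly[OF P, where h = "\<lambda>y. window F y + window G y" and L = "\<bar>L\<bar> + 1" and c = 2 and ?x0.0 = x1])
    show "continuous_on UNIV (\<lambda>y. window F y + window G y)"
      by (intro continuous_intros window_continuous F G)
    have "window F x1 \<ge> 0" "window G x1 \<ge> 0" unfolding window_def by auto
    then show "window F x1 + window G x1 \<noteq> 0" using x1 by linarith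
    fix x
    have l: "complex_of_real (window F y + window G y) = 1 * ?wF y + 1 * ?wG y" for y by simp
    show "set_conv P (\<lambda>y. complex_of_real (window F y + window G y)) x + 1 * set_conv Q (\<lambda>y. complex_of_real (window F y + window G y)) x = 2"
      unfolding set_conv_lin[OF P(1) dF dG l] set_conv_lin[OF P(2) dF dG l]
      using arg_cong2[OF e1[of x] e2[of x], of "(+)"] by (simp add: algebra_simps)
  qed (use out R bump_cutoff in auto)
  have neg: "trig_poly (\<lambda>x. ?uP x + (-1) * ?uQ x)"
  proof (cases "Q = {}")
    case True
    then show ?thesis using pos by (simp add: set_conv_def)
  next
    case False
    then have "\<not> (\<forall>x. window F x = window G x)" using ne window_eq_imp_AE_eq[OF F(1,2) G] by blast
    then obtain x2 where x2: "window F x2 \<noteq> window G x2" by blast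
    show ?thesis
    proof (rule set_conv_kern_trig_poly[OF P, where h = "\<lambda>y. window F y - window G y" and L = "\<bar>L\<bar> + 1" and c = 0 and ?x0.0 = x2])
      show "continuous_on UNIV (\<lambda>y. window F y - window G y)"
        by (intro continuous_intros window_continuous F G)
      show "window F x2 - window G x2 \<noteq> 0" using x2 by simp
      fix x
      have l: "complex_of_real (window F y - window G y) = 1 * ?wF y + (-1) * ?wG y" for y by simp
      show "set_conv P (\<lambda>y. complex_of_real (window F y - window G y)) x + (-1) * set_conv Q (\<lambda>y. complex_of_real (window F y - window G y)) x = 0"
        unfolding set_conv_lin[OF P(1) dF dG l] set_conv_lin[OF P(2) dF dG l]
        using arg_cong2[OF e1[of x] e2[of x], of "(-)"] by (simp add: algebra_simps)
    qed (use out R bump_cutoff in auto)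
  qed
  have "R ^ 5 / 2 > 0" using R by simp
  from trig_poly_common_almost_period[OF pos neg this]
  obtain t where t: "t \<ge> 1" "\<And>x. norm ((?uP (x + t) + 1 * ?uQ (x + t)) - (?uP x + 1 * ?uQ x)) < R ^ 5 / 2"
    "\<And>x. norm ((?uP (x + t) + (-1) * ?uQ (x + t)) - (?uP x + (-1) * ?uQ x)) < R ^ 5 / 2" by blast
  \<comment> \<open>Closeness for sum and difference returns to \<open>P\<close> and
    \<open>Q\<close> separately, by averaging.\<close>
  have avg: "norm a < d" "norm b < d" if ab: "norm (a + b) < d" "norm (a - b) < d" for a b :: complex and d
  proof -
    have "2 * norm a = norm ((a + b) + (a - b))" by (simp flip: mult_2 add: norm_mult)
    also have "\<dots> \<le> norm (a + b) + norm (a - b)" by (rule norm_triangle_ineq)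
    finally show "norm a < d" using ab by linarith
    have "2 * norm b = norm ((a + b) - (a - b))" by (simp flip: mult_2 add: norm_mult)
    also have "\<dots> \<le> norm (a + b) + norm (a - b)" by (rule norm_triangle_ineq4)
    finally show "norm b < d" using ab by linarith
  qed
  have "norm (?uP (x + t) - ?uP x) < R ^ 5 / 2" "norm (?uQ (x + t) - ?uQ x) < R ^ 5 / 2" for x
    using avg[of "?uP (x + t) - ?uP x" "?uQ (x + t) - ?uQ x" "R ^ 5 / 2"] t(2)[of x] t(3)[of x]
    by (simp_all add: algebra_simps)
  then show ?thesis
    using that[OF t(1)] R1(2)[OF R(3), of t] R2(2)[OF R(4), of t] by blast
qed

text \<open>Sending each point to the one near its translate by \<open>t\<close> is a bijection of
  \<open>P\<close> and of \<open>Q\<close>. Transporting the tiling along it and shifting back by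
  \<open>t\<close> moves each tile slightly, so rigidity makes all displacements equal, and
  \<open>t\<close> minus that displacement is an exact period.\<close>

lemma sheets_periodic:
  assumes F: "F \<in> lmeasurable" "F \<subseteq> {-L..L}" "measure lebesgue F > 0"
    and G: "G \<in> lmeasurable" "G \<subseteq> {-L..L}" "measure lebesgue G > 0"
    and s: "sheet P Q F G" "sheet P Q G F"
    and ne: "Q = {} \<or> \<not> (AE x in lebesgue. x \<in> F \<longleftrightarrow> x \<in> G)"
  obtains \<tau> where "\<tau> > 0" "\<And>x. x + \<tau> \<in> P \<longleftrightarrow> x \<in> P" "\<And>x. x + \<tau> \<in> Q \<longleftrightarrow> x \<in> Q"
proof (cases "P = {} \<and> Q = {}")
  case True
  then show ?thesis using that[of 1] by simp
next
  case nonempty: False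
  have P: "uniform_discrete P" by (rule sheet_uniform_discrete[OF s(1) F(1,3)])
  have Q: "uniform_discrete Q" by (rule sheet_uniform_discrete[OF sheet_swap[OF s(2)] F(1,3)])
  obtain dP where dP: "dP > 0" "\<And>p q. p \<in> P \<Longrightarrow> q \<in> P \<Longrightarrow> dist p q < dP \<Longrightarrow> p = q"
    using P unfolding uniform_discrete_def by blast
  obtain dQ where dQ: "dQ > 0" "\<And>p q. p \<in> Q \<Longrightarrow> q \<in> Q \<Longrightarrow> dist p q < dQ \<Longrightarrow> p = q"
    using Q unfolding uniform_discrete_def by blast
  obtain xF dF where dF: "dF > 0" "\<And>h. 0 < h \<Longrightarrow> h \<le> dF \<Longrightarrow> measure lebesgue (F \<inter> {xF<..xF + h}) \<ge> 9 / 10 * h"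
    using right_density_point[OF F(1,3)] by blast
  obtain xG dG where dG: "dG > 0" "\<And>h. 0 < h \<Longrightarrow> h \<le> dG \<Longrightarrow> measure lebesgue (G \<inter> {xG<..xG + h}) \<ge> 9 / 10 * h"
    using right_density_point[OF G(1,3)] by blast
  \<comment> \<open>The bounds by \<open>dP\<close> and \<open>dQ\<close> make the matching unique,
    those by \<open>dF\<close> and \<open>dG\<close> provide the densities for rigidity at lengths
    up to \<open>2 * \<epsilon>\<close>, and 1/2 keeps the period positive because
    \<open>t >= 1\<close>.\<close>
  define \<epsilon> where "\<epsilon> = min (min (dP / 2) (dQ / 2)) (min (min (dF / 2) (dG / 2)) (1 / 2))"
  have \<epsilon>: "\<epsilon> > 0" "2 * \<epsilon> \<le> dP" "2 * \<epsilon> \<le> dQ" "2 * \<epsilon> \<le> dF" "2 * \<epsilon> \<le> dG" "\<epsilon> < 1"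
    using dP(1) dQ(1) dF(1) dG(1) unfolding \<epsilon>_def by (auto simp: min_def)
  define A where "A b = (if b then P else Q)" for b
  define I where "I = two_idx P Q"
  have I: "i \<in> I \<longleftrightarrow> fst i \<in> A (snd i)" for i unfolding I_def two_idx_def A_def by simp
  have sep: "x = y" if "x \<in> A b" "y \<in> A b" "\<bar>x - y\<bar> < 2 * \<epsilon>" for x y b
    using that dP(2)[of x y] dQ(2)[of x y] \<epsilon> by (cases b) (auto simp: A_def dist_real_def)
  obtain t where t: "t \<ge> 1"
    "\<And>p. p \<in> P \<Longrightarrow> (\<exists>p'\<in>P. \<bar>p + t - p'\<bar> < \<epsilon>) \<and> (\<exists>p'\<in>P. \<bar>p - t - p'\<bar> < \<epsilon>)"
    "\<And>p. p \<in> Q \<Longrightarrow> (\<exists>p'\<in>Q. \<bar>p + t - p'\<bar> < \<epsilon>) \<and> (\<exists>p'\<in>Q. \<bar>p - t - p'\<bar> < \<epsilon>)"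
    using sheets_almost_period[OF P Q F G(1,2) s ne \<epsilon>(1)] by blast
  have tA: "(\<exists>p'\<in>A b. \<bar>p + t - p'\<bar> < \<epsilon>) \<and> (\<exists>p'\<in>A b. \<bar>p - t - p'\<bar> < \<epsilon>)" if "p \<in> A b" for p b
    using t(2)[of p] t(3)[of p] that unfolding A_def by (cases b) auto
  define \<phi> where "\<phi> i = ((SOME p'. p' \<in> A (snd i) \<and> \<bar>fst i + t - p'\<bar> < \<epsilon>), snd i)" for i :: "real \<times> bool"
  have \<phi>: "fst (\<phi> i) \<in> A (snd i)" "\<bar>fst i + t - fst (\<phi> i)\<bar> < \<epsilon>" if i: "i \<in> I" for i
  proof -
    have "\<exists>p'. p' \<in> A (snd i) \<and> \<bar>fst i + t - p'\<bar> < \<epsilon>" using tA[of "fst i" "snd i"] i I by blast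
    from someI_ex[OF this] show "fst (\<phi> i) \<in> A (snd i)" "\<bar>fst i + t - fst (\<phi> i)\<bar> < \<epsilon>"
      unfolding \<phi>_def by auto
  qed
  have \<phi>s: "snd (\<phi> i) = snd i" for i unfolding \<phi>_def by simp
  have \<phi>I: "\<phi> i \<in> I" if "i \<in> I" for i using \<phi>(1)[OF that] \<phi>s I by simp
  have bij: "bij_betw \<phi> I I"
    unfolding bij_betw_def
  proof
    show "inj_on \<phi> I"
    proof (rule inj_onI)
      fix i j assume ij: "i \<in> I" "j \<in> I" "\<phi> i = \<phi> j"
      then have b: "snd i = snd j" using \<phi>s by metis
      have "\<bar>fst i - fst j\<bar> < 2 * \<epsilon>" using \<phi>(2)[OF ij(1)] \<phi>(2)[OF ij(2)] ij(3) by auto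
      then have "fst i = fst j" using sep[of "fst i" "snd i" "fst j"] ij b I by auto
      then show "i = j" using b by (rule prod_eqI)
    qed
    show "\<phi> ` I = I"
    proof (intro equalityI subsetI)
      fix j assume "j \<in> \<phi> ` I" then show "j \<in> I" using \<phi>I by blast
    next
      fix j assume j: "j \<in> I"
      then obtain p' where p': "p' \<in> A (snd j)" "\<bar>fst j - t - p'\<bar> < \<epsilon>" using tA[of "fst j" "snd j"] I by blast
      \<comment> \<open>The point near \<open>fst j - t\<close> is the preimage: its image and
        \<open>fst j\<close> are closer than the separation.\<close>
      define i where "i = (p', snd j)"
      have i: "i \<in> I" unfolding I i_def using p' by simp
      have "\<bar>fst (\<phi> i) - fst j\<bar> < 2 * \<epsilon>" using \<phi>(2)[OF i] p'(2) unfolding i_def fst_conv by linarith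
      then have "fst (\<phi> i) = fst j" using sep[of "fst (\<phi> i)" "snd j" "fst j"] \<phi>(1)[OF i] j I unfolding i_def by auto
      then have "\<phi> i = j" using \<phi>s[of i] by (intro prod_eqI) (auto simp: i_def)
      then show "j \<in> \<phi> ` I" using i by blast
    qed
  qed
  let ?E = "\<lambda>i::real \<times> bool. if snd i then F else G"
  define d where "d i = fst i + t - fst (\<phi> i)" for i
  have const: "d i = d j" if ij: "i \<in> I" "j \<in> I" for i j
  proof (rule fam_tiling_rigid[where I = I and a = fst and E = ?E and L = L and \<epsilon> = \<epsilon>])
    fix B :: real
    have "{i\<in>I. \<bar>fst i\<bar> \<le> B} \<subseteq> (P \<inter> {-B..B}) \<times> {True} \<union> (Q \<inter> {-B..B}) \<times> {False}"
      unfolding I_def two_idx_def by (auto split: if_splits simp: abs_le_iff minus_le_iff)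
    moreover have "finite ((P \<inter> {-B..B}) \<times> {True} \<union> (Q \<inter> {-B..B}) \<times> {False})"
      using uniform_discrete_Int_bounded_finite[OF P, of "{-B..B}"] uniform_discrete_Int_bounded_finite[OF Q, of "{-B..B}"] by simp
    ultimately show "finite {i\<in>I. \<bar>fst i\<bar> \<le> B}" by (rule finite_subset)
  next
    show t1: "fam_tiling I fst ?E" using s(1) unfolding sheet_def I_def .
    have "fam_tiling I (\<lambda>i. fst (\<phi> i)) ?E"
      by (rule fam_tiling_reindex[OF t1 bij]) (auto simp: \<phi>s)
    from fam_tiling_shift[OF this, of "-t"] show "fam_tiling I (\<lambda>i. fst i - d i) ?E"
      unfolding d_def by (simp add: algebra_simps)
    fix i assume i: "i \<in> I"
    show "?E i \<in> lmeasurable" "?E i \<subseteq> {-L..L}" using F G by auto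
    show "\<bar>d i\<bar> \<le> \<epsilon>" using \<phi>(2)[OF i] unfolding d_def by simp
    have hF: "\<forall>h. 0 < h \<and> h \<le> 2 * \<epsilon> \<longrightarrow> 9 / 10 * h \<le> measure lebesgue (F \<inter> {xF<..xF + h})"
      using dF(2) \<epsilon>(4) by (meson order_trans)
    have hG: "\<forall>h. 0 < h \<and> h \<le> 2 * \<epsilon> \<longrightarrow> 9 / 10 * h \<le> measure lebesgue (G \<inter> {xG<..xG + h})"
      using dG(2) \<epsilon>(5) by (meson order_trans)
    show "\<exists>x. \<forall>h. 0 < h \<and> h \<le> 2 * \<epsilon> \<longrightarrow> 9 / 10 * h \<le> measure lebesgue (?E i \<inter> {x<..x + h})"
    proof (cases "snd i")
      case True
      then show ?thesis using hF by (simp only: if_True) blast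
    next
      case False
      then show ?thesis using hG by (simp only: if_False) blast
    qed
  qed (fact ij)+
  obtain i0 where i0: "i0 \<in> I"
  proof -
    obtain b p where "p \<in> A b" using nonempty unfolding A_def by (metis all_not_in_conv)
    then have "(p, b) \<in> I" unfolding I by simp
    then show ?thesis by (rule that)
  qed
  define \<tau> where "\<tau> = t - d i0"
  have "\<bar>d i0\<bar> < \<epsilon>" using \<phi>(2)[OF i0] unfolding d_def .
  then have \<tau>: "\<tau> > 0" using t(1) \<epsilon>(6) unfolding \<tau>_def by linarith
  have move: "fst (\<phi> i) = fst i + \<tau>" if "i \<in> I" for i
    using const[OF that i0] unfolding \<tau>_def by (simp add: d_def)
  have shift: "x + \<tau> \<in> A b \<longleftrightarrow> x \<in> A b" for x b
  proof
    assume "x \<in> A b"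
    then have "(x, b) \<in> I" unfolding I by simp
    then show "x + \<tau> \<in> A b" using move[of "(x, b)"] \<phi>(1)[of "(x, b)"] by simp
  next
    assume "x + \<tau> \<in> A b"
    then have "(x + \<tau>, b) \<in> I" unfolding I by simp
    then obtain i where i: "i \<in> I" "\<phi> i = (x + \<tau>, b)" using bij unfolding bij_betw_def by (metis imageE)
    then have "fst i = x" "snd i = b" using move[OF i(1)] \<phi>s[of i] by auto
    then show "x \<in> A b" using i(1) I by auto
  qed
  show ?thesis
    by (rule that[OF \<tau>]) (use shift[of _ True] shift[of _ False] in \<open>auto simp: A_def\<close>)
qed

subsection \<open>Rational periodicity\<close>

lemma periodic_int:
  fixes \<tau> :: real
  assumes "\<And>x. x + \<tau> \<in> P \<longleftrightarrow> x \<in> P"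
  shows "x + \<tau> * of_int k \<in> P \<longleftrightarrow> x \<in> P"
proof -
  have nat: "x + \<tau> * real n \<in> P \<longleftrightarrow> x \<in> P" for n x
  proof (induction n)
    case (Suc n)
    have "x + \<tau> * real (Suc n) = (x + \<tau> * real n) + \<tau>" by (simp add: algebra_simps)
    then show ?case using assms Suc by metis
  qed simp
  show ?thesis
  proof (cases "k \<ge> 0")
    case True
    then show ?thesis using nat[of x "nat k"] by simp
  next
    case False
    then have e: "(x + \<tau> * of_int k) + \<tau> * real (nat (-k)) = x" by (simp add: algebra_simps)
    show ?thesis using nat[of "x + \<tau> * of_int k" "nat (-k)"] unfolding e by (rule sym)
  qed
qed

text \<open>In the index group \<open>real \<times> int\<close> the parity of the integer records the copy of the line; odd dilation
factors preserve it.\<close>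

lemma sheets_rational_periodic:
  assumes F: "F \<in> lmeasurable" "F \<subseteq> {-L..L}" "measure lebesgue F > 0"
    and G: "G \<in> lmeasurable" "G \<subseteq> {-L..L}"
    and s: "sheet P Q F G" "sheet P Q G F"
    and \<tau>: "\<tau> > 0" and per: "\<And>x. x + \<tau> \<in> P \<longleftrightarrow> x \<in> P" "\<And>x. x + \<tau> \<in> Q \<longleftrightarrow> x \<in> Q"
  shows "rational_periodic \<tau> P"
proof -
  have P: "uniform_discrete P" by (rule sheet_uniform_discrete[OF s(1) F(1,3)])
  have Q: "uniform_discrete Q" by (rule sheet_uniform_discrete[OF sheet_swap[OF s(2)] F(1,3)])
  define P0 Q0 where "P0 = P \<inter> {0..<\<tau>}" and "Q0 = Q \<inter> {0..<\<tau>}"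
  have fin: "finite P0" "finite Q0"
    unfolding P0_def Q0_def using P Q by (auto intro!: uniform_discrete_Int_bounded_finite)
  define I where "I = two_idx P0 Q0"
  have "I = P0 \<times> {True} \<union> Q0 \<times> {False}" unfolding I_def by (auto simp: two_idx_def split: if_splits)
  then have finI: "finite I" using fin by simp
  \<comment> \<open>A translate from \<open>Q\<close> exchanges the roles of \<open>F\<close> and
    \<open>G\<close>, hence changes the parity of the integer coordinate.\<close>
  define c :: "bool \<Rightarrow> int" where "c b = (if b then 0 else 1)" for b
  define v where "v i = (fst i, c (snd i))" for i :: "real \<times> bool"
  define E where "E n = (if even n then F else G)" for n :: int
  have EL: "E n \<subseteq> {-L..L}" for n using F(2) G(2) unfolding E_def by auto
  define K where "K z n = {k::int. z - \<tau> * of_int k \<in> E n}" for z n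
  have finK: "finite (K z n)" for z n
  proof (rule finite_subset)
    show "K z n \<subseteq> {\<lfloor>(z - L) / \<tau>\<rfloor>..\<lceil>(z + L) / \<tau>\<rceil>}"
    proof
      fix k assume "k \<in> K z n"
      then have "z - \<tau> * of_int k \<in> {-L..L}" using EL unfolding K_def by blast
      then have "z - L \<le> of_int k * \<tau>" "of_int k * \<tau> \<le> z + L" by (auto simp: algebra_simps)
      then have "(z - L) / \<tau> \<le> of_int k" "of_int k \<le> (z + L) / \<tau>"
        using \<tau> by (simp_all add: pos_divide_le_eq pos_le_divide_eq)
      then show "k \<in> {\<lfloor>(z - L) / \<tau>\<rfloor>..\<lceil>(z + L) / \<tau>\<rceil>}" by (simp add: floor_le_iff le_ceiling_iff)
    qed
  qed simp
  \<comment> \<open>The tile selected by the parity, periodized with period \<open>\<tau>\<close>;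
    counting keeps it integer-valued for the dilation argument.\<close>
  define \<psi> where "\<psi> y = int (card (K (fst y) (snd y)))" for y
  have \<psi>_pos: "\<psi> y \<ge> 1" if "fst y - \<tau> * of_int k \<in> E (snd y)" for y k
  proof -
    have "K (fst y) (snd y) \<noteq> {}" using that unfolding K_def by blast
    then have "card (K (fst y) (snd y)) > 0" using finK by (simp add: card_gt_0_iff)
    then show ?thesis unfolding \<psi>_def by simp
  qed
  define U where "U F' G' x \<longleftrightarrow> (\<exists>!i. i \<in> two_idx P Q \<and> x - fst i \<in> (if snd i then F' else G'))" for F' G' :: "real set" and x :: real
  define good where "good x \<longleftrightarrow> U F G x \<and> U G F x" for x
  have AE_good: "AE x in lebesgue. good x"
    using s unfolding sheet_def fam_tiling_def good_def U_def by (rule AE_conjI)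
  have level: "(\<Sum>i\<in>I. \<psi> ((x, n) - v i)) = 1" if x: "good x" for x n
  proof -
    \<comment> \<open>The parity of \<open>n\<close> decides which of the two sheets is read at
      \<open>x\<close>.\<close>
    have "U (E n) (E (n - 1)) x" using x unfolding good_def E_def by (cases "even n") auto
    then obtain j where j: "j \<in> two_idx P Q \<and> x - fst j \<in> (if snd j then E n else E (n - 1))"
      and uniq: "\<forall>i. i \<in> two_idx P Q \<and> x - fst i \<in> (if snd i then E n else E (n - 1)) \<longrightarrow> i = j"
      unfolding U_def by (rule ex1E)
    have Ec: "(if b then E n else E (n - 1)) = E (n - c b)" for b unfolding c_def by simp
    \<comment> \<open>The unique tile \<open>j\<close> splits into a representative in
      \<open>{0..<\<tau>}\<close> and a number of periods, so exactly one pair contributes.\<close>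
    define k0 where "k0 = \<lfloor>fst j / \<tau>\<rfloor>"
    define i0 where "i0 = (fst j - \<tau> * of_int k0, snd j)"
    let ?T = "SIGMA i:I. K (x - fst i) (n - c (snd i))"
    have "?T = {(i0, k0)}"
    proof (intro equalityI subsetI)
      fix w assume "w \<in> ?T"
      then obtain i k where w: "w = (i, k)" "i \<in> I" "k \<in> K (x - fst i) (n - c (snd i))" by blast
      have i1: "fst i \<in> (if snd i then P else Q)" "0 \<le> fst i" "fst i < \<tau>"
        using w(2) unfolding I_def two_idx_def P0_def Q0_def by (auto split: if_splits)
      have "fst i + \<tau> * of_int k \<in> (if snd i then P else Q)"
        using i1(1) periodic_int[OF per(1)] periodic_int[OF per(2)] by (auto split: if_splits)
      moreover have "x - (fst i + \<tau> * of_int k) \<in> E (n - c (snd i))"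
        using w(3) unfolding K_def by (simp add: diff_diff_eq)
      ultimately have "(fst i + \<tau> * of_int k, snd i) = j"
        using uniq[rule_format, of "(fst i + \<tau> * of_int k, snd i)"] unfolding Ec by (simp add: two_idx_def)
      then have fj: "fst j = fst i + \<tau> * of_int k" "snd j = snd i" by auto
      have "k0 = k" unfolding k0_def fj
      proof (rule floor_unique)
        show "of_int k \<le> (fst i + \<tau> * of_int k) / \<tau>" using i1 \<tau> by (simp add: pos_le_divide_eq mult.commute)
        show "(fst i + \<tau> * of_int k) / \<tau> < of_int k + 1" using i1 \<tau> by (simp add: pos_divide_less_eq algebra_simps)
      qed
      then show "w \<in> {(i0, k0)}" unfolding w(1) i0_def fj by (simp add: prod_eq_iff)
    next
      fix w assume "w \<in> {(i0, k0)}"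
      then have w: "w = (i0, k0)" by simp
      have "of_int k0 \<le> fst j / \<tau>" "fst j / \<tau> < of_int k0 + 1" unfolding k0_def by linarith+
      then have r: "0 \<le> fst i0" "fst i0 < \<tau>"
        using \<tau> unfolding i0_def by (simp_all add: pos_le_divide_eq pos_divide_less_eq algebra_simps)
      have "fst i0 + \<tau> * of_int k0 = fst j" unfolding i0_def by simp
      then have "fst i0 \<in> (if snd j then P else Q)"
        using j periodic_int[OF per(1), of "fst i0" k0] periodic_int[OF per(2), of "fst i0" k0] unfolding two_idx_def
        by (auto split: if_splits)
      then have "i0 \<in> I" using r unfolding I_def two_idx_def P0_def Q0_def i0_def by (auto split: if_splits)
      moreover have "k0 \<in> K (x - fst i0) (n - c (snd i0))"
        using j unfolding Ec K_def i0_def by simp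
      ultimately show "w \<in> ?T" unfolding w by blast
    qed
    then have "card ?T = 1" by simp
    moreover have "card ?T = (\<Sum>i\<in>I. card (K (x - fst i) (n - c (snd i))))"
      by (rule card_SigmaI[OF finI]) (use finK in blast)
    ultimately have "(\<Sum>i\<in>I. card (K (x - fst i) (n - c (snd i)))) = 1" by simp
    then have "int (\<Sum>i\<in>I. card (K (x - fst i) (n - c (snd i)))) = 1" by simp
    then show ?thesis unfolding \<psi>_def v_def by simp
  qed
  define D where "D = P0 \<union> Q0"
  \<comment> \<open>The group generated by the representatives. It is countable, so almost every
    \<open>x\<close> is good at all its translates by \<open>\<Gamma>\<close>, which is the
    invariance the dilation lemma needs.\<close>
  define \<Gamma> where "\<Gamma> = sum_list ` lists (D \<union> uminus ` D)"
  have "countable (D \<union> uminus ` D)" using fin unfolding D_def by (intro countable_finite) simp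
  then have count: "countable \<Gamma>" unfolding \<Gamma>_def by (intro countable_image countable_lists)
  have \<Gamma>: "0 \<in> \<Gamma>" "\<And>p g. p \<in> D \<Longrightarrow> g \<in> \<Gamma> \<Longrightarrow> p + g \<in> \<Gamma>" "\<And>p g. p \<in> D \<Longrightarrow> g \<in> \<Gamma> \<Longrightarrow> - p + g \<in> \<Gamma>"
  proof -
    show "0 \<in> \<Gamma>" unfolding \<Gamma>_def by (rule image_eqI[of _ _ "[]"]) auto
    fix p g assume p: "p \<in> D" and "g \<in> \<Gamma>"
    then obtain l where l: "g = sum_list l" "l \<in> lists (D \<union> uminus ` D)" unfolding \<Gamma>_def by blast
    show "p + g \<in> \<Gamma>" unfolding \<Gamma>_def l(1) by (rule image_eqI[of _ _ "p # l"]) (use p l(2) in auto)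
    show "- p + g \<in> \<Gamma>" unfolding \<Gamma>_def l(1) by (rule image_eqI[of _ _ "(- p) # l"]) (use p l(2) in auto)
  qed
  have AE_all: "AE x in lebesgue. \<forall>g\<in>\<Gamma>. good (x + g)"
    using AE_lebesgue_shift[OF AE_good] by (simp add: AE_ball_countable[OF count])
  have ID: "fst i \<in> D" if "i \<in> I" for i using that unfolding I_def two_idx_def D_def by (auto split: if_splits)
  have dil: "(\<Sum>i\<in>I. \<psi> ((x, 0) - dilate n (v i))) = 1"
    if x: "\<forall>g\<in>\<Gamma>. good (x + g)" and n: "n \<noteq> 0" "\<And>p. prime p \<Longrightarrow> p dvd n \<Longrightarrow> card I < p" for x n
  proof -
    define S where "S = {(x + g, m :: int) | g m. g \<in> \<Gamma>}"
    have eqS: "(\<Sum>i\<in>I. \<psi> (y - v i)) = 1" if "y \<in> S" for y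
      using that level x unfolding S_def by auto
    have xS: "(x, 0) \<in> S" unfolding S_def using \<Gamma>(1) by force
    have mv: "y - v i \<in> S" "y + v i \<in> S" if y: "y \<in> S" and i: "i \<in> I" for y i
    proof -
      obtain g m where g: "y = (x + g, m)" "g \<in> \<Gamma>" using y unfolding S_def by blast
      have "y - v i = (x + (- fst i + g), m - c (snd i))" "y + v i = (x + (fst i + g), m + c (snd i))"
        unfolding g(1) v_def by auto
      then show "y - v i \<in> S" "y + v i \<in> S" unfolding S_def using \<Gamma>(2,3)[OF ID[OF i] g(2)] by blast+
    qed
    have "I \<noteq> {}" using eqS[OF xS] by auto
    then obtain i1 where i1: "i1 \<in> I" by blast
    have nn: "\<psi> y \<ge> 0" for y unfolding \<psi>_def by simp
    \<comment> \<open>\<open>\<psi> y\<close> is itself one of the nonnegative summands of the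
      level-1 identity at \<open>y + v i1\<close>.\<close>
    have le1: "\<psi> y \<le> 1" if y: "y \<in> S" for y
    proof -
      have "\<psi> (y + v i1 - v i1) \<le> (\<Sum>i\<in>I. \<psi> (y + v i1 - v i))"
        by (rule member_le_sum[OF i1 _ finI]) (rule nn)
      then show ?thesis using eqS[OF mv(2)[OF y i1]] by simp
    qed
    show ?thesis by (rule tiling_dilate[OF finI n nn le1 mv(1) eqS xS])
  qed
  obtain d where d: "d > 0" "\<And>c. \<bar>c\<bar> < d \<Longrightarrow> \<not> (AE x in lebesgue. \<not> (x \<in> F \<and> x - c \<in> F))"
    using overlap_positive[OF F(1,3)] by blast
  have rat: "(p - p') / \<tau> \<in> \<rat>" if p: "p \<in> P0" "p' \<in> P0" for p p'
  proof (rule ccontr)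
    assume irr: "(p - p') / \<tau> \<notin> \<rat>"
    then have ne: "p \<noteq> p'" by auto
    define \<theta> where "\<theta> = (p - p') / \<tau>"
    define N where "N = card I"
    have "fact N * \<theta> \<notin> \<rat>"
    proof
      assume "fact N * \<theta> \<in> \<rat>"
      then have "fact N * \<theta> / fact N \<in> \<rat>" by (rule Rats_divide) (metis Rats_of_nat of_nat_fact)
      then show False using irr unfolding \<theta>_def by simp
    qed
    \<comment> \<open>Density of the fractional parts puts \<open>k * fact N * \<theta>\<close> near
      \<open>- \<theta>\<close> modulo 1. With \<open>n = 1 + k * fact N\<close> this makes
      \<open>n * \<theta>\<close> nearly an integer, while every prime factor of \<open>n\<close>
      exceeds \<open>N\<close>.\<close>
    then obtain h k where k: "k > 0" "\<bar>of_int k * (fact N * \<theta>) - of_int h - (- \<theta>)\<bar> < d / \<tau>"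
      using sequence_of_fractional_parts_is_dense[of "fact N * \<theta>" "d / \<tau>" "- \<theta>"] d(1) \<tau> by (metis divide_pos_pos)
    define n where "n = 1 + nat k * fact N"
    have n0: "n \<noteq> 0" unfolding n_def by simp
    have big: "card I < q" if q: "prime q" "q dvd n" for q
    proof (rule ccontr)
      assume "\<not> card I < q"
      then have "q dvd fact N" using prime_gt_0_nat[OF q(1)] unfolding N_def by (intro dvd_fact) auto
      then have "q dvd nat k * fact N" by simp
      then have "q dvd 1" using q(2) unfolding n_def by (metis dvd_add_left_iff)
      then show False using q(1) by simp
    qed
    have nk: "real n = 1 + of_int k * fact N" using k(1) unfolding n_def by simp
    have "real n * (p - p') - \<tau> * of_int h = \<tau> * (of_int k * (fact N * \<theta>) - of_int h - (- \<theta>))"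
      unfolding nk \<theta>_def using \<tau> by (simp add: field_simps)
    then have "\<bar>real n * (p - p') - \<tau> * of_int h\<bar> = \<tau> * \<bar>of_int k * (fact N * \<theta>) - of_int h - (- \<theta>)\<bar>"
      using \<tau> by (simp add: abs_mult)
    also have "\<dots> < d" using k(2) \<tau> by (simp add: pos_less_divide_eq mult.commute)
    finally have small: "\<bar>real n * (p - p') - \<tau> * of_int h\<bar> < d" .
    \<comment> \<open>The tiles at the dilates of \<open>p\<close> and \<open>p'\<close> must be
      disjoint, yet modulo \<open>\<tau>\<close> they are translates of \<open>F\<close> by amounts
      closer than \<open>d\<close>.\<close>
    have "AE x in lebesgue. \<not> (x - real n * p' \<in> F \<and> x - real n * p - \<tau> * of_int (- h) \<in> F)"
      using AE_all
    proof eventually_elim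
      case (elim x)
      have i: "(p, True) \<in> I" "(p', True) \<in> I" using p unfolding I_def two_idx_def by auto
      let ?f = "\<lambda>i. \<psi> ((x, 0) - dilate n (v i))"
      have "sum ?f {(p, True), (p', True)} \<le> sum ?f I"
        by (rule sum_mono2[OF finI]) (use i in \<open>auto simp: \<psi>_def\<close>)
      then have "?f (p, True) + ?f (p', True) \<le> 1" using ne dil[OF elim n0 big] by simp
      then have le: "\<psi> (x - real n * p, 0) + \<psi> (x - real n * p', 0) \<le> 1"
        by (simp add: v_def dilate_def c_def)
      show ?case
      proof
        assume a: "x - real n * p' \<in> F \<and> x - real n * p - \<tau> * of_int (- h) \<in> F"
        have "\<psi> (x - real n * p', 0) \<ge> 1" by (rule \<psi>_pos[of _ 0]) (use a in \<open>simp add: E_def\<close>)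
        moreover have "\<psi> (x - real n * p, 0) \<ge> 1" by (rule \<psi>_pos[of _ "- h"]) (use a in \<open>simp add: E_def\<close>)
        ultimately show False using le by linarith
      qed
    qed
    from AE_lebesgue_shift[OF this, of "real n * p'"]
    have "AE x in lebesgue. \<not> (x \<in> F \<and> x - (real n * (p - p') - \<tau> * of_int h) \<in> F)"
      by (simp add: algebra_simps)
    then show False using d(2)[OF small] by blast
  qed
  have rep: "P = {\<tau> * of_int k + r | k r. r \<in> P0}"
  proof (intro equalityI subsetI)
    fix x assume x: "x \<in> P"
    define k where "k = \<lfloor>x / \<tau>\<rfloor>"
    have "of_int k \<le> x / \<tau>" "x / \<tau> < of_int k + 1" unfolding k_def by linarith+
    then have "0 \<le> x - \<tau> * of_int k" "x - \<tau> * of_int k < \<tau>"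
      using \<tau> by (simp_all add: pos_le_divide_eq pos_divide_less_eq algebra_simps)
    moreover have "x - \<tau> * of_int k \<in> P" using x periodic_int[OF per(1), of "x - \<tau> * of_int k" k] by simp
    ultimately have "x - \<tau> * of_int k \<in> P0" unfolding P0_def by simp
    moreover have "x = \<tau> * of_int k + (x - \<tau> * of_int k)" by simp
    ultimately show "x \<in> {\<tau> * of_int k + r | k r. r \<in> P0}" by blast
  next
    fix x assume "x \<in> {\<tau> * of_int k + r | k r. r \<in> P0}"
    then obtain k r where "x = \<tau> * of_int k + r" "r \<in> P0" by blast
    then show "x \<in> P" using periodic_int[OF per(1), of r k] unfolding P0_def by (simp add: add.commute)
  qed
  have "\<exists>q\<in>\<rat>. r - r' = q * \<tau>" if "r \<in> P0" "r' \<in> P0" for r r'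
    by (rule bexI[OF _ rat[OF that]]) (use \<tau> in simp)
  then show ?thesis unfolding rational_periodic_def using \<tau> rep fin(1) by blast
qed

section \<open>Null changes, repartitions and single tiles\<close>

text \<open>Each point is the only one of \<open>A\<close> in some interval with rational endpoints.
  Countability permits null changes of the tile at all translates at once.\<close>

lemma discrete_countable:
  fixes A :: "real set"
  assumes "discrete A"
  shows "countable A"
proof -
  have "\<exists>v. v \<in> \<rat> \<times> \<rat> \<and> A \<inter> {fst v<..<snd v} = {a}" if a: "a \<in> A" for a
  proof -
    from assms a obtain e where e: "e > 0" "\<forall>y\<in>A. dist a y < e \<longrightarrow> y = a"
      unfolding discrete_def isolated_in_dist_Ex_iff by blast
    obtain q where q: "q \<in> \<rat>" "a - e < q" "q < a" using Rats_dense_in_real[of "a - e" a] e(1) by auto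
    obtain r where r: "r \<in> \<rat>" "a < r" "r < a + e" using Rats_dense_in_real[of a "a + e"] e(1) by auto
    have uniq: "y = a" if "y \<in> A" "q < y" "y < r" for y
    proof -
      have "dist a y < e" using that q r unfolding dist_real_def by linarith
      then show ?thesis using e(2) that(1) by blast
    qed
    have "A \<inter> {q<..<r} = {a}"
    proof (intro equalityI subsetI)
      fix y assume "y \<in> A \<inter> {q<..<r}"
      then have "y = a" by (intro uniq) simp_all
      then show "y \<in> {a}" by simp
    qed (use a q r in simp)
    then show ?thesis using q(1) r(1) by (intro exI[of _ "(q, r)"]) simp
  qed
  then have "\<forall>a\<in>A. \<exists>v. v \<in> \<rat> \<times> \<rat> \<and> A \<inter> {fst v<..<snd v} = {a}" by (rule ballI)
  from bchoice[OF this] obtain f where f: "\<forall>a\<in>A. f a \<in> \<rat> \<times> \<rat> \<and> A \<inter> {fst (f a)<..<snd (f a)} = {a}" ..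
  have "inj_on f A"
  proof (rule inj_onI)
    fix a b assume ab: "a \<in> A" "b \<in> A" "f a = f b"
    have "{a} = {b}" using bspec[OF f ab(1)] bspec[OF f ab(2)] unfolding ab(3) by simp
    then show "a = b" by simp
  qed
  moreover have "f ` A \<subseteq> \<rat> \<times> \<rat>" using f by blast
  then have "countable (f ` A)" by (rule countable_subset) (intro countable_SIGMA countable_rat)
  ultimately show ?thesis by (rule countable_image_inj_on[rotated])
qed

lemma sheet_AE_cong:
  assumes s: "sheet P Q F G" and PQ: "countable P" "countable Q"
    and F: "AE x in lebesgue. x \<in> F \<longleftrightarrow> x \<in> F'" and G: "AE x in lebesgue. x \<in> G \<longleftrightarrow> x \<in> G'"
  shows "sheet P Q F' G'"
proof -
  have "AE x in lebesgue. \<forall>p\<in>P. x + (- p) \<in> F \<longleftrightarrow> x + (- p) \<in> F'"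
    unfolding AE_ball_countable[OF PQ(1)] using AE_lebesgue_shift[OF F] by blast
  moreover have "AE x in lebesgue. \<forall>q\<in>Q. x + (- q) \<in> G \<longleftrightarrow> x + (- q) \<in> G'"
    unfolding AE_ball_countable[OF PQ(2)] using AE_lebesgue_shift[OF G] by blast
  ultimately show ?thesis
    using s unfolding sheet_def fam_tiling_def
  proof eventually_elim
    case (elim x)
    have p: "x - p \<in> F \<longleftrightarrow> x - p \<in> F'" if "p \<in> P" for p using bspec[OF elim(1) that] by simp
    have q: "x - p \<in> G \<longleftrightarrow> x - p \<in> G'" if "p \<in> Q" for p using bspec[OF elim(2) that] by simp
    have "(\<lambda>i. i \<in> two_idx P Q \<and> x - fst i \<in> (if snd i then F else G)) =
        (\<lambda>i. i \<in> two_idx P Q \<and> x - fst i \<in> (if snd i then F' else G'))"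
    proof
      fix i
      show "(i \<in> two_idx P Q \<and> x - fst i \<in> (if snd i then F else G)) =
          (i \<in> two_idx P Q \<and> x - fst i \<in> (if snd i then F' else G'))"
        by (cases "snd i") (simp_all add: two_idx_def p q cong: conj_cong)
    qed
    with elim(3) show ?case by (rule back_subst[of Ex1])
  qed
qed

text \<open>A null tile covers nothing, so its translation set can be emptied. The tile paired with
  the empty set can be chosen freely; the single-tile lemmas take it to be \<open>F\<close>.\<close>

lemma sheet_null_second:
  assumes s: "sheet P Q F G" and Q: "countable P" "countable Q" and G: "AE x in lebesgue. x \<notin> G"
  shows "sheet P {} F H"
proof -
  have "sheet P Q F {}" by (rule sheet_AE_cong[OF s Q]) (use G in auto)
  then show ?thesis
    unfolding sheet_def fam_tiling_def
  proof eventually_elim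
    case (elim x)
    have "(\<lambda>i. i \<in> two_idx P Q \<and> x - fst i \<in> (if snd i then F else {})) =
        (\<lambda>i. i \<in> two_idx P {} \<and> x - fst i \<in> (if snd i then F else H))"
      by (rule ext) (simp add: two_idx_def)
    with elim show ?case by (rule back_subst[of Ex1])
  qed
qed

text \<open>When both tiles are the same set, only the point of an index affects the covering, and
  disjointness lets the point determine the tag.\<close>

lemma sheet_repartition:
  assumes s: "sheet P Q F F" and eq: "P' \<union> Q' = P \<union> Q" and disj: "P \<inter> Q = {}" "P' \<inter> Q' = {}"
  shows "sheet P' Q' F F"
  unfolding sheet_def
proof (rule fam_tiling_reindex[OF s[unfolded sheet_def], where g = "\<lambda>i. (fst i, fst i \<in> P)"])
  show "bij_betw (\<lambda>i. (fst i, fst i \<in> P)) (two_idx P' Q') (two_idx P Q)"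
  proof (rule bij_betw_byWitness[where f' = "\<lambda>i. (fst i, fst i \<in> P')"])
    have mem: "i \<in> two_idx A B \<longleftrightarrow> fst i \<in> A \<union> B \<and> (snd i \<longleftrightarrow> fst i \<in> A)" if "A \<inter> B = {}" for i A B
      using that unfolding two_idx_def by (cases "snd i") auto
    show "\<forall>i\<in>two_idx P' Q'. (fst (fst i, fst i \<in> P), fst (fst i, fst i \<in> P) \<in> P') = i"
      by (auto simp: mem[OF disj(2)])
    show "\<forall>i\<in>two_idx P Q. (fst (fst i, fst i \<in> P'), fst (fst i, fst i \<in> P') \<in> P) = i"
      by (auto simp: mem[OF disj(1)])
    show "(\<lambda>i. (fst i, fst i \<in> P)) ` two_idx P' Q' \<subseteq> two_idx P Q"
      "(\<lambda>i. (fst i, fst i \<in> P')) ` two_idx P Q \<subseteq> two_idx P' Q'"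
      using eq by (auto simp: mem[OF disj(1)] mem[OF disj(2)])
  qed
qed auto

text \<open>The density of the translates of a single tile is the reciprocal of its measure, so any two
tilings by the same tile have commensurable periods.\<close>

lemma single_tile_period:
  assumes F: "F \<in> lmeasurable" "F \<subseteq> {-L..L}" "measure lebesgue F > 0"
    and s: "sheet P {} F H" and \<tau>: "\<tau> > 0" and per: "\<And>x. x + \<tau> \<in> P \<longleftrightarrow> x \<in> P"
  obtains n :: nat where "n > 0" "\<tau> = real n * measure lebesgue F"
proof -
  have P: "uniform_discrete P" by (rule sheet_uniform_discrete[OF s F(1,3)])
  define P0 where "P0 = P \<inter> {0..<\<tau>}"
  have fin: "finite P0" unfolding P0_def using P by (auto intro!: uniform_discrete_Int_bounded_finite)
  \<comment> \<open>Indices are split into a residue in \<open>{0..<\<tau>}\<close> and the number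
    of its period, so that the tiles over one residue can be summed.\<close>
  define I where "I = P0 \<times> (UNIV :: int set)"
  define a where "a i = fst i + \<tau> * of_int (snd i)" for i :: "real \<times> int"
  have bij: "bij_betw (\<lambda>i. (a i, True)) I (two_idx P {})"
  proof (rule bij_betw_byWitness[where f' = "\<lambda>j. (fst j - \<tau> * of_int \<lfloor>fst j / \<tau>\<rfloor>, \<lfloor>fst j / \<tau>\<rfloor>)"])
    show "\<forall>i\<in>I. (fst (a i, True) - \<tau> * of_int \<lfloor>fst (a i, True) / \<tau>\<rfloor>, \<lfloor>fst (a i, True) / \<tau>\<rfloor>) = i"
    proof
      fix i assume "i \<in> I"
      then have i: "0 \<le> fst i" "fst i < \<tau>" unfolding I_def P0_def by auto
      have "\<lfloor>a i / \<tau>\<rfloor> = snd i" unfolding a_def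
      proof (rule floor_unique)
        show "of_int (snd i) \<le> (fst i + \<tau> * of_int (snd i)) / \<tau>" using i \<tau> by (simp add: pos_le_divide_eq mult.commute)
        show "(fst i + \<tau> * of_int (snd i)) / \<tau> < of_int (snd i) + 1" using i \<tau> by (simp add: pos_divide_less_eq algebra_simps)
      qed
      then show "(fst (a i, True) - \<tau> * of_int \<lfloor>fst (a i, True) / \<tau>\<rfloor>, \<lfloor>fst (a i, True) / \<tau>\<rfloor>) = i"
        by (simp add: prod_eq_iff a_def)
    qed
    show "\<forall>j\<in>two_idx P {}. (a (fst j - \<tau> * of_int \<lfloor>fst j / \<tau>\<rfloor>, \<lfloor>fst j / \<tau>\<rfloor>), True) = j"
      unfolding two_idx_def a_def by (auto simp: prod_eq_iff split: if_splits)
    show "(\<lambda>i. (a i, True)) ` I \<subseteq> two_idx P {}"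
      unfolding I_def P0_def two_idx_def a_def using periodic_int[OF per] by auto
    show "(\<lambda>j. (fst j - \<tau> * of_int \<lfloor>fst j / \<tau>\<rfloor>, \<lfloor>fst j / \<tau>\<rfloor>)) ` two_idx P {} \<subseteq> I"
    proof
      fix w assume "w \<in> (\<lambda>j. (fst j - \<tau> * of_int \<lfloor>fst j / \<tau>\<rfloor>, \<lfloor>fst j / \<tau>\<rfloor>)) ` two_idx P {}"
      then obtain x where x: "x \<in> P" "w = (x - \<tau> * of_int \<lfloor>x / \<tau>\<rfloor>, \<lfloor>x / \<tau>\<rfloor>)"
        unfolding two_idx_def by (auto split: if_splits)
      define k where "k = \<lfloor>x / \<tau>\<rfloor>"
      have "of_int k \<le> x / \<tau>" "x / \<tau> < of_int k + 1" unfolding k_def by linarith+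
      then have "0 \<le> x - \<tau> * of_int k" "x - \<tau> * of_int k < \<tau>"
        using \<tau> by (simp_all add: pos_le_divide_eq pos_divide_less_eq algebra_simps)
      moreover have "x - \<tau> * of_int k \<in> P"
        using x(1) periodic_int[OF per, of "x - \<tau> * of_int k" k] by simp
      ultimately show "w \<in> I" unfolding I_def P0_def x(2) k_def[symmetric] by simp
    qed
  qed
  have t: "fam_tiling I a (\<lambda>_. F)"
    by (rule fam_tiling_reindex[OF s[unfolded sheet_def] bij]) auto
  \<comment> \<open>Period numbers beyond \<open>m\<close> move the tile off the interval
    \<open>{0<..\<tau>}\<close>.\<close>
  obtain m :: nat where m: "(\<bar>L\<bar> + 2 * \<tau>) / \<tau> \<le> real m" using real_arch_simple by blast
  have m': "\<bar>L\<bar> + 2 * \<tau> \<le> \<tau> * real m" using m \<tau> by (simp add: pos_divide_le_eq mult.commute)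
  let ?M = "{- int m..int m}"
  have "(\<Sum>i\<in>P0 \<times> ?M. measure lebesgue (F \<inter> {0 - a i<..\<tau> - a i})) = \<tau> - 0"
  proof (rule fam_tiling_measure[OF t])
    show "finite (P0 \<times> ?M)" using fin by simp
    show "P0 \<times> ?M \<subseteq> I" unfolding I_def by auto
    fix i z assume i: "i \<in> I - P0 \<times> ?M" "z \<in> {0<..\<tau>}"
    then have r: "0 \<le> fst i" "fst i < \<tau>" and k: "snd i < - int m \<or> int m < snd i"
      unfolding I_def P0_def by (auto simp: prod_eq_iff)
    show "z - a i \<notin> F"
    proof
      assume "z - a i \<in> F"
      then have "z - a i \<in> {-L..L}" using F(2) by blast
      then have zL: "-L \<le> z - a i" "z - a i \<le> L" by auto
      from k show False
      proof
        assume "snd i < - int m"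
        then have "of_int (snd i) \<le> - real m" by linarith
        then have "\<tau> * of_int (snd i) \<le> \<tau> * (- real m)" using \<tau> by (intro mult_left_mono) auto
        then show False
          using zL r i(2)[unfolded greaterThanAtMost_iff] m' \<tau> unfolding a_def mult_minus_right by linarith
      next
        assume "int m < snd i"
        then have "real m \<le> of_int (snd i)" by linarith
        then have "\<tau> * real m \<le> \<tau> * of_int (snd i)" using \<tau> by (intro mult_left_mono) auto
        then show False
          using zL r i(2)[unfolded greaterThanAtMost_iff] m' \<tau> unfolding a_def mult_minus_right by linarith
      qed
    qed
  qed (use F \<tau> in auto)
  moreover have "(\<Sum>i\<in>P0 \<times> ?M. measure lebesgue (F \<inter> {0 - a i<..\<tau> - a i})) =
      (\<Sum>p\<in>P0. \<Sum>k\<in>?M. measure lebesgue (F \<inter> {- (p + \<tau> * of_int k)<..\<tau> - (p + \<tau> * of_int k)}))"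
    unfolding a_def sum.cartesian_product by (simp add: case_prod_unfold)
  moreover have "(\<Sum>k\<in>?M. measure lebesgue (F \<inter> {- (p + \<tau> * of_int k)<..\<tau> - (p + \<tau> * of_int k)})) = measure lebesgue F"
    if p: "p \<in> P0" for p
  proof -
    have p': "0 \<le> p" "p < \<tau>" using p unfolding P0_def by auto
    let ?A = "\<lambda>k::int. F \<inter> {- (p + \<tau> * of_int k)<..\<tau> - (p + \<tau> * of_int k)}"
    have in_A: "y \<in> ?A k \<longleftrightarrow> y \<in> F \<and> k = \<lfloor>(\<tau> - p - y) / \<tau>\<rfloor>" for y k
    proof -
      have "k = \<lfloor>(\<tau> - p - y) / \<tau>\<rfloor> \<longleftrightarrow> of_int k \<le> (\<tau> - p - y) / \<tau> \<and> (\<tau> - p - y) / \<tau> < of_int k + 1"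
        using floor_eq_iff[of "(\<tau> - p - y) / \<tau>" k] by auto
      also have "\<dots> \<longleftrightarrow> of_int k * \<tau> \<le> \<tau> - p - y \<and> \<tau> - p - y < (of_int k + 1) * \<tau>"
        using \<tau> by (simp only: pos_le_divide_eq pos_divide_less_eq)
      also have "\<dots> \<longleftrightarrow> y \<in> {- (p + \<tau> * of_int k)<..\<tau> - (p + \<tau> * of_int k)}"
        by (auto simp: algebra_simps)
      finally show ?thesis by auto
    qed
    \<comment> \<open>Translates of one period interval partition the line, so each residue
      contributes the full measure of \<open>F\<close>.\<close>
    have "F = (\<Union>k\<in>?M. ?A k)"
    proof (intro equalityI subsetI)
      fix y assume y: "y \<in> F"
      then have yL: "-L \<le> y" "y \<le> L" using F(2) by auto
      define k where "k = \<lfloor>(\<tau> - p - y) / \<tau>\<rfloor>"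
      have "(\<tau> - p - y) / \<tau> \<le> real m"
      proof -
        have "\<tau> - p - y \<le> real m * \<tau>" using m' yL p' \<tau> by (simp add: mult.commute)
        then show ?thesis using \<tau> by (simp add: pos_divide_le_eq)
      qed
      then have "k \<le> int m" unfolding k_def by linarith
      moreover have "- real m \<le> (\<tau> - p - y) / \<tau>"
      proof -
        have "- real m * \<tau> \<le> \<tau> - p - y" using m' yL p' \<tau> by (simp add: mult.commute)
        then show ?thesis using \<tau> by (simp add: pos_le_divide_eq)
      qed
      then have "- int m \<le> k" unfolding k_def by linarith
      moreover have "y \<in> ?A k" unfolding in_A k_def using y by simp
      ultimately show "y \<in> (\<Union>k\<in>?M. ?A k)" by (intro UN_I[of k]) auto
    qed auto
    then have "measure lebesgue F = measure lebesgue (\<Union>k\<in>?M. ?A k)" by (rule arg_cong)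
    also have "\<dots> = (\<Sum>k\<in>?M. measure lebesgue (?A k))"
    proof (rule measure_finite_Union)
      show "?A ` ?M \<subseteq> sets lebesgue" using lmeasurable_Int_Ioc[OF F(1)] by (auto simp: fmeasurableD)
      show "disjoint_family_on ?A ?M" unfolding disjoint_family_on_def
      proof (intro ballI impI equals0I)
        fix k k' y assume "k \<noteq> k'" "y \<in> ?A k \<inter> ?A k'"
        then show False unfolding Int_iff[of y "?A k"] in_A by simp
      qed
      fix k show "emeasure lebesgue (?A k) \<noteq> \<infinity>"
        using fmeasurableD2[OF lmeasurable_Int_Ioc[OF F(1)]] unfolding infinity_ennreal_def .
    qed simp
    finally show ?thesis by (rule sym)
  qed
  ultimately have "\<tau> = real (card P0) * measure lebesgue F" by simp
  moreover from this have "card P0 > 0" using \<tau> by (cases "card P0 = 0") auto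
  ultimately show ?thesis using that by blast
qed

text \<open>All multiples of the period are offered, so that two such sets can be brought to a
  common period.\<close>

lemma single_tile_rational_periodic:
  assumes F: "F \<in> lmeasurable" "F \<subseteq> {-L..L}" "measure lebesgue F > 0"
    and s: "sheet P {} F F"
  obtains \<tau> n where "\<tau> > 0" "n > 0" "\<tau> = real n * measure lebesgue F"
    "\<And>m. m > 0 \<Longrightarrow> rational_periodic (real m * \<tau>) P"
proof -
  obtain \<tau> where \<tau>: "\<tau> > 0" "\<And>x. x + \<tau> \<in> P \<longleftrightarrow> x \<in> P"
    by (rule sheets_periodic[OF F F s s disjI1[OF refl]]) (rule that)
  obtain n where n: "n > 0" "\<tau> = real n * measure lebesgue F"
    by (rule single_tile_period[OF F s \<tau>])
  have "rational_periodic (real m * \<tau>) P" if "m > 0" for m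
  proof (rule sheets_rational_periodic[OF F F(1,2) s s])
    show "real m * \<tau> > 0" using \<tau> that by simp
    show "x + real m * \<tau> \<in> P \<longleftrightarrow> x \<in> P" for x
      using periodic_int[OF \<tau>(2), of x "int m"] by (simp add: mult.commute)
  qed simp
  then show ?thesis by (rule that[OF \<tau>(1) n])
qed

subsection \<open>Passing to logarithms\<close>

lemma card_Collect_eq_1_iff: "card {a. T a} = 1 \<longleftrightarrow> (\<exists>!a. T a)"
proof
  assume "card {a. T a} = 1"
  then obtain x where "{a. T a} = {x}" using card_1_singletonE by blast
  then show "\<exists>!a. T a" by (intro ex1I[of _ x]) blast+
next
  assume "\<exists>!a. T a"
  then obtain x where "T x" "\<forall>y. T y \<longrightarrow> y = x" by (rule ex1E)
  then have "{a. T a} = {x}" by blast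
  then show "card {a. T a} = 1" by simp
qed

lemma has_sum_indicator_one_iff:
  fixes A :: "real set"
  shows "((\<lambda>a. indicat_real \<Omega> (f a)) has_sum 1) A \<longleftrightarrow> (\<exists>!a. a \<in> A \<and> f a \<in> \<Omega>)"
proof -
  let ?B = "{a\<in>A. f a \<in> \<Omega>}"
  have "((\<lambda>a. indicat_real \<Omega> (f a)) has_sum 1) A \<longleftrightarrow> ((\<lambda>a. 1::real) has_sum 1) ?B"
    by (rule has_sum_cong_neutral) (auto simp: indicator_def)
  also have "\<dots> \<longleftrightarrow> card ?B = 1"
  proof
    assume h: "((\<lambda>a. 1::real) has_sum 1) ?B"
    then have "(\<lambda>a. 1::real) summable_on ?B" by (rule has_sum_imp_summable)
    then have "finite ?B" using infsum_diverge_constant[of ?B "1::real"] by auto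
    then have "((\<lambda>a. 1::real) has_sum of_nat (card ?B) * 1) ?B" by (rule has_sum_constant)
    then have "of_nat (card ?B) * 1 = (1::real)" using h by (rule has_sum_unique)
    then show "card ?B = 1" by simp
  next
    assume c: "card ?B = 1"
    then have "finite ?B" by (metis card.infinite zero_neq_one)
    then have "((\<lambda>a. 1::real) has_sum of_nat (card ?B) * 1) ?B" by (rule has_sum_constant)
    then show "((\<lambda>a. 1::real) has_sum 1) ?B" using c by simp
  qed
  also have "\<dots> \<longleftrightarrow> (\<exists>!a. a \<in> A \<and> f a \<in> \<Omega>)"
    by (rule card_Collect_eq_1_iff)
  finally show ?thesis .
qed

lemma AE_lebesgue_iff_negligible:
  "(AE x in lebesgue. T (x::real)) \<longleftrightarrow> negligible {x. \<not> T x}"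
proof
  assume "AE x in lebesgue. T x"
  then obtain N where "N \<in> null_sets lebesgue" "{x. \<not> T x} \<subseteq> N" unfolding eventually_ae_filter by auto
  then show "negligible {x. \<not> T x}" by (meson negligible_iff_null_sets negligible_subset)
next
  assume "negligible {x. \<not> T x}"
  then show "AE x in lebesgue. T x" by (intro AE_I'[of "{x. \<not> T x}"]) (auto simp: negligible_iff_null_sets)
qed

text \<open>Differentiable maps send null sets to null sets; \<open>exp\<close> and
  \<open>ln\<close> do so on each half-line, and the point 0 is null.\<close>

lemma AE_lebesgue_exp_iff:
  fixes T :: "real \<Rightarrow> bool"
  shows "(AE x in lebesgue. T x) \<longleftrightarrow> (AE y in lebesgue. T (exp y)) \<and> (AE y in lebesgue. T (- exp y))"
  unfolding AE_lebesgue_iff_negligible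
proof (intro iffI conjI; (elim conjE)?)
  assume n: "negligible {x. \<not> T x}"
  have "ln differentiable_on ({x. \<not> T x} \<inter> {0<..})"
    by (intro differentiable_at_imp_differentiable_on) (auto intro!: derivative_intros simp: real_differentiable_def intro: DERIV_ln)
  then have "negligible (ln ` ({x. \<not> T x} \<inter> {0<..}))"
    by (intro negligible_differentiable_image_negligible negligible_subset[OF n]) auto
  moreover have "{y. \<not> T (exp y)} \<subseteq> ln ` ({x. \<not> T x} \<inter> {0<..})"
    by (auto intro!: image_eqI[of _ _ "exp _"])
  ultimately show "negligible {y. \<not> T (exp y)}" by (rule negligible_subset)
  have n': "negligible (uminus ` {x. \<not> T x})"
    by (rule negligible_differentiable_image_negligible[OF _ n]) (auto intro!: derivative_intros)
  have "ln differentiable_on (uminus ` {x. \<not> T x} \<inter> {0<..})"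
    by (intro differentiable_at_imp_differentiable_on) (auto intro!: derivative_intros simp: real_differentiable_def intro: DERIV_ln)
  then have "negligible (ln ` (uminus ` {x. \<not> T x} \<inter> {0<..}))"
    by (intro negligible_differentiable_image_negligible negligible_subset[OF n']) auto
  moreover have "{y. \<not> T (- exp y)} \<subseteq> ln ` (uminus ` {x. \<not> T x} \<inter> {0<..})"
  proof
    fix y assume "y \<in> {y. \<not> T (- exp y)}"
    then have "exp y \<in> uminus ` {x. \<not> T x} \<inter> {0<..}" by (auto intro!: image_eqI[of _ _ "- exp y"])
    then show "y \<in> ln ` (uminus ` {x. \<not> T x} \<inter> {0<..})" by (rule image_eqI[rotated]) simp
  qed
  ultimately show "negligible {y. \<not> T (- exp y)}" by (rule negligible_subset)
next
  assume n: "negligible {y. \<not> T (exp y)}" "negligible {y. \<not> T (- exp y)}"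
  have "negligible (exp ` {y. \<not> T (exp y)})"
    by (rule negligible_differentiable_image_negligible[OF order_refl n(1)])
      (use real_differentiable_def DERIV_exp in \<open>blast intro: differentiable_at_imp_differentiable_on\<close>)+
  moreover have "negligible ((\<lambda>y. - exp y) ` {y. \<not> T (- exp y)})"
    by (rule negligible_differentiable_image_negligible[OF order_refl n(2)])
      (use real_differentiable_def DERIV_minus[OF DERIV_exp] in \<open>blast intro: differentiable_at_imp_differentiable_on\<close>)+
  ultimately have "negligible ({0} \<union> exp ` {y. \<not> T (exp y)} \<union> (\<lambda>y. - exp y) ` {y. \<not> T (- exp y)})"
    by (intro negligible_Un) auto
  moreover have "{x. \<not> T x} \<subseteq> {0} \<union> exp ` {y. \<not> T (exp y)} \<union> (\<lambda>y. - exp y) ` {y. \<not> T (- exp y)}"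
  proof
    fix x assume x: "x \<in> {x. \<not> T x}"
    consider "x = 0" | "x > 0" | "x < 0" by linarith
    then show "x \<in> {0} \<union> exp ` {y. \<not> T (exp y)} \<union> (\<lambda>y. - exp y) ` {y. \<not> T (- exp y)}"
    proof cases
      case 2
      then have "x = exp (ln x)" by simp
      then show ?thesis using x by (metis (mono_tags, lifting) UnCI imageI mem_Collect_eq)
    next
      case 3
      then have "x = - exp (ln (- x))" by simp
      then show ?thesis using x by (metis (mono_tags, lifting) UnCI image_eqI mem_Collect_eq)
    qed simp
  qed
  ultimately show "negligible {x. \<not> T x}" by (rule negligible_subset)
qed

lemma mem_ln_halves:
  "z \<in> ln ` pos_half \<Omega> \<longleftrightarrow> exp z \<in> \<Omega>" "z \<in> ln ` neg_half \<Omega> \<longleftrightarrow> - exp z \<in> \<Omega>"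
proof -
  show "z \<in> ln ` pos_half \<Omega> \<longleftrightarrow> exp z \<in> \<Omega>"
  proof
    assume "exp z \<in> \<Omega>"
    then have "exp z \<in> pos_half \<Omega>" unfolding pos_half_def by simp
    then show "z \<in> ln ` pos_half \<Omega>" by (rule image_eqI[rotated]) simp
  qed (auto simp: pos_half_def)
  show "z \<in> ln ` neg_half \<Omega> \<longleftrightarrow> - exp z \<in> \<Omega>"
  proof
    assume "- exp z \<in> \<Omega>"
    then have "exp z \<in> neg_half \<Omega>" unfolding neg_half_def by (auto intro!: image_eqI[of _ _ "- exp z"])
    then show "z \<in> ln ` neg_half \<Omega>" by (rule image_eqI[rotated]) simp
  qed (auto simp: neg_half_def)
qed

text \<open>A positive \<open>x\<close> arises from factors of equal sign, a negative one from
  factors of opposite sign; this gives the two sheets with the tiles exchanged.\<close>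

lemma tiling_iff_sheets:
  "(AE x in lebesgue. ((\<lambda>a. indicat_real \<Omega> (inverse a * x)) has_sum 1) (exp ` P \<union> uminus ` exp ` Q)) \<longleftrightarrow>
     sheet P Q (ln ` pos_half \<Omega>) (ln ` neg_half \<Omega>) \<and> sheet P Q (ln ` neg_half \<Omega>) (ln ` pos_half \<Omega>)"
proof -
  let ?A = "exp ` P \<union> uminus ` exp ` Q"
  define g where "g i = (if snd i then exp (fst i) else - exp (fst i))" for i :: "real \<times> bool"
  have inj: "inj g"
  proof (rule injI)
    fix i j assume eq: "g i = g j"
    have "exp x \<noteq> - exp y" "- exp x \<noteq> exp y" for x y :: real using exp_gt_zero[of x] exp_gt_zero[of y] by linarith+
    then show "i = j" using eq unfolding g_def by (cases "snd i"; cases "snd j") (auto simp: prod_eq_iff)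
  qed
  have img: "g ` two_idx P Q = ?A"
  proof (intro equalityI subsetI)
    fix a assume "a \<in> g ` two_idx P Q"
    then show "a \<in> ?A" unfolding g_def two_idx_def by (auto split: if_splits)
  next
    fix a assume "a \<in> ?A"
    then consider p where "p \<in> P" "a = exp p" | q where "q \<in> Q" "a = - exp q" by blast
    then show "a \<in> g ` two_idx P Q"
    proof cases
      case 1
      then show ?thesis by (intro image_eqI[of _ _ "(p, True)"]) (auto simp: g_def two_idx_def)
    next
      case 2
      then show ?thesis by (intro image_eqI[of _ _ "(q, False)"]) (auto simp: g_def two_idx_def)
    qed
  qed
  have ex1: "(\<exists>!a. a \<in> ?A \<and> inverse a * x \<in> \<Omega>) \<longleftrightarrow> (\<exists>!i. i \<in> two_idx P Q \<and> inverse (g i) * x \<in> \<Omega>)" for x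
  proof -
    have "{a. a \<in> ?A \<and> inverse a * x \<in> \<Omega>} = g ` {i. i \<in> two_idx P Q \<and> inverse (g i) * x \<in> \<Omega>}"
      unfolding img[symmetric] by auto
    moreover have "card (g ` {i. i \<in> two_idx P Q \<and> inverse (g i) * x \<in> \<Omega>}) = card {i. i \<in> two_idx P Q \<and> inverse (g i) * x \<in> \<Omega>}"
      by (rule card_image) (rule inj_on_subset[OF inj subset_UNIV])
    ultimately have "card {a. a \<in> ?A \<and> inverse a * x \<in> \<Omega>} = 1 \<longleftrightarrow> card {i. i \<in> two_idx P Q \<and> inverse (g i) * x \<in> \<Omega>} = 1"
      by (simp only:)
    then show ?thesis unfolding card_Collect_eq_1_iff .
  qed
  have 1: "inverse (g i) * exp y \<in> \<Omega> \<longleftrightarrow> y - fst i \<in> (if snd i then ln ` pos_half \<Omega> else ln ` neg_half \<Omega>)" for i y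
  proof (cases "snd i")
    case True
    then have "inverse (g i) * exp y = exp (y - fst i)" unfolding g_def by (simp add: exp_diff field_simps)
    then show ?thesis using True by (simp only: if_True mem_ln_halves)
  next
    case False
    then have "inverse (g i) * exp y = - exp (y - fst i)" unfolding g_def by (simp add: exp_diff field_simps)
    then show ?thesis using False by (simp only: if_False mem_ln_halves)
  qed
  have 2: "inverse (g i) * - exp y \<in> \<Omega> \<longleftrightarrow> y - fst i \<in> (if snd i then ln ` neg_half \<Omega> else ln ` pos_half \<Omega>)" for i y
  proof (cases "snd i")
    case True
    then have "inverse (g i) * - exp y = - exp (y - fst i)" unfolding g_def by (simp add: exp_diff field_simps)
    then show ?thesis using True by (simp only: if_True mem_ln_halves)
  next
    case False
    then have "inverse (g i) * - exp y = exp (y - fst i)" unfolding g_def by (simp add: exp_diff field_simps)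
    then show ?thesis using False by (simp only: if_False mem_ln_halves)
  qed
  show ?thesis
    unfolding has_sum_indicator_one_iff ex1 sheet_def fam_tiling_def
    by (subst AE_lebesgue_exp_iff) (simp only: 1 2)
qed

text \<open>Boundedness of the tile bounds its logarithms above, and the gap around 0 bounds them
  below.\<close>

lemma lmeasurable_ln_halves:
  assumes b: "bounded \<Omega>" and m: "\<Omega> \<in> sets lebesgue" and e: "e > 0" "\<Omega> \<inter> {-e<..<e} = {}"
  obtains L where "ln ` pos_half \<Omega> \<in> lmeasurable" "ln ` neg_half \<Omega> \<in> lmeasurable"
    "ln ` pos_half \<Omega> \<subseteq> {-L..L}" "ln ` neg_half \<Omega> \<subseteq> {-L..L}"
proof -
  obtain M where M: "\<And>x. x \<in> \<Omega> \<Longrightarrow> \<bar>x\<bar> \<le> M" using b unfolding bounded_iff by auto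
  have d: "ln differentiable_on S" if "S \<subseteq> {0<..}" for S :: "real set"
    using that by (intro differentiable_at_imp_differentiable_on) (auto simp: real_differentiable_def intro: DERIV_ln)
  have pm: "pos_half \<Omega> \<in> sets lebesgue" unfolding pos_half_def using m by (intro sets.Int) auto
  have "\<Omega> \<inter> {..<0} \<in> sets lebesgue" using m by (intro sets.Int) auto
  then have nm: "neg_half \<Omega> \<in> sets lebesgue"
    unfolding neg_half_def by (rule differentiable_image_in_sets_lebesgue) (auto intro!: derivative_intros)
  have sets: "ln ` pos_half \<Omega> \<in> sets lebesgue" "ln ` neg_half \<Omega> \<in> sets lebesgue"
    using pm nm by (auto intro!: differentiable_image_in_sets_lebesgue d simp: pos_half_def neg_half_def)
  define L where "L = \<bar>ln e\<bar> + \<bar>ln (\<bar>M\<bar> + 1)\<bar>"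
  have "z \<in> {-L..L}" if "exp z \<in> \<Omega> \<or> - exp z \<in> \<Omega>" for z
  proof -
    have "exp z \<le> \<bar>M\<bar> + 1" using M that by fastforce
    then have 1: "z \<le> ln (\<bar>M\<bar> + 1)" by (subst ln_ge_iff) auto
    have "e \<le> exp z"
    proof (rule ccontr)
      assume "\<not> e \<le> exp z"
      then have "exp z \<in> {-e<..<e}" "- exp z \<in> {-e<..<e}" using exp_gt_zero[of z] e(1) by (auto simp del: exp_gt_zero)
      then show False using that e(2) by blast
    qed
    then have "ln e \<le> z" using e(1) by (metis ln_exp ln_mono exp_gt_zero)
    then show ?thesis using 1 unfolding L_def atLeastAtMost_iff by linarith
  qed
  then have sub: "ln ` pos_half \<Omega> \<subseteq> {-L..L}" "ln ` neg_half \<Omega> \<subseteq> {-L..L}" unfolding subset_iff mem_ln_halves by blast+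
  then have "bounded (ln ` pos_half \<Omega>)" "bounded (ln ` neg_half \<Omega>)" using bounded_closed_interval bounded_subset by blast+
  then show ?thesis
    using that[OF _ _ sub] sets by (auto simp: bounded_set_imp_lmeasurable)
qed

lemma essentially_symmetric_iff:
  assumes m: "\<Omega> \<in> sets lebesgue"
  shows "essentially_symmetric \<Omega> \<longleftrightarrow> (AE y in lebesgue. y \<in> ln ` pos_half \<Omega> \<longleftrightarrow> y \<in> ln ` neg_half \<Omega>)"
proof -
  have pm: "pos_half \<Omega> \<in> sets lebesgue" unfolding pos_half_def using m by (intro sets.Int) auto
  have "\<Omega> \<inter> {..<0} \<in> sets lebesgue" using m by (intro sets.Int) auto
  then have nm: "neg_half \<Omega> \<in> sets lebesgue"
    unfolding neg_half_def by (rule differentiable_image_in_sets_lebesgue) (auto intro!: derivative_intros)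
  have "essentially_symmetric \<Omega> \<longleftrightarrow> sym_diff (pos_half \<Omega>) (neg_half \<Omega>) \<in> null_sets lebesgue"
    unfolding essentially_symmetric_def using pm nm by (simp only: null_sets_def) auto
  also have "\<dots> \<longleftrightarrow> (AE x in lebesgue. x \<notin> sym_diff (pos_half \<Omega>) (neg_half \<Omega>))"
    using pm nm by (intro AE_iff_null_sets) auto
  also have "\<dots> \<longleftrightarrow> (AE y in lebesgue. exp y \<notin> sym_diff (pos_half \<Omega>) (neg_half \<Omega>))"
  proof -
    have "- exp y \<notin> sym_diff (pos_half \<Omega>) (neg_half \<Omega>)" for y
      using exp_gt_zero[of y] unfolding pos_half_def neg_half_def by auto
    then show ?thesis by (subst AE_lebesgue_exp_iff) simp
  qed
  also have "\<dots> \<longleftrightarrow> (AE y in lebesgue. y \<in> ln ` pos_half \<Omega> \<longleftrightarrow> y \<in> ln ` neg_half \<Omega>)"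
  proof -
    have "exp y \<in> pos_half \<Omega> \<longleftrightarrow> exp y \<in> \<Omega>" "exp y \<in> neg_half \<Omega> \<longleftrightarrow> - exp y \<in> \<Omega>" for y
      unfolding pos_half_def neg_half_def by (auto intro!: image_eqI[of _ _ "- exp y"])
    then have "exp y \<notin> sym_diff (pos_half \<Omega>) (neg_half \<Omega>) \<longleftrightarrow> (exp y \<in> \<Omega> \<longleftrightarrow> - exp y \<in> \<Omega>)" for y by blast
    then show ?thesis unfolding mem_ln_halves by (simp only:)
  qed
  finally show ?thesis .
qed

lemma null_tile_iff:
  fixes F :: "real set"
  assumes "F \<in> lmeasurable"
  shows "(AE x in lebesgue. x \<notin> F) \<longleftrightarrow> measure lebesgue F = 0"
  unfolding AE_lebesgue_iff_negligible using assms by (simp add: negligible_iff_measure)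

text \<open>\<open>P\<close> and \<open>Q\<close> now tile separately by \<open>F\<close>. Both
  periods are integer multiples of the measure of \<open>F\<close>, so crosswise multiplication
  makes them equal.\<close>

lemma one_null_tile_rational_periodic:
  assumes F: "F \<in> lmeasurable" "F \<subseteq> {-L..L}" "measure lebesgue F > 0" and G: "AE x in lebesgue. x \<notin> G"
    and s: "sheet P Q F G" "sheet Q P F G" and c: "countable P" "countable Q"
  shows "\<exists>\<alpha>. rational_periodic \<alpha> P \<and> rational_periodic \<alpha> Q"
proof -
  obtain \<tau> n where P: "\<tau> > 0" "n > 0" "\<tau> = real n * measure lebesgue F" "\<And>m. m > 0 \<Longrightarrow> rational_periodic (real m * \<tau>) P"
    by (rule single_tile_rational_periodic[OF F sheet_null_second[OF s(1) c G]]) (rule that)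
  obtain \<tau>' n' where Q: "\<tau>' > 0" "n' > 0" "\<tau>' = real n' * measure lebesgue F" "\<And>m. m > 0 \<Longrightarrow> rational_periodic (real m * \<tau>') Q"
    by (rule single_tile_rational_periodic[OF F sheet_null_second[OF s(2) c(2,1) G]]) (rule that)
  have "real n' * \<tau> = real n * \<tau>'" unfolding P(3) Q(3) by simp
  then show ?thesis using P(4)[OF Q(2)] Q(4)[OF P(2)] by (intro exI[of _ "real n' * \<tau>"]) simp
qed

text \<open>Exponentials of a uniformly discrete set may accumulate at 0, so only isolation of each
  point survives; it follows from continuity of \<open>ln\<close>.\<close>

lemma discrete_exp_union:
  assumes S: "uniform_discrete S1" "uniform_discrete S2"
  shows "discrete (exp ` S1 \<union> uminus ` exp ` S2 :: real set)"
proof -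
  have iso: "\<exists>e>0. \<forall>y\<in>exp ` U \<union> uminus ` exp ` V. dist (exp p) y < e \<longrightarrow> y = exp p"
    if U: "uniform_discrete U" and p: "p \<in> U" for U V :: "real set" and p
  proof -
    obtain d where d: "d > 0" "\<And>u w. u \<in> U \<Longrightarrow> w \<in> U \<Longrightarrow> dist u w < d \<Longrightarrow> u = w"
      using U unfolding uniform_discrete_def by blast
    have "isCont ln (exp p)" by (rule isCont_ln) simp
    then obtain e where e: "e > 0" "\<And>y. dist y (exp p) < e \<Longrightarrow> dist (ln y) (ln (exp p)) < d"
      unfolding continuous_at_eps_delta using d(1) by (auto simp: dist_real_def)
    \<comment> \<open>A radius of at most \<open>exp p\<close> excludes the points of the negative
      half.\<close>
    have "y = exp p" if y: "y \<in> exp ` U \<union> uminus ` exp ` V" "dist (exp p) y < min e (exp p)" for y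
    proof -
      have "y > 0" using y(2) unfolding dist_real_def by linarith
      moreover have "- exp v \<le> 0" for v :: real by simp
      ultimately obtain u where u: "u \<in> U" "y = exp u" using y(1) by force
      have "dist (ln y) (ln (exp p)) < d" using y(2) by (intro e(2)) (simp add: dist_commute)
      then have "u = p" using d(2)[OF u(1) p] u(2) by simp
      then show ?thesis using u(2) by simp
    qed
    then show ?thesis using e(1) by (intro exI[of _ "min e (exp p)"]) auto
  qed
  have "\<exists>e>0. \<forall>y\<in>exp ` S1 \<union> uminus ` exp ` S2. dist a y < e \<longrightarrow> y = a"
    if a: "a \<in> exp ` S1 \<union> uminus ` exp ` S2" for a :: real
  proof -
    from a consider p where "p \<in> S1" "a = exp p" | q where "q \<in> S2" "a = - exp q" by blast
    then show ?thesis
    proof cases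
      case 1
      then show ?thesis using iso[OF S(1) 1(1), of S2] by simp
    next
      case 2
      obtain e where e: "e > 0" "\<And>y. y \<in> exp ` S2 \<union> uminus ` exp ` S1 \<Longrightarrow> dist (exp q) y < e \<Longrightarrow> y = exp q"
        using iso[OF S(2) 2(1), of S1] by blast
      have "y = a" if y: "y \<in> exp ` S1 \<union> uminus ` exp ` S2" "dist a y < e" for y
      proof -
        have "- y \<in> exp ` S2 \<union> uminus ` exp ` S1" using y(1) by (auto simp: image_image)
        moreover have "dist (exp q) (- y) < e" using y(2) unfolding 2(2) dist_real_def by linarith
        ultimately have "- y = exp q" by (rule e(2))
        then show ?thesis unfolding 2(2) by simp
      qed
      then show ?thesis using e(1) by blast
    qed
  qed
  then show ?thesis unfolding discrete_def isolated_in_dist_Ex_iff by blast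
qed

theorem theorem2:
  fixes \<Omega> A :: "real set"
  assumes "bounded \<Omega>"
    and "\<Omega> \<in> sets lebesgue"
    and "\<exists>\<epsilon>>0. \<Omega> \<inter> {-\<epsilon><..<\<epsilon>} = {}"
    and "A \<subseteq> UNIV - {0}"
    and "discrete A"
    and "mult_tiling A \<Omega>"
  shows "(essentially_symmetric \<Omega> \<longrightarrow>
            pos_half A \<inter> neg_half A = {} \<and>
            (\<exists>\<alpha>. rational_periodic \<alpha> (ln ` pos_half A \<union> ln ` neg_half A)) \<and>
            (\<forall>Sp Sn. Sp \<union> Sn = ln ` pos_half A \<union> ln ` neg_half A \<and> Sp \<inter> Sn = {} \<longrightarrow>
               mult_tiling (exp ` Sp \<union> uminus ` exp ` Sn) \<Omega>)) \<and>
         (\<not> essentially_symmetric \<Omega> \<longrightarrow>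
            (\<exists>\<alpha>. rational_periodic \<alpha> (ln ` pos_half A) \<and>
                 rational_periodic \<alpha> (ln ` neg_half A)))"
proof -
  define P Q where "P = ln ` pos_half A" and "Q = ln ` neg_half A"
  define F G where "F = ln ` pos_half \<Omega>" and "G = ln ` neg_half \<Omega>"
  obtain e where e: "e > 0" "\<Omega> \<inter> {-e<..<e} = {}" using assms(3) by blast
  obtain L where FG: "F \<in> lmeasurable" "G \<in> lmeasurable" "F \<subseteq> {-L..L}" "G \<subseteq> {-L..L}"
    unfolding F_def G_def by (rule lmeasurable_ln_halves[OF assms(1,2) e])
  have A_eq: "exp ` P \<union> uminus ` exp ` Q = A"
  proof (intro equalityI subsetI)
    fix a assume "a \<in> exp ` P \<union> uminus ` exp ` Q"
    then show "a \<in> A" unfolding P_def Q_def pos_half_def neg_half_def by auto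
  next
    fix a assume a: "a \<in> A"
    then have "a \<noteq> 0" using assms(4) by blast
    then consider "a > 0" | "a < 0" by linarith
    then show "a \<in> exp ` P \<union> uminus ` exp ` Q"
    proof cases
      case 1
      then have "ln a \<in> P" "a = exp (ln a)" unfolding P_def pos_half_def using a by auto
      then show ?thesis by blast
    next
      case 2
      then have "- a \<in> neg_half A" unfolding neg_half_def using a by auto
      then have "ln (- a) \<in> Q" unfolding Q_def by (rule imageI)
      moreover have "a = - exp (ln (- a))" using 2 by simp
      ultimately show ?thesis by blast
    qed
  qed
  have s: "sheet P Q F G" "sheet P Q G F"
    using assms(6) tiling_iff_sheets[of \<Omega> P Q] unfolding mult_tiling_def A_eq F_def G_def by blast+
  have cA: "countable A" by (rule discrete_countable[OF assms(5)])
  have c: "countable P" "countable Q"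
    unfolding P_def Q_def pos_half_def neg_half_def using cA by auto
  have sym: "essentially_symmetric \<Omega> \<longleftrightarrow> (AE y in lebesgue. y \<in> F \<longleftrightarrow> y \<in> G)"
    unfolding F_def G_def by (rule essentially_symmetric_iff[OF assms(2)])
  have nonnull: "measure lebesgue F > 0 \<or> measure lebesgue G > 0"
  proof (rule ccontr)
    assume "\<not> ?thesis"
    then have "measure lebesgue F = 0" "measure lebesgue G = 0"
      using measure_nonneg[of lebesgue F] measure_nonneg[of lebesgue G] by linarith+
    then have "AE x in lebesgue. x \<in> F \<longleftrightarrow> x \<in> {}" "AE x in lebesgue. x \<in> G \<longleftrightarrow> x \<in> {}"
      using null_tile_iff[OF FG(1)] null_tile_iff[OF FG(2)] by simp_all
    then have "sheet P Q {} {}" by (rule sheet_AE_cong[OF s(1) c])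
    then have "AE x::real in lebesgue. False" unfolding sheet_def fam_tiling_def by (rule eventually_mono) auto
    then show False unfolding AE_lebesgue_iff_negligible by simp
  qed
  have part1: "pos_half A \<inter> neg_half A = {} \<and> (\<exists>\<alpha>. rational_periodic \<alpha> (P \<union> Q)) \<and>
      (\<forall>Sp Sn. Sp \<union> Sn = P \<union> Q \<and> Sp \<inter> Sn = {} \<longrightarrow> mult_tiling (exp ` Sp \<union> uminus ` exp ` Sn) \<Omega>)"
    if "essentially_symmetric \<Omega>"
  proof -
    have eq: "AE y in lebesgue. y \<in> F \<longleftrightarrow> y \<in> G" using that sym by blast
    have eq': "AE y in lebesgue. y \<in> F \<longleftrightarrow> y \<in> F" by simp
    have "measure lebesgue F = measure lebesgue G" using measure_eq_AE[OF eq] FG by auto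
    then have F0: "measure lebesgue F > 0" using nonnull by linarith
    have eq2: "AE y in lebesgue. y \<in> G \<longleftrightarrow> y \<in> F" using eq by eventually_elim simp
    have sFF: "sheet P Q F F" by (rule sheet_AE_cong[OF s(1) c eq' eq2])
    \<comment> \<open>A common point would give two indices carrying the same translate of
      \<open>F\<close>, which could then cover almost nothing.\<close>
    have disj: "P \<inter> Q = {}"
    proof (rule ccontr)
      assume "P \<inter> Q \<noteq> {}"
      then obtain p where p: "p \<in> P" "p \<in> Q" by blast
      have "AE x in lebesgue. x - p \<notin> F"
        using sFF unfolding sheet_def fam_tiling_def
      proof eventually_elim
        case (elim x)
        from elim obtain k where k: "\<forall>i. i \<in> two_idx P Q \<and> x - fst i \<in> (if snd i then F else F) \<longrightarrow> i = k"
          by (rule ex1E)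
        show ?case
        proof
          assume "x - p \<in> F"
          then have "(p, True) = k" "(p, False) = k" using k p by (simp_all add: two_idx_def)
          then show False by (metis prod.inject)
        qed
      qed
      from AE_lebesgue_shift[OF this, of p] have "AE x in lebesgue. x \<notin> F" by simp
      then show False using null_tile_iff[OF FG(1)] F0 by simp
    qed
    have "pos_half A \<inter> neg_half A = {}"
    proof (rule ccontr)
      assume "pos_half A \<inter> neg_half A \<noteq> {}"
      then obtain a where "a \<in> pos_half A" "a \<in> neg_half A" by blast
      then have "ln a \<in> P \<inter> Q" unfolding P_def Q_def by blast
      then show False using disj by blast
    qed
    \<comment> \<open>All translates are merged into one set with a single tile, so an empty second
      set replaces the difference equation.\<close>
    moreover have sS: "sheet (P \<union> Q) {} F F" by (rule sheet_repartition[OF sFF _ disj]) auto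
    have "\<exists>\<alpha>. rational_periodic \<alpha> (P \<union> Q)"
    proof -
      obtain \<tau> n where "\<And>m. m > 0 \<Longrightarrow> rational_periodic (real m * \<tau>) (P \<union> Q)"
        by (rule single_tile_rational_periodic[OF FG(1,3) F0 sS]) (rule that)
      from this[of 1] show ?thesis by auto
    qed
    moreover have "mult_tiling (exp ` Sp \<union> uminus ` exp ` Sn) \<Omega>" if S: "Sp \<union> Sn = P \<union> Q" "Sp \<inter> Sn = {}" for Sp Sn
    proof -
      have sF: "sheet Sp Sn F F" by (rule sheet_repartition[OF sFF S(1) disj S(2)])
      have "countable (Sp \<union> Sn)" unfolding S(1) using c by simp
      then have cS: "countable Sp" "countable Sn" by simp_all
      \<comment> \<open>Both sheets arise from the one with tiles \<open>F\<close> and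
        \<open>F\<close>, since \<open>G\<close> differs from \<open>F\<close> by a null
        set.\<close>
      have "sheet Sp Sn F G" by (rule sheet_AE_cong[OF sF cS eq' eq])
      moreover have "sheet Sp Sn G F" by (rule sheet_AE_cong[OF sF cS eq eq'])
      ultimately have "AE x in lebesgue. ((\<lambda>a. indicat_real \<Omega> (inverse a * x)) has_sum 1) (exp ` Sp \<union> uminus ` exp ` Sn)"
        unfolding tiling_iff_sheets F_def G_def by blast
      moreover have "uniform_discrete Sp" "uniform_discrete Sn"
        using sheet_uniform_discrete[OF sF FG(1) F0] sheet_uniform_discrete[OF sheet_swap[OF sF] FG(1) F0] by auto
      then have "discrete (exp ` Sp \<union> uminus ` exp ` Sn)" by (rule discrete_exp_union)
      moreover have "0 \<notin> exp ` Sp \<union> uminus ` exp ` Sn" by auto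
      ultimately show ?thesis unfolding mult_tiling_def using assms(2) by blast
    qed
    ultimately show ?thesis by blast
  qed
  have part2: "\<exists>\<alpha>. rational_periodic \<alpha> P \<and> rational_periodic \<alpha> Q" if "\<not> essentially_symmetric \<Omega>"
  proof -
    have ne: "\<not> (AE y in lebesgue. y \<in> F \<longleftrightarrow> y \<in> G)" using that sym by blast
    note s' = sheet_swap[OF s(2)] sheet_swap[OF s(1)]
    \<comment> \<open>With both tiles of positive measure a common exact period exists; a null tile
      decouples the two copies.\<close>
    consider "measure lebesgue F > 0" "measure lebesgue G > 0" | "measure lebesgue F > 0" "measure lebesgue G = 0"
      | "measure lebesgue F = 0" "measure lebesgue G > 0"
      using nonnull measure_nonneg[of lebesgue F] measure_nonneg[of lebesgue G] by linarith
    then show ?thesis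
    proof cases
      case 1
      obtain \<tau> where \<tau>: "\<tau> > 0" "\<And>x. x + \<tau> \<in> P \<longleftrightarrow> x \<in> P" "\<And>x. x + \<tau> \<in> Q \<longleftrightarrow> x \<in> Q"
        by (rule sheets_periodic[OF FG(1,3) 1(1) FG(2,4) 1(2) s disjI2[OF ne]]) (rule that)
      have "rational_periodic \<tau> P"
        by (rule sheets_rational_periodic[OF FG(1,3) 1(1) FG(2,4) s \<tau>])
      moreover have "rational_periodic \<tau> Q"
        by (rule sheets_rational_periodic[OF FG(1,3) 1(1) FG(2,4) s' \<tau>(1,3,2)])
      ultimately show ?thesis by blast
    next
      case 2
      then have "AE x in lebesgue. x \<notin> G" using null_tile_iff[OF FG(2)] by blast
      then show ?thesis by (rule one_null_tile_rational_periodic[OF FG(1,3) 2(1) _ s(1) s'(1) c])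
    next
      case 3
      then have "AE x in lebesgue. x \<notin> F" using null_tile_iff[OF FG(1)] by blast
      then show ?thesis by (rule one_null_tile_rational_periodic[OF FG(2,4) 3(2) _ s(2) s'(2) c])
    qed
  qed
  show ?thesis
    using part1 part2 unfolding P_def Q_def by blast
qed

end
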